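(* Let $X$ be a scheme and let $Q\colon\mathscr{M}\to\mathscr{L}$ be a binary quadratic $\mathscr{O}_X$-module, with even Clifford algebra $\mathscr{O}_Y=\mathrm{Clf}^0(Q)$. Then $Q$ is primitive if and only if the $\mathscr{O}_Y$-module $\mathrm{Clf}^1(Q)$ corresponding to it under the Clifford functor is invertible as an $\mathscr{O}_Y$-module.
   Context: A binary quadratic $\mathscr{O}_X$-module $Q\colon \mathscr{M}\to\mathscr{L}$ consists of a locally free $\mathscr{O}_X$-module $\mathscr{M}$ of rank $2$, an invertible $\mathscr{O}_X$-module $\mathscr{L}$, and a map $Q$ with $Q(rx)=r^2Q(x)$ and $Q(x+y)-Q(x)-Q(y)$ $\mathscr{O}_X$-bilinear. It is primitive if for each open $U\subseteq X$ the values $Q(x)$, $x\in\mathscr{M}(U)$, generate $\mathscr{L}(U)$ as an $\mathscr{O}_X(U)$-module. An $\mathscr{O}_Y$-module is invertible if it is locally free of rank $1$ (locally principal). The even Clifford algebra $\mathrm{Clf}^0(Q)$ is the quotient of $\bigoplus_{d\ge 0}\mathscr{M}^{\otimes 2d}\otimes(\mathscr{L}^\vee)^{\otimes d}$ by the two-sided ideal generated by $x\otimes x\otimes f-f(Q(x))$ and $x\otimes y\otimes y\otimes z\otimes f\otimes g-f(Q(y))\,x\otimes z\otimes g$; it is a commutative $\mathscr{O}_X$-algebra, locally free of rank $2$. The odd Clifford module $\mathrm{Clf}^1(Q)$ is the quotient of $\bigoplus_{d\text{ odd}}\mathscr{M}^{\otimes d}\otimes(\mathscr{L}^\vee)^{\otimes\lfloor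 d/2\rfloor}$ by the sub-bimodule generated by $x\otimes x\otimes y\otimes f-f(Q(x))y$ and $y\otimes x\otimes x\otimes f-f(Q(x))y$, regarded as a left $\mathrm{Clf}^0(Q)$-module. Locally, if $\mathscr{M}=Re_1\oplus Re_2$, $\mathscr{L}=Rf$ and $Q(xe_1+ye_2)=(ax^2+bxy+cy^2)f$, then with $\alpha=e_1e_2\otimes f^\vee$ one has $\mathrm{Clf}^0(Q)=R[\alpha]$, $\alpha^2-b\alpha+ac=0$, $\mathrm{Clf}^1(Q)=Re_1\oplus Re_2$, $\alpha e_1=be_1-ae_2$, $\alpha e_2=ce_1$.
   Formalization: "Primitive" is read locally: the values of Q generate L as a sheaf, not L(U) for every open U. With the literal condition the claim fails: on P^1, Q(x,y)=xy from O(-1)+O(3) to O(2) has Clf^1(Q) invertible but Q=0 on global sections. *)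

theory Defs
  imports "HOL-Analysis.Abstract_Topology" "HOL-Algebra.QuotRing" "HOL-Algebra.Module"
begin

section \<open>Sheaves of rings and modules\<close>

text \<open>
  A presheaf of algebraic structures: \<open>sec F U\<close> is the structure (a ring or module record)
  of sections over \<open>U\<close>, and \<open>res F U V\<close> is restriction from \<open>U\<close> to \<open>V \<subseteq> U\<close>. Only open sets matter.
\<close>

record ('x, 'a, 'z) presheaf =
  sec :: "'x set \<Rightarrow> ('a, 'z) ring_scheme"
  res :: "'x set \<Rightarrow> 'x set \<Rightarrow> 'a \<Rightarrow> 'a"

type_synonym ('x, 'r) ring_presheaf = "('x, 'r, unit) presheaf"

text \<open>In a presheaf of modules the fields \<^const>\<open>mult\<close> and \<^const>\<open>one\<close> of the section records
  carry no information.\<close>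

type_synonym ('x, 'r, 'm) module_presheaf = "('x, 'm, ('r, 'm, unit) module_ext) presheaf"

locale sheaf =
  fixes X :: "'x topology" and F :: "('x, 'a, 'z) presheaf"
  assumes res_closed:
      "\<lbrakk>openin X U; openin X V; V \<subseteq> U; s \<in> carrier (sec F U)\<rbrakk> \<Longrightarrow> res F U V s \<in> carrier (sec F V)"
    and res_id:
      "\<lbrakk>openin X U; s \<in> carrier (sec F U)\<rbrakk> \<Longrightarrow> res F U U s = s"
    and res_comp:
      "\<lbrakk>openin X U; openin X V; openin X W; W \<subseteq> V; V \<subseteq> U; s \<in> carrier (sec F U)\<rbrakk>
       \<Longrightarrow> res F V W (res F U V s) = res F U W s"
    and glueing:
      "\<lbrakk>\<And>U. U \<in> \<U> \<Longrightarrow> openin X U; \<And>U. U \<in> \<U> \<Longrightarrow> u U \<in> carrier (sec F U);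
        \<And>U V. \<lbrakk>U \<in> \<U>; V \<in> \<U>\<rbrakk> \<Longrightarrow> res F U (U \<inter> V) (u U) = res F V (U \<inter> V) (u V)\<rbrakk>
       \<Longrightarrow> \<exists>!t. t \<in> carrier (sec F (\<Union>\<U>)) \<and> (\<forall>U\<in>\<U>. res F (\<Union>\<U>) U t = u U)"

locale sheaf_of_rings = sheaf X OX
  for X :: "'x topology" and OX :: "('x, 'r) ring_presheaf" +
  assumes sec_cring: "openin X U \<Longrightarrow> cring (sec OX U)"
    and res_ring_hom:
      "\<lbrakk>openin X U; openin X V; V \<subseteq> U\<rbrakk> \<Longrightarrow> res OX U V \<in> ring_hom (sec OX U) (sec OX V)"

locale sheaf_of_modules = OX: sheaf_of_rings X OX + M: sheaf X M
  for X :: "'x topology" and OX :: "('x, 'r) ring_presheaf" and M :: "('x, 'r, 'm) module_presheaf" +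
  assumes sec_module: "openin X U \<Longrightarrow> Module.module (sec OX U) (sec M U)"
    and res_add:
      "\<lbrakk>openin X U; openin X V; V \<subseteq> U; s \<in> carrier (sec M U); t \<in> carrier (sec M U)\<rbrakk>
       \<Longrightarrow> res M U V (s \<oplus>\<^bsub>sec M U\<^esub> t) = res M U V s \<oplus>\<^bsub>sec M V\<^esub> res M U V t"
    and res_smult:
      "\<lbrakk>openin X U; openin X V; V \<subseteq> U; r \<in> carrier (sec OX U); s \<in> carrier (sec M U)\<rbrakk>
       \<Longrightarrow> res M U V (r \<odot>\<^bsub>sec M U\<^esub> s) = res OX U V r \<odot>\<^bsub>sec M V\<^esub> res M U V s"


subsection \<open>Stalks and sheafification\<close>

definition germ ::
    "'x topology \<Rightarrow> ('x, 'a, 'z) presheaf \<Rightarrow> 'x \<Rightarrow> 'x set \<Rightarrow> 'a \<Rightarrow> ('x set \<times> 'a) set" where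
  "germ X F p U s =
     {(V, t). openin X V \<and> p \<in> V \<and> t \<in> carrier (sec F V) \<and>
        (\<exists>W. openin X W \<and> p \<in> W \<and> W \<subseteq> U \<inter> V \<and> res F U W s = res F V W t)}"

text \<open>The operation on germs at \<open>p\<close> induced by operations \<open>f U\<close> on sections over \<open>U\<close>.\<close>

definition germ_op ::
    "'x topology \<Rightarrow> ('x, 'a, 'y) presheaf \<Rightarrow> ('x, 'b, 'z) presheaf \<Rightarrow> 'x \<Rightarrow>
     ('x set \<Rightarrow> 'a \<Rightarrow> 'b \<Rightarrow> 'b) \<Rightarrow> ('x set \<times> 'a) set \<Rightarrow> ('x set \<times> 'b) set \<Rightarrow> ('x set \<times> 'b) set" where
  "germ_op X F G p f A B =
     (\<Union>(U, s)\<in>A. \<Union>(V, t)\<in>B. germ X G p (U \<inter> V) (f (U \<inter> V) (res F U (U \<inter> V) s) (res G V (U \<inter> V) t)))"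

definition stalk :: "'x topology \<Rightarrow> ('x, 'a, 'z) presheaf \<Rightarrow> 'x \<Rightarrow> ('x set \<times> 'a) set ring" where
  "stalk X F p =
     \<lparr>carrier = {germ X F p U s | U s. openin X U \<and> p \<in> U \<and> s \<in> carrier (sec F U)},
      mult = germ_op X F F p (\<lambda>U. mult (sec F U)),
      one = germ X F p (topspace X) (one (sec F (topspace X))),
      zero = germ X F p (topspace X) (zero (sec F (topspace X))),
      add = germ_op X F F p (\<lambda>U. add (sec F U))\<rparr>"

definition sheafify_sec ::
    "'x topology \<Rightarrow> ('x, 'a, 'z) presheaf \<Rightarrow> 'x set \<Rightarrow> ('x \<Rightarrow> ('x set \<times> 'a) set) ring" where
  "sheafify_sec X F U =
     \<lparr>carrier = {\<sigma> \<in> extensional U. \<forall>p\<in>U. \<exists>V s. openin X V \<and> p \<in> V \<and> V \<subseteq> U \<and>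
                   s \<in> carrier (sec F V) \<and> (\<forall>q\<in>V. \<sigma> q = germ X F q V s)},
      mult = (\<lambda>\<sigma> \<tau>. \<lambda>p\<in>U. \<sigma> p \<otimes>\<^bsub>stalk X F p\<^esub> \<tau> p),
      one = (\<lambda>p\<in>U. \<one>\<^bsub>stalk X F p\<^esub>),
      zero = (\<lambda>p\<in>U. \<zero>\<^bsub>stalk X F p\<^esub>),
      add = (\<lambda>\<sigma> \<tau>. \<lambda>p\<in>U. \<sigma> p \<oplus>\<^bsub>stalk X F p\<^esub> \<tau> p)\<rparr>"

definition sheafify_ring ::
    "'x topology \<Rightarrow> ('x, 'a, 'z) presheaf \<Rightarrow> ('x, 'x \<Rightarrow> ('x set \<times> 'a) set) ring_presheaf" where
  "sheafify_ring X F = \<lparr>sec = sheafify_sec X F, res = (\<lambda>U V \<sigma>. restrict \<sigma> V)\<rparr>"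

text \<open>Sheafification of a presheaf \<open>N\<close> of modules over a presheaf \<open>A\<close> of rings, as a module over
  the sheafification of \<open>A\<close>.\<close>

definition sheafify_module ::
    "'x topology \<Rightarrow> ('x, 'a) ring_presheaf \<Rightarrow> ('x, 'a, 'm) module_presheaf \<Rightarrow>
     ('x, 'x \<Rightarrow> ('x set \<times> 'a) set, 'x \<Rightarrow> ('x set \<times> 'm) set) module_presheaf" where
  "sheafify_module X A N =
     \<lparr>sec = (\<lambda>U. ring.extend (sheafify_sec X N U)
              (module.fields (\<lambda>\<sigma> \<tau>. \<lambda>p\<in>U. germ_op X A N p (\<lambda>V. smult (sec N V)) (\<sigma> p) (\<tau> p)))),
      res = (\<lambda>U V \<sigma>. restrict \<sigma> V)\<rparr>"


subsection \<open>Locally free sheaves\<close>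

text \<open>\<open>N\<close> restricted to \<open>U\<close> is free of rank \<open>n\<close> over \<open>A\<close>: some sections \<open>e 0, \<dots>, e (n - 1)\<close> of \<open>N\<close>
  over \<open>U\<close> define an isomorphism of sheaves of modules from the \<open>n\<close>-th power of \<open>A\<close> to \<open>N\<close> on \<open>U\<close>
  (every morphism out of a finite power of \<open>A\<close> on \<open>U\<close> is given by such sections).\<close>

definition free_of_rank_on ::
    "nat \<Rightarrow> 'x topology \<Rightarrow> ('x, 'a) ring_presheaf \<Rightarrow> ('x, 'a, 'm) module_presheaf \<Rightarrow> 'x set \<Rightarrow> bool" where
  "free_of_rank_on n X A N U \<longleftrightarrow>
     (\<exists>e. e \<in> {..<n} \<rightarrow> carrier (sec N U) \<and>
       (\<forall>V. openin X V \<and> V \<subseteq> U \<longrightarrow>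
         bij_betw (\<lambda>c. \<Oplus>\<^bsub>sec N V\<^esub>i\<in>{..<n}. c i \<odot>\<^bsub>sec N V\<^esub> res N U V (e i))
           ({..<n} \<rightarrow>\<^sub>E carrier (sec A V)) (carrier (sec N V))))"

definition locally_free_of_rank ::
    "nat \<Rightarrow> 'x topology \<Rightarrow> ('x, 'a) ring_presheaf \<Rightarrow> ('x, 'a, 'm) module_presheaf \<Rightarrow> bool" where
  "locally_free_of_rank n X A N \<longleftrightarrow>
     (\<forall>p\<in>topspace X. \<exists>U. openin X U \<and> p \<in> U \<and> free_of_rank_on n X A N U)"

definition invertible_module ::
    "'x topology \<Rightarrow> ('x, 'a) ring_presheaf \<Rightarrow> ('x, 'a, 'm) module_presheaf \<Rightarrow> bool" where
  "invertible_module X A N \<longleftrightarrow> locally_free_of_rank 1 X A N"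


section \<open>Schemes\<close>

definition local_ring :: "('a, 'b) ring_scheme \<Rightarrow> bool" where
  "local_ring R \<longleftrightarrow> cring R \<and> (\<exists>!I. maximalideal I R)"

locale locally_ringed_space = sheaf_of_rings +
  assumes stalk_local: "p \<in> topspace X \<Longrightarrow> local_ring (stalk X OX p)"

definition zariski :: "('r, 'z) ring_scheme \<Rightarrow> 'r set topology" where
  "zariski R = topology_generated_by {{P. primeideal P R \<and> f \<notin> P} | f. f \<in> carrier R}"

text \<open>The fraction \<open>a / s\<close> in the localization of \<open>R\<close> at the prime ideal \<open>P\<close>, as an equivalence class
  of pairs.\<close>

definition fraction :: "('r, 'z) ring_scheme \<Rightarrow> 'r set \<Rightarrow> 'r \<Rightarrow> 'r \<Rightarrow> ('r \<times> 'r) set" where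
  "fraction R P a s =
     {(b, t). b \<in> carrier R \<and> t \<in> carrier R - P \<and>
        (\<exists>u\<in>carrier R - P. u \<otimes>\<^bsub>R\<^esub> (a \<otimes>\<^bsub>R\<^esub> t) = u \<otimes>\<^bsub>R\<^esub> (b \<otimes>\<^bsub>R\<^esub> s))}"

definition localization :: "('r, 'z) ring_scheme \<Rightarrow> 'r set \<Rightarrow> ('r \<times> 'r) set ring" where
  "localization R P =
     \<lparr>carrier = {fraction R P a s | a s. a \<in> carrier R \<and> s \<in> carrier R - P},
      mult = (\<lambda>A B. \<Union>(a, s)\<in>A. \<Union>(b, t)\<in>B. fraction R P (a \<otimes>\<^bsub>R\<^esub> b) (s \<otimes>\<^bsub>R\<^esub> t)),
      one = fraction R P \<one>\<^bsub>R\<^esub> \<one>\<^bsub>R\<^esub>,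
      zero = fraction R P \<zero>\<^bsub>R\<^esub> \<one>\<^bsub>R\<^esub>,
      add = (\<lambda>A B. \<Union>(a, s)\<in>A. \<Union>(b, t)\<in>B.
               fraction R P (a \<otimes>\<^bsub>R\<^esub> t \<oplus>\<^bsub>R\<^esub> b \<otimes>\<^bsub>R\<^esub> s) (s \<otimes>\<^bsub>R\<^esub> t))\<rparr>"

definition spec_sheaf ::
    "('r, 'z) ring_scheme \<Rightarrow> ('r set, 'r set \<Rightarrow> ('r \<times> 'r) set) ring_presheaf" where
  "spec_sheaf R =
     \<lparr>sec = (\<lambda>U. \<lparr>carrier = {\<sigma> \<in> extensional U. \<forall>P\<in>U. \<exists>V a s. openin (zariski R) V \<and> P \<in> V \<and> V \<subseteq> U \<and>
                     a \<in> carrier R \<and> s \<in> carrier R \<and> (\<forall>P'\<in>V. s \<notin> P' \<and> \<sigma> P' = fraction R P' a s)},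
                  mult = (\<lambda>\<sigma> \<tau>. \<lambda>P\<in>U. \<sigma> P \<otimes>\<^bsub>localization R P\<^esub> \<tau> P),
                  one = (\<lambda>P\<in>U. \<one>\<^bsub>localization R P\<^esub>),
                  zero = (\<lambda>P\<in>U. \<zero>\<^bsub>localization R P\<^esub>),
                  add = (\<lambda>\<sigma> \<tau>. \<lambda>P\<in>U. \<sigma> P \<oplus>\<^bsub>localization R P\<^esub> \<tau> P)\<rparr>),
      res = (\<lambda>U V \<sigma>. restrict \<sigma> V)\<rparr>"

text \<open>An isomorphism of ringed spaces between locally ringed spaces is automatically local on stalks.\<close>

definition ringed_space_isomorphic ::
    "'x topology \<Rightarrow> ('x, 'r) ring_presheaf \<Rightarrow> 'y topology \<Rightarrow> ('y, 's) ring_presheaf \<Rightarrow> bool" where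
  "ringed_space_isomorphic X OX Y OY \<longleftrightarrow>
     (\<exists>\<phi> \<theta>. homeomorphic_map X Y \<phi> \<and>
        (\<forall>V. openin Y V \<longrightarrow> \<theta> V \<in> ring_iso (sec OY V) (sec OX {p \<in> topspace X. \<phi> p \<in> V})) \<and>
        (\<forall>V W. openin Y V \<and> openin Y W \<and> W \<subseteq> V \<longrightarrow>
           (\<forall>s\<in>carrier (sec OY V).
              \<theta> W (res OY V W s) = res OX {p \<in> topspace X. \<phi> p \<in> V} {p \<in> topspace X. \<phi> p \<in> W} (\<theta> V s))))"

text \<open>If \<open>U\<close> is isomorphic to the spectrum of some ring, then that ring is isomorphic to the ring of
  sections over \<open>U\<close>; so it is no restriction that \<open>R\<close> has the element type of \<open>OX\<close>.\<close>

locale scheme = locally_ringed_space X OX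
  for X :: "'x topology" and OX :: "('x, 'r) ring_presheaf" +
  assumes locally_affine:
    "p \<in> topspace X \<Longrightarrow> \<exists>U (R :: 'r ring). openin X U \<and> p \<in> U \<and> cring R \<and>
       ringed_space_isomorphic (subtopology X U) OX (zariski R) (spec_sheaf R)"


section \<open>Binary quadratic modules\<close>

locale binary_quadratic_module =
  M: sheaf_of_modules X OX M + L: sheaf_of_modules X OX L
  for X :: "'x topology" and OX :: "('x, 'r) ring_presheaf"
    and M :: "('x, 'r, 'm) module_presheaf" and L :: "('x, 'r, 'l) module_presheaf"
    and Q :: "'x set \<Rightarrow> 'm \<Rightarrow> 'l" +
  assumes M_locally_free: "locally_free_of_rank 2 X OX M"
    and L_invertible: "invertible_module X OX L"
    and Q_closed: "\<lbrakk>openin X U; x \<in> carrier (sec M U)\<rbrakk> \<Longrightarrow> Q U x \<in> carrier (sec L U)"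
    and Q_res:
      "\<lbrakk>openin X U; openin X V; V \<subseteq> U; x \<in> carrier (sec M U)\<rbrakk> \<Longrightarrow> Q V (res M U V x) = res L U V (Q U x)"
    and Q_smult:
      "\<lbrakk>openin X U; r \<in> carrier (sec OX U); x \<in> carrier (sec M U)\<rbrakk>
       \<Longrightarrow> Q U (r \<odot>\<^bsub>sec M U\<^esub> x) = (r [^]\<^bsub>sec OX U\<^esub> (2::nat)) \<odot>\<^bsub>sec L U\<^esub> Q U x"
    and Q_bilinear:
      "\<And>U B r x y z. \<lbrakk>openin X U;
          B = (\<lambda>x y. Q U (x \<oplus>\<^bsub>sec M U\<^esub> y) \<ominus>\<^bsub>sec L U\<^esub> Q U x \<ominus>\<^bsub>sec L U\<^esub> Q U y);
          r \<in> carrier (sec OX U); x \<in> carrier (sec M U); y \<in> carrier (sec M U); z \<in> carrier (sec M U)\<rbrakk>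
       \<Longrightarrow> B (x \<oplus>\<^bsub>sec M U\<^esub> y) z = B x z \<oplus>\<^bsub>sec L U\<^esub> B y z \<and>
           B z (x \<oplus>\<^bsub>sec M U\<^esub> y) = B z x \<oplus>\<^bsub>sec L U\<^esub> B z y \<and>
           B (r \<odot>\<^bsub>sec M U\<^esub> x) z = r \<odot>\<^bsub>sec L U\<^esub> B x z \<and>
           B z (r \<odot>\<^bsub>sec M U\<^esub> x) = r \<odot>\<^bsub>sec L U\<^esub> B z x"

definition generated_submodule ::
    "('a, 'b) ring_scheme \<Rightarrow> ('a, 'm, 'c) module_scheme \<Rightarrow> 'm set \<Rightarrow> 'm set" where
  "generated_submodule R M S = \<Inter>{H. submodule H R M \<and> S \<subseteq> H}"

text \<open>
  \<open>Q\<close> is primitive if its values generate \<open>L\<close> as a sheaf of modules: over each open \<open>U\<close>, the sections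
  of the subsheaf of modules generated by the values of \<open>Q\<close> are all sections of \<open>L\<close>. Demanding that
  the values on global sections over \<open>U\<close> already span \<open>sec L U\<close> as a module over \<open>sec OX U\<close> is the
  same for affine \<open>U\<close>, but too strong for arbitrary \<open>U\<close>: on the projective line, the product
  \<open>O(-1) \<oplus> O(3) \<rightarrow> O(2)\<close> is locally the form \<open>x y\<close>, yet vanishes on all global sections.
\<close>

definition primitive ::
    "'x topology \<Rightarrow> ('x, 'r) ring_presheaf \<Rightarrow> ('x, 'r, 'm) module_presheaf \<Rightarrow>
     ('x, 'r, 'l) module_presheaf \<Rightarrow> ('x set \<Rightarrow> 'm \<Rightarrow> 'l) \<Rightarrow> bool" where
  "primitive X OX M L Q \<longleftrightarrow>
     (\<forall>U. openin X U \<longrightarrow>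
        {s \<in> carrier (sec L U). \<forall>p\<in>U. \<exists>V. openin X V \<and> p \<in> V \<and> V \<subseteq> U \<and>
           res L U V s \<in> generated_submodule (sec OX V) (sec L V) (Q V ` carrier (sec M V))}
        = carrier (sec L U))"

text \<open>The dual of \<open>L\<close>: a section over \<open>U\<close> is a morphism of sheaves of modules from \<open>L\<close> to \<open>OX\<close> on \<open>U\<close>.\<close>

definition dual_sheaf ::
    "'x topology \<Rightarrow> ('x, 'r) ring_presheaf \<Rightarrow> ('x, 'r, 'l) module_presheaf \<Rightarrow>
     ('x, 'r, 'x set \<Rightarrow> 'l \<Rightarrow> 'r) module_presheaf" where
  "dual_sheaf X OX L =
     \<lparr>sec = (\<lambda>U.
        \<lparr>carrier = {\<phi> \<in> (\<Pi>\<^sub>E V\<in>{V. openin X V \<and> V \<subseteq> U}. carrier (sec L V) \<rightarrow>\<^sub>E carrier (sec OX V)).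
            (\<forall>V. openin X V \<and> V \<subseteq> U \<longrightarrow>
               (\<forall>x\<in>carrier (sec L V). \<forall>y\<in>carrier (sec L V).
                  \<phi> V (x \<oplus>\<^bsub>sec L V\<^esub> y) = \<phi> V x \<oplus>\<^bsub>sec OX V\<^esub> \<phi> V y) \<and>
               (\<forall>r\<in>carrier (sec OX V). \<forall>x\<in>carrier (sec L V).
                  \<phi> V (r \<odot>\<^bsub>sec L V\<^esub> x) = r \<otimes>\<^bsub>sec OX V\<^esub> \<phi> V x)) \<and>
            (\<forall>V W. openin X V \<and> openin X W \<and> W \<subseteq> V \<and> V \<subseteq> U \<longrightarrow>
               (\<forall>x\<in>carrier (sec L V). \<phi> W (res L V W x) = res OX V W (\<phi> V x)))},
         mult = undefined,
         one = undefined,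
         zero = (\<lambda>V\<in>{V. openin X V \<and> V \<subseteq> U}. \<lambda>x\<in>carrier (sec L V). \<zero>\<^bsub>sec OX V\<^esub>),
         add = (\<lambda>\<phi> \<psi>. \<lambda>V\<in>{V. openin X V \<and> V \<subseteq> U}. \<lambda>x\<in>carrier (sec L V). \<phi> V x \<oplus>\<^bsub>sec OX V\<^esub> \<psi> V x),
         smult = (\<lambda>r \<phi>. \<lambda>V\<in>{V. openin X V \<and> V \<subseteq> U}. \<lambda>x\<in>carrier (sec L V).
                    res OX U V r \<otimes>\<^bsub>sec OX V\<^esub> \<phi> V x)\<rparr>),
      res = (\<lambda>U V \<phi>. restrict \<phi> {W. openin X W \<and> W \<subseteq> V})\<rparr>"


section \<open>Tensor algebras\<close>

text \<open>
  For modules \<open>M\<close> and \<open>N\<close> over a commutative ring \<open>R\<close>, the direct sum of all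
  \<open>M\<^sup>\<otimes>\<^sup>i \<otimes> N\<^sup>\<otimes>\<^sup>j\<close> is built as a quotient of the free \<open>R\<close>-module on the words
  \<open>(xs, fs)\<close> with \<open>xs\<close> a list over \<open>M\<close> and \<open>fs\<close> a list over \<open>N\<close>, multiplied by concatenating both
  components. Since words multiply by concatenation, the ideal generated by the linearity relations
  for one-letter words is the submodule of all multilinearity relations; these are homogeneous in
  \<open>(i, j)\<close>.
\<close>

definition word_term :: "('r, 'z) ring_scheme \<Rightarrow> 'r \<Rightarrow> 'm list \<Rightarrow> 'n list \<Rightarrow> 'm list \<times> 'n list \<Rightarrow> 'r" where
  "word_term R r xs fs = (\<lambda>w. if w = (xs, fs) then r else \<zero>\<^bsub>R\<^esub>)"

definition word_algebra ::
    "('r, 'z) ring_scheme \<Rightarrow> ('r, 'm, 'y) module_scheme \<Rightarrow> ('r, 'n, 'v) module_scheme \<Rightarrow>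
     ('m list \<times> 'n list \<Rightarrow> 'r) ring" where
  "word_algebra R M N =
     \<lparr>carrier = {a. range a \<subseteq> carrier R \<and> finite {w. a w \<noteq> \<zero>\<^bsub>R\<^esub>} \<and>
                   {w. a w \<noteq> \<zero>\<^bsub>R\<^esub>} \<subseteq> lists (carrier M) \<times> lists (carrier N)},
      mult = (\<lambda>a b (xs, fs). \<Oplus>\<^bsub>R\<^esub>i\<in>{..length xs}. \<Oplus>\<^bsub>R\<^esub>j\<in>{..length fs}.
                a (take i xs, take j fs) \<otimes>\<^bsub>R\<^esub> b (drop i xs, drop j fs)),
      one = word_term R \<one>\<^bsub>R\<^esub> [] [],
      zero = (\<lambda>w. \<zero>\<^bsub>R\<^esub>),
      add = (\<lambda>a b w. a w \<oplus>\<^bsub>R\<^esub> b w)\<rparr>"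

definition linearity_ideal ::
    "('r, 'z) ring_scheme \<Rightarrow> ('r, 'm, 'y) module_scheme \<Rightarrow> ('r, 'n, 'v) module_scheme \<Rightarrow>
     ('m list \<times> 'n list \<Rightarrow> 'r) set" where
  "linearity_ideal R M N =
     (let F = word_algebra R M N; w = word_term R in
      Idl\<^bsub>F\<^esub>
       ({w \<one>\<^bsub>R\<^esub> [x \<oplus>\<^bsub>M\<^esub> y] [] \<ominus>\<^bsub>F\<^esub> (w \<one>\<^bsub>R\<^esub> [x] [] \<oplus>\<^bsub>F\<^esub> w \<one>\<^bsub>R\<^esub> [y] []) | x y. x \<in> carrier M \<and> y \<in> carrier M} \<union>
        {w \<one>\<^bsub>R\<^esub> [r \<odot>\<^bsub>M\<^esub> x] [] \<ominus>\<^bsub>F\<^esub> w r [x] [] | r x. r \<in> carrier R \<and> x \<in> carrier M} \<union>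
        {w \<one>\<^bsub>R\<^esub> [] [f \<oplus>\<^bsub>N\<^esub> g] \<ominus>\<^bsub>F\<^esub> (w \<one>\<^bsub>R\<^esub> [] [f] \<oplus>\<^bsub>F\<^esub> w \<one>\<^bsub>R\<^esub> [] [g]) | f g. f \<in> carrier N \<and> g \<in> carrier N} \<union>
        {w \<one>\<^bsub>R\<^esub> [] [r \<odot>\<^bsub>N\<^esub> f] \<ominus>\<^bsub>F\<^esub> w r [] [f] | r f. r \<in> carrier R \<and> f \<in> carrier N}))"

definition tensor_algebra ::
    "('r, 'z) ring_scheme \<Rightarrow> ('r, 'm, 'y) module_scheme \<Rightarrow> ('r, 'n, 'v) module_scheme \<Rightarrow>
     ('m list \<times> 'n list \<Rightarrow> 'r) set ring" where
  "tensor_algebra R M N = word_algebra R M N Quot linearity_ideal R M N"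

text \<open>The tensor \<open>r (x\<^sub>1 \<otimes> \<dots> \<otimes> x\<^sub>i \<otimes> f\<^sub>1 \<otimes> \<dots> \<otimes> f\<^sub>j)\<close>.\<close>

definition tensor ::
    "('r, 'z) ring_scheme \<Rightarrow> ('r, 'm, 'y) module_scheme \<Rightarrow> ('r, 'n, 'v) module_scheme \<Rightarrow>
     'r \<Rightarrow> 'm list \<Rightarrow> 'n list \<Rightarrow> ('m list \<times> 'n list \<Rightarrow> 'r) set" where
  "tensor R M N r xs fs = linearity_ideal R M N +>\<^bsub>word_algebra R M N\<^esub> word_term R r xs fs"

text \<open>The direct sum over \<open>d\<close> of the summands of bidegree \<open>(2 d + \<epsilon>, d)\<close>. For \<open>\<epsilon> = 0\<close> it is a subring,
  for \<open>\<epsilon> = 1\<close> it is an additive group with two commuting actions of that subring by multiplication.\<close>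

definition tensor_part ::
    "nat \<Rightarrow> ('r, 'z) ring_scheme \<Rightarrow> ('r, 'm, 'y) module_scheme \<Rightarrow> ('r, 'n, 'v) module_scheme \<Rightarrow>
     ('m list \<times> 'n list \<Rightarrow> 'r) set ring" where
  "tensor_part \<epsilon> R M N = (tensor_algebra R M N)
     \<lparr>carrier := {linearity_ideal R M N +>\<^bsub>word_algebra R M N\<^esub> a | a. a \<in> carrier (word_algebra R M N) \<and>
        (\<forall>xs fs. a (xs, fs) \<noteq> \<zero>\<^bsub>R\<^esub> \<longrightarrow> length xs = 2 * length fs + \<epsilon>)}\<rparr>"


section \<open>Clifford algebras\<close>

text \<open>Here \<open>N\<close> stands for the dual of \<open>L\<close>, and \<open>q f x\<close> for \<open>f (Q x)\<close>.\<close>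

definition even_ideal ::
    "('r, 'z) ring_scheme \<Rightarrow> ('r, 'm, 'y) module_scheme \<Rightarrow> ('r, 'n, 'v) module_scheme \<Rightarrow> ('n \<Rightarrow> 'm \<Rightarrow> 'r) \<Rightarrow>
     ('m list \<times> 'n list \<Rightarrow> 'r) set set" where
  "even_ideal R M N q =
     (let T = tensor_part 0 R M N; t = tensor R M N in
      Idl\<^bsub>T\<^esub>
       ({t \<one>\<^bsub>R\<^esub> [x, x] [f] \<ominus>\<^bsub>T\<^esub> t (q f x) [] [] | x f. x \<in> carrier M \<and> f \<in> carrier N} \<union>
        {t \<one>\<^bsub>R\<^esub> [x, y, y, z] [f, g] \<ominus>\<^bsub>T\<^esub> t (q f y) [x, z] [g] | x y z f g.
           x \<in> carrier M \<and> y \<in> carrier M \<and> z \<in> carrier M \<and> f \<in> carrier N \<and> g \<in> carrier N}))"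

definition even_clifford_ring ::
    "('r, 'z) ring_scheme \<Rightarrow> ('r, 'm, 'y) module_scheme \<Rightarrow> ('r, 'n, 'v) module_scheme \<Rightarrow> ('n \<Rightarrow> 'm \<Rightarrow> 'r) \<Rightarrow>
     ('m list \<times> 'n list \<Rightarrow> 'r) set set ring" where
  "even_clifford_ring R M N q = tensor_part 0 R M N Quot even_ideal R M N q"

definition odd_subbimodule ::
    "('r, 'z) ring_scheme \<Rightarrow> ('r, 'm, 'y) module_scheme \<Rightarrow> ('r, 'n, 'v) module_scheme \<Rightarrow> ('n \<Rightarrow> 'm \<Rightarrow> 'r) \<Rightarrow>
     ('m list \<times> 'n list \<Rightarrow> 'r) set set" where
  "odd_subbimodule R M N q =
     (let T = tensor_part 1 R M N; t = tensor R M N in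
      \<Inter>{J. additive_subgroup J T \<and>
           (\<forall>a\<in>carrier (tensor_part 0 R M N). \<forall>b\<in>J. a \<otimes>\<^bsub>T\<^esub> b \<in> J \<and> b \<otimes>\<^bsub>T\<^esub> a \<in> J) \<and>
           {t \<one>\<^bsub>R\<^esub> [x, x, y] [f] \<ominus>\<^bsub>T\<^esub> t (q f x) [y] [] | x y f.
              x \<in> carrier M \<and> y \<in> carrier M \<and> f \<in> carrier N} \<subseteq> J \<and>
           {t \<one>\<^bsub>R\<^esub> [y, x, x] [f] \<ominus>\<^bsub>T\<^esub> t (q f x) [y] [] | x y f.
              x \<in> carrier M \<and> y \<in> carrier M \<and> f \<in> carrier N} \<subseteq> J})"

definition odd_clifford_module ::
    "('r, 'z) ring_scheme \<Rightarrow> ('r, 'm, 'y) module_scheme \<Rightarrow> ('r, 'n, 'v) module_scheme \<Rightarrow> ('n \<Rightarrow> 'm \<Rightarrow> 'r) \<Rightarrow>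
     (('m list \<times> 'n list \<Rightarrow> 'r) set set, ('m list \<times> 'n list \<Rightarrow> 'r) set set) module" where
  "odd_clifford_module R M N q =
     (let T = tensor_part 1 R M N; J = odd_subbimodule R M N q in
      \<lparr>carrier = a_rcosets\<^bsub>T\<^esub> J, mult = undefined, one = undefined, zero = J, add = set_add T,
       smult = (\<lambda>A B. \<Union>a\<in>A. \<Union>b\<in>B. J +>\<^bsub>T\<^esub> (a \<otimes>\<^bsub>T\<^esub> b))\<rparr>)"


subsection \<open>Restriction maps and sheafification\<close>

text \<open>The map that \<open>f\<close> induces from a quotient to the cosets of \<open>I\<close> in \<open>G\<close>.\<close>

definition coset_map :: "('b, 'z) ring_scheme \<Rightarrow> 'b set \<Rightarrow> ('a \<Rightarrow> 'b) \<Rightarrow> 'a set \<Rightarrow> 'b set" where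
  "coset_map G I f A = (\<Union>a\<in>A. I +>\<^bsub>G\<^esub> f a)"

definition word_map ::
    "('r, 'z) ring_scheme \<Rightarrow> ('r, 'z) ring_scheme \<Rightarrow> ('r \<Rightarrow> 'r) \<Rightarrow> ('m \<Rightarrow> 'm) \<Rightarrow> ('n \<Rightarrow> 'n) \<Rightarrow>
     ('m list \<times> 'n list \<Rightarrow> 'r) \<Rightarrow> ('m list \<times> 'n list \<Rightarrow> 'r)" where
  "word_map R R' \<rho> g h a =
     (\<lambda>w'. \<Oplus>\<^bsub>R'\<^esub>w\<in>{w. a w \<noteq> \<zero>\<^bsub>R\<^esub> \<and> map_prod (map g) (map h) w = w'}. \<rho> (a w))"

definition tensor_res ::
    "('x, 'r) ring_presheaf \<Rightarrow> ('x, 'r, 'm) module_presheaf \<Rightarrow> ('x, 'r, 'n) module_presheaf \<Rightarrow>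
     'x set \<Rightarrow> 'x set \<Rightarrow> ('m list \<times> 'n list \<Rightarrow> 'r) set \<Rightarrow> ('m list \<times> 'n list \<Rightarrow> 'r) set" where
  "tensor_res OX M N U V =
     coset_map (word_algebra (sec OX V) (sec M V) (sec N V))
       (linearity_ideal (sec OX V) (sec M V) (sec N V))
       (word_map (sec OX U) (sec OX V) (res OX U V) (res M U V) (res N U V))"

definition even_clifford_presheaf ::
    "'x topology \<Rightarrow> ('x, 'r) ring_presheaf \<Rightarrow> ('x, 'r, 'm) module_presheaf \<Rightarrow>
     ('x, 'r, 'l) module_presheaf \<Rightarrow> ('x set \<Rightarrow> 'm \<Rightarrow> 'l) \<Rightarrow>
     ('x, ('m list \<times> ('x set \<Rightarrow> 'l \<Rightarrow> 'r) list \<Rightarrow> 'r) set set) ring_presheaf" where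
  "even_clifford_presheaf X OX M L Q =
     (let N = dual_sheaf X OX L in
      \<lparr>sec = (\<lambda>U. even_clifford_ring (sec OX U) (sec M U) (sec N U) (\<lambda>f x. f U (Q U x))),
       res = (\<lambda>U V. coset_map (tensor_part 0 (sec OX V) (sec M V) (sec N V))
                (even_ideal (sec OX V) (sec M V) (sec N V) (\<lambda>f x. f V (Q V x)))
                (tensor_res OX M N U V))\<rparr>)"

definition odd_clifford_presheaf ::
    "'x topology \<Rightarrow> ('x, 'r) ring_presheaf \<Rightarrow> ('x, 'r, 'm) module_presheaf \<Rightarrow>
     ('x, 'r, 'l) module_presheaf \<Rightarrow> ('x set \<Rightarrow> 'm \<Rightarrow> 'l) \<Rightarrow>
     ('x, ('m list \<times> ('x set \<Rightarrow> 'l \<Rightarrow> 'r) list \<Rightarrow> 'r) set set,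
          ('m list \<times> ('x set \<Rightarrow> 'l \<Rightarrow> 'r) list \<Rightarrow> 'r) set set) module_presheaf" where
  "odd_clifford_presheaf X OX M L Q =
     (let N = dual_sheaf X OX L in
      \<lparr>sec = (\<lambda>U. odd_clifford_module (sec OX U) (sec M U) (sec N U) (\<lambda>f x. f U (Q U x))),
       res = (\<lambda>U V. coset_map (tensor_part 1 (sec OX V) (sec M V) (sec N V))
                (odd_subbimodule (sec OX V) (sec M V) (sec N V) (\<lambda>f x. f V (Q V x)))
                (tensor_res OX M N U V))\<rparr>)"

text \<open>Tensor products, direct sums and quotients of sheaves of modules are sheafifications of the
  corresponding presheaves, so it suffices to sheafify once at the end.\<close>

definition even_clifford where
  "even_clifford X OX M L Q = sheafify_ring X (even_clifford_presheaf X OX M L Q)"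

definition odd_clifford where
  "odd_clifford X OX M L Q =
     sheafify_module X (even_clifford_presheaf X OX M L Q) (odd_clifford_presheaf X OX M L Q)"

end

theory Submission
  imports Defs
begin

text \<open>
  For a single ring, write the Clifford algebra and module as quotients of the even and odd parts of
  the word algebra. If some \<open>v\<close> and \<open>g\<close> satisfy \<open>g (Q v) = 1\<close>, then \<open>a \<mapsto> a v\<close> is a bijection from
  \<open>Clf\<^sup>0\<close> to \<open>Clf\<^sup>1\<close>, with inverse \<open>b \<mapsto> b v \<otimes> g\<close>; over a local ring a primitive form has such a \<open>v\<close>.

  Conversely, let \<open>I\<close> be the ideal generated by the values of \<open>Q\<close>. Projecting words to degrees \<open>(0, 0)\<close>
  and \<open>(1, 0)\<close> gives a ring homomorphism \<open>Clf\<^sup>0 \<rightarrow> R / I\<close> and a compatible surjection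
  \<open>Clf\<^sup>1 \<rightarrow> M / I M \<cong> (R / I)\<^sup>2\<close>. If one element generates \<open>Clf\<^sup>1\<close>, then one element generates
  \<open>(R / I)\<^sup>2\<close>, which forces \<open>I = R\<close>.
\<close>

section \<open>The word algebra\<close>

text \<open>Three layers of quotients separate the definitions from any computation: tensors are
  cosets of words, Clifford classes are cosets of tensors, and sections of the Clifford sheaves are
  families of germs of such classes. The algebra is therefore done with words. Equality of two
  Clifford classes becomes membership of a difference in an inductively generated set of relators,
  and a statement about the quotients becomes an induction over the rules of that set.
  Multiplication by v and by v \<otimes> g respects relators because a generator of one parity,
  lengthened by further letters where necessary, starts with a generator of the other parity.

  The letters are only assumed closed under sums and scalar multiples. This puts the linearity
  relations into the word algebra, and of the module structure of the dual sheaf it leaves only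
  closure to be checked.

  The second obstacle is the passage between stalks and sections. Invertibility of a germ, or an
  identity between germs, is always realised on a smaller neighbourhood, and only finitely many such
  neighbourhoods are intersected.\<close>

locale word_setting = cring R for R :: "('r, 'z) ring_scheme" (structure) +
  fixes M :: "('r, 'm, 'y) module_scheme" and N :: "('r, 'n, 'v) module_scheme"
  assumes M_add: "\<lbrakk>x \<in> carrier M; y \<in> carrier M\<rbrakk> \<Longrightarrow> x \<oplus>\<^bsub>M\<^esub> y \<in> carrier M"
    and M_smult: "\<lbrakk>r \<in> carrier R; x \<in> carrier M\<rbrakk> \<Longrightarrow> r \<odot>\<^bsub>M\<^esub> x \<in> carrier M"
    and N_add: "\<lbrakk>f \<in> carrier N; g \<in> carrier N\<rbrakk> \<Longrightarrow> f \<oplus>\<^bsub>N\<^esub> g \<in> carrier N"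
    and N_smult: "\<lbrakk>r \<in> carrier R; f \<in> carrier N\<rbrakk> \<Longrightarrow> r \<odot>\<^bsub>N\<^esub> f \<in> carrier N"
begin

abbreviation W where "W \<equiv> word_algebra R M N"
abbreviation wt where "wt \<equiv> word_term R"

lemma W_carrier_iff:
  "a \<in> carrier W \<longleftrightarrow> (\<forall>w. a w \<in> carrier R) \<and> finite {w. a w \<noteq> \<zero>} \<and>
     (\<forall>xs fs. a (xs, fs) \<noteq> \<zero> \<longrightarrow> set xs \<subseteq> carrier M \<and> set fs \<subseteq> carrier N)"
  by (fastforce simp: word_algebra_def in_lists_conv_set)

lemma W_coeff [simp]: "a \<in> carrier W \<Longrightarrow> a w \<in> carrier R"
  unfolding W_carrier_iff by blast

lemma W_finite: "a \<in> carrier W \<Longrightarrow> finite {w. a w \<noteq> \<zero>}"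
  unfolding W_carrier_iff by blast

lemma W_letters:
  "\<lbrakk>a \<in> carrier W; a (xs, fs) \<noteq> \<zero>\<rbrakk> \<Longrightarrow> set xs \<subseteq> carrier M \<and> set fs \<subseteq> carrier N"
  unfolding W_carrier_iff by blast

lemma W_carrierI:
  assumes "\<And>w. a w \<in> carrier R" "finite {w. a w \<noteq> \<zero>}"
    "\<And>xs fs. a (xs, fs) \<noteq> \<zero> \<Longrightarrow> set xs \<subseteq> carrier M \<and> set fs \<subseteq> carrier N"
  shows "a \<in> carrier W"
  unfolding W_carrier_iff using assms by blast

lemma W_add: "a \<oplus>\<^bsub>W\<^esub> b = (\<lambda>w. a w \<oplus> b w)" and W_zero: "\<zero>\<^bsub>W\<^esub> = (\<lambda>w. \<zero>)"
  and W_one: "\<one>\<^bsub>W\<^esub> = wt \<one> [] []"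
  by (simp_all add: word_algebra_def)

lemma W_add_apply: "(a \<oplus>\<^bsub>W\<^esub> b) w = a w \<oplus> b w"
  by (simp add: W_add)

lemma W_mult: "(a \<otimes>\<^bsub>W\<^esub> b) (xs, fs) = (\<Oplus>i\<in>{..length xs}. \<Oplus>j\<in>{..length fs}.
    a (take i xs, take j fs) \<otimes> b (drop i xs, drop j fs))"
  by (simp add: word_algebra_def)

lemma wt_closed [simp]:
  assumes "r \<in> carrier R" "set xs \<subseteq> carrier M" "set fs \<subseteq> carrier N"
  shows "wt r xs fs \<in> carrier W"
proof -
  have "{w. wt r xs fs w \<noteq> \<zero>} \<subseteq> {(xs, fs)}" by (auto simp: word_term_def split: if_splits)
  then have "finite {w. wt r xs fs w \<noteq> \<zero>}" by (rule finite_subset) simp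
  with assms show ?thesis by (auto simp: W_carrier_iff word_term_def split: if_splits)
qed

lemma W_add_closed: "\<lbrakk>a \<in> carrier W; b \<in> carrier W\<rbrakk> \<Longrightarrow> a \<oplus>\<^bsub>W\<^esub> b \<in> carrier W"
proof -
  assume a: "a \<in> carrier W" and b: "b \<in> carrier W"
  have "{w. a w \<oplus> b w \<noteq> \<zero>} \<subseteq> {w. a w \<noteq> \<zero>} \<union> {w. b w \<noteq> \<zero>}" by auto
  then have "finite {w. a w \<oplus> b w \<noteq> \<zero>}"
    by (rule finite_subset) (use a b in \<open>simp add: W_finite\<close>)
  moreover have "set xs \<subseteq> carrier M \<and> set fs \<subseteq> carrier N" if "a (xs, fs) \<oplus> b (xs, fs) \<noteq> \<zero>" for xs fs
  proof -
    from that have "a (xs, fs) \<noteq> \<zero> \<or> b (xs, fs) \<noteq> \<zero>" by auto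
    with a b show ?thesis using W_letters by blast
  qed
  ultimately show ?thesis using a b unfolding W_add by (intro W_carrierI) auto
qed

lemma W_abelian_group: "abelian_group W"
proof (rule abelian_groupI)
  show "\<exists>b\<in>carrier W. b \<oplus>\<^bsub>W\<^esub> a = \<zero>\<^bsub>W\<^esub>" if a: "a \<in> carrier W" for a
  proof
    have "(\<ominus> (a w) \<noteq> \<zero>) = (a w \<noteq> \<zero>)" for w
      using a W_coeff[OF a] by (metis minus_minus minus_zero)
    then show "(\<lambda>w. \<ominus> (a w)) \<in> carrier W"
      using a W_letters[OF a] by (intro W_carrierI) (simp_all add: W_finite)
    show "(\<lambda>w. \<ominus> (a w)) \<oplus>\<^bsub>W\<^esub> a = \<zero>\<^bsub>W\<^esub>" using a by (auto simp: W_add W_zero l_neg)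
  qed
  show "\<zero>\<^bsub>W\<^esub> \<in> carrier W" by (rule W_carrierI) (simp_all add: W_zero)
qed (simp add: W_add_closed, simp_all add: W_add W_zero a_ac)

lemma finsum_all_zero: "(\<And>i. i \<in> A \<Longrightarrow> f i = \<zero>) \<Longrightarrow> (\<Oplus>i\<in>A. f i) = \<zero>"
  using add.finprod_one_eqI[of A f] by simp

text \<open>A coefficient of a product is a sum over pairs of cuts, one of each list; if it is
  nonzero, some pair of cuts has both halves in the supports.\<close>

lemma W_mult_support:
  assumes "(a \<otimes>\<^bsub>W\<^esub> b) (xs, fs) \<noteq> \<zero>" "a \<in> carrier W" "b \<in> carrier W"
  obtains us vs hs ks where "xs = us @ vs" "fs = hs @ ks" "a (us, hs) \<noteq> \<zero>" "b (vs, ks) \<noteq> \<zero>"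
proof -
  have "\<exists>i j. a (take i xs, take j fs) \<otimes> b (drop i xs, drop j fs) \<noteq> \<zero>"
  proof (rule ccontr)
    assume "\<not> ?thesis"
    then have "(a \<otimes>\<^bsub>W\<^esub> b) (xs, fs) = \<zero>" unfolding W_mult by (intro finsum_all_zero) blast
    with assms(1) show False by simp
  qed
  then obtain i j where "a (take i xs, take j fs) \<otimes> b (drop i xs, drop j fs) \<noteq> \<zero>" by blast
  then have "a (take i xs, take j fs) \<noteq> \<zero>" "b (drop i xs, drop j fs) \<noteq> \<zero>"
    using assms(2,3) by auto
  then show ?thesis using that[of "take i xs" "drop i xs" "take j fs" "drop j fs"] by simp
qed

lemma W_mult_closed:
  assumes a: "a \<in> carrier W" and b: "b \<in> carrier W" shows "a \<otimes>\<^bsub>W\<^esub> b \<in> carrier W"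
proof -
  let ?c = "\<lambda>((us, hs), (vs, ks)). (us @ vs, hs @ ks)"
  have "{w. (a \<otimes>\<^bsub>W\<^esub> b) w \<noteq> \<zero>} \<subseteq> ?c ` ({w. a w \<noteq> \<zero>} \<times> {w. b w \<noteq> \<zero>})"
  proof
    fix w assume w: "w \<in> {w. (a \<otimes>\<^bsub>W\<^esub> b) w \<noteq> \<zero>}"
    obtain xs fs where [simp]: "w = (xs, fs)" by (cases w)
    from w have "(a \<otimes>\<^bsub>W\<^esub> b) (xs, fs) \<noteq> \<zero>" by simp
    from this a b show "w \<in> ?c ` ({w. a w \<noteq> \<zero>} \<times> {w. b w \<noteq> \<zero>})"
      by (rule W_mult_support) (auto intro!: image_eqI)
  qed
  moreover have "finite ({w. a w \<noteq> \<zero>} \<times> {w. b w \<noteq> \<zero>})" using a b by (simp add: W_finite)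
  ultimately have "finite {w. (a \<otimes>\<^bsub>W\<^esub> b) w \<noteq> \<zero>}" by (meson finite_imageI finite_subset)
  moreover have "(a \<otimes>\<^bsub>W\<^esub> b) w \<in> carrier R" for w
    by (cases w) (auto simp: W_mult a b intro!: finsum_closed)
  moreover have "set xs \<subseteq> carrier M \<and> set fs \<subseteq> carrier N" if "(a \<otimes>\<^bsub>W\<^esub> b) (xs, fs) \<noteq> \<zero>" for xs fs
    using that a b by (rule W_mult_support) (use W_letters[OF a] W_letters[OF b] in auto)
  ultimately show ?thesis by (intro W_carrierI)
qed

lemma W_l_distr:
  assumes "a \<in> carrier W" "b \<in> carrier W" "c \<in> carrier W"
  shows "(a \<oplus>\<^bsub>W\<^esub> b) \<otimes>\<^bsub>W\<^esub> c = a \<otimes>\<^bsub>W\<^esub> c \<oplus>\<^bsub>W\<^esub> b \<otimes>\<^bsub>W\<^esub> c"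
proof
  fix w :: "'m list \<times> 'n list"
  obtain xs fs where w: "w = (xs, fs)" by (cases w)
  have "((a \<oplus>\<^bsub>W\<^esub> b) \<otimes>\<^bsub>W\<^esub> c) (xs, fs) = (\<Oplus>i\<in>{..length xs}. \<Oplus>j\<in>{..length fs}.
      a (take i xs, take j fs) \<otimes> c (drop i xs, drop j fs) \<oplus> b (take i xs, take j fs) \<otimes> c (drop i xs, drop j fs))"
    unfolding W_mult W_add_apply using assms by (simp add: l_distr)
  also have "\<dots> = (a \<otimes>\<^bsub>W\<^esub> c) (xs, fs) \<oplus> (b \<otimes>\<^bsub>W\<^esub> c) (xs, fs)"
    unfolding W_mult using assms by (simp add: finsum_addf Pi_def)
  finally show "((a \<oplus>\<^bsub>W\<^esub> b) \<otimes>\<^bsub>W\<^esub> c) w = (a \<otimes>\<^bsub>W\<^esub> c \<oplus>\<^bsub>W\<^esub> b \<otimes>\<^bsub>W\<^esub> c) w"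
    unfolding W_add_apply w .
qed

lemma W_r_distr:
  assumes "a \<in> carrier W" "b \<in> carrier W" "c \<in> carrier W"
  shows "c \<otimes>\<^bsub>W\<^esub> (a \<oplus>\<^bsub>W\<^esub> b) = c \<otimes>\<^bsub>W\<^esub> a \<oplus>\<^bsub>W\<^esub> c \<otimes>\<^bsub>W\<^esub> b"
proof
  fix w :: "'m list \<times> 'n list"
  obtain xs fs where w: "w = (xs, fs)" by (cases w)
  have "(c \<otimes>\<^bsub>W\<^esub> (a \<oplus>\<^bsub>W\<^esub> b)) (xs, fs) = (\<Oplus>i\<in>{..length xs}. \<Oplus>j\<in>{..length fs}.
      c (take i xs, take j fs) \<otimes> a (drop i xs, drop j fs) \<oplus> c (take i xs, take j fs) \<otimes> b (drop i xs, drop j fs))"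
    unfolding W_mult W_add_apply using assms by (simp add: r_distr)
  also have "\<dots> = (c \<otimes>\<^bsub>W\<^esub> a) (xs, fs) \<oplus> (c \<otimes>\<^bsub>W\<^esub> b) (xs, fs)"
    unfolding W_mult using assms by (simp add: finsum_addf Pi_def)
  finally show "(c \<otimes>\<^bsub>W\<^esub> (a \<oplus>\<^bsub>W\<^esub> b)) w = (c \<otimes>\<^bsub>W\<^esub> a \<oplus>\<^bsub>W\<^esub> c \<otimes>\<^bsub>W\<^esub> b) w"
    unfolding W_add_apply w .
qed

lemma W_null:
  assumes "a \<in> carrier W" shows "\<zero>\<^bsub>W\<^esub> \<otimes>\<^bsub>W\<^esub> a = \<zero>\<^bsub>W\<^esub>" "a \<otimes>\<^bsub>W\<^esub> \<zero>\<^bsub>W\<^esub> = \<zero>\<^bsub>W\<^esub>"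
  using assms by (auto simp: W_mult W_zero fun_eq_iff)

text \<open>A cut can recover both factors only at the positions \<open>length xs\<close> and
  \<open>length fs\<close>, since equal lists have equal lengths. So at most one term of the double
  sum survives.\<close>

lemma wt_mult:
  assumes [simp]: "r \<in> carrier R" "s \<in> carrier R"
  shows "wt r xs fs \<otimes>\<^bsub>W\<^esub> wt s ys gs = wt (r \<otimes> s) (xs @ ys) (fs @ gs)"
proof
  fix w :: "'m list \<times> 'n list" obtain us hs where [simp]: "w = (us, hs)" by (cases w)
  let ?t = "\<lambda>i j. wt r xs fs (take i us, take j hs) \<otimes> wt s ys gs (drop i us, drop j hs)"
  show "(wt r xs fs \<otimes>\<^bsub>W\<^esub> wt s ys gs) w = wt (r \<otimes> s) (xs @ ys) (fs @ gs) w"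
  proof (cases "us = xs @ ys \<and> hs = fs @ gs")
    case True
    then have u: "us = xs @ ys" and h: "hs = fs @ gs" by auto
    have t: "?t i j = (if length xs = i then if length fs = j then r \<otimes> s else \<zero> else \<zero>)"
      if "i \<le> length us" "j \<le> length hs" for i j
    proof (cases "length xs = i \<and> length fs = j")
      case True then show ?thesis by (auto simp: word_term_def u h)
    next
      case False
      then have "length (take i us) \<noteq> length xs \<or> length (take j hs) \<noteq> length fs"
        using that by auto
      then have "wt r xs fs (take i us, take j hs) = \<zero>" unfolding word_term_def by (metis fst_conv snd_conv)
      then show ?thesis using False by (auto simp: word_term_def)
    qed
    have "(\<Oplus>j\<in>{..length hs}. ?t i j) = (if length xs = i then r \<otimes> s else \<zero>)" if "i \<le> length us" for i
    proof -
      have "(\<Oplus>j\<in>{..length hs}. ?t i j) =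
          (\<Oplus>j\<in>{..length hs}. if length fs = j then (if length xs = i then r \<otimes> s else \<zero>) else \<zero>)"
        by (rule finsum_cong') (use that in \<open>auto simp: t\<close>)
      also have "\<dots> = (if length xs = i then r \<otimes> s else \<zero>)"
        by (subst finsum_singleton) (auto simp: h)
      finally show ?thesis .
    qed
    then have "(\<Oplus>i\<in>{..length us}. \<Oplus>j\<in>{..length hs}. ?t i j) =
        (\<Oplus>i\<in>{..length us}. if length xs = i then r \<otimes> s else \<zero>)"
      by (intro finsum_cong') auto
    also have "\<dots> = r \<otimes> s" by (subst finsum_singleton[where f = "\<lambda>_. r \<otimes> s"]) (auto simp: u)
    finally show ?thesis using True by (simp add: W_mult word_term_def)
  next
    case False
    have "?t i j = \<zero>" for i j
    proof (rule ccontr)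
      assume "?t i j \<noteq> \<zero>"
      then have "(take i us, take j hs) = (xs, fs)" "(drop i us, drop j hs) = (ys, gs)"
        by (auto simp: word_term_def split: if_splits)
      then show False using False by auto
    qed
    then show ?thesis using False by (auto simp: W_mult word_term_def)
  qed
qed

text \<open>The support is finite, so words are split off one at a time. The premise
  \<open>a (xs, fs) \<noteq> \<zero>\<close> remembers that only words of the original
  \<open>a\<close> occur; this is what later supplies their bidegree.\<close>

lemma word_induct [consumes 1, case_names zero word add]:
  assumes a: "a \<in> carrier W"
    and zero: "P \<zero>\<^bsub>W\<^esub>"
    and wt: "\<And>r xs fs. \<lbrakk>r \<in> carrier R; set xs \<subseteq> carrier M; set fs \<subseteq> carrier N; a (xs, fs) \<noteq> \<zero>\<rbrakk>
       \<Longrightarrow> P (wt r xs fs)"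
    and add: "\<And>b c. \<lbrakk>b \<in> carrier W; c \<in> carrier W; P b; P c\<rbrakk> \<Longrightarrow> P (b \<oplus>\<^bsub>W\<^esub> c)"
  shows "P a"
proof -
  have "P b" if "finite F" "F = {w. b w \<noteq> \<zero>}" "b \<in> carrier W" "F \<subseteq> {w. a w \<noteq> \<zero>}" for F b
    using that
  proof (induction F arbitrary: b rule: finite_induct)
    case empty
    then have "b = \<zero>\<^bsub>W\<^esub>" by (auto simp: W_zero)
    then show ?case using zero by simp
  next
    case (insert w F)
    obtain xs fs where w: "w = (xs, fs)" by (cases w)
    let ?b = "b(w := \<zero>)" let ?w = "wt (b w) xs fs"
    have F: "F = {w. ?b w \<noteq> \<zero>}" using insert.hyps insert.prems(1) by auto
    have nz: "b (xs, fs) \<noteq> \<zero>" "a (xs, fs) \<noteq> \<zero>" using insert.prems w by auto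
    have sub: "set xs \<subseteq> carrier M" "set fs \<subseteq> carrier N"
      using nz(1) insert.prems(2) W_letters by auto
    have b: "?b \<in> carrier W" using insert.prems(2) W_letters[OF insert.prems(2)] insert.hyps(1) F[symmetric]
      by (intro W_carrierI) (simp_all split: if_splits)
    have "b = ?b \<oplus>\<^bsub>W\<^esub> ?w"
      using insert.prems(2) w by (auto simp: fun_eq_iff W_add word_term_def)
    moreover have "P ?b" by (rule insert.IH[OF F b]) (use insert.prems(3) in auto)
    moreover have "P ?w" using insert.prems(2) sub nz(2) by (intro wt) auto
    ultimately show ?case using add[OF b, of ?w] insert.prems(2) sub by simp
  qed
  then show ?thesis using a W_finite by blast
qed

text \<open>Both sides are additive in each of the three arguments, which reduces the claim to
  single words, where it is associativity of append and of multiplication in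
  \<open>R\<close>.\<close>

lemma W_assoc:
  assumes a: "a \<in> carrier W" and b: "b \<in> carrier W" and c: "c \<in> carrier W"
  shows "a \<otimes>\<^bsub>W\<^esub> b \<otimes>\<^bsub>W\<^esub> c = a \<otimes>\<^bsub>W\<^esub> (b \<otimes>\<^bsub>W\<^esub> c)"
  using a
proof (induction rule: word_induct)
  case (word r xs fs)
  note 1 = this
  from b show ?case
  proof (induction rule: word_induct)
    case (word s ys gs)
    note 2 = this
    from c show ?case
      by (induction rule: word_induct)
        (use 1 2 in \<open>simp_all add: W_null wt_mult W_r_distr W_mult_closed m_assoc\<close>)
  qed (use 1 c in \<open>simp_all add: W_null W_l_distr W_r_distr W_mult_closed\<close>)
qed (use b c in \<open>simp_all add: W_null W_l_distr W_r_distr W_mult_closed\<close>)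

lemma W_l_one: "a \<in> carrier W \<Longrightarrow> \<one>\<^bsub>W\<^esub> \<otimes>\<^bsub>W\<^esub> a = a"
  by (induction rule: word_induct) (simp_all add: W_one W_null W_r_distr wt_mult)

lemma W_r_one: "a \<in> carrier W \<Longrightarrow> a \<otimes>\<^bsub>W\<^esub> \<one>\<^bsub>W\<^esub> = a"
  by (induction rule: word_induct) (simp_all add: W_one W_null W_l_distr wt_mult)

lemma W_ring: "ring W"
  by (intro ringI W_abelian_group monoidI)
    (simp_all add: W_mult_closed W_assoc W_l_one W_r_one W_l_distr W_r_distr, simp add: W_one)

sublocale W: ring W
  by (rule W_ring)

end

section \<open>Even and odd words, tensors, and classes represented by words\<close>

context word_setting begin

lemma W_uminus_apply: "a \<in> carrier W \<Longrightarrow> (\<ominus>\<^bsub>W\<^esub> a) w = \<ominus> (a w)"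
  by (metis W.a_inv_closed W.l_neg W_add_apply W_coeff W_zero minus_equality)

lemma W_minus_apply: "\<lbrakk>a \<in> carrier W; b \<in> carrier W\<rbrakk> \<Longrightarrow> (a \<ominus>\<^bsub>W\<^esub> b) w = a w \<ominus> b w"
  by (simp add: W.minus_eq W_add_apply W_uminus_apply minus_eq)

text \<open>The word elements whose cosets make up \<open>tensor_part \<epsilon>\<close>: sums of
  words of bidegree (2 d + \<epsilon>, d).\<close>

definition wpart :: "nat \<Rightarrow> ('m list \<times> 'n list \<Rightarrow> 'r) set" where
  "wpart \<epsilon> = {a \<in> carrier W. \<forall>xs fs. a (xs, fs) \<noteq> \<zero> \<longrightarrow> length xs = 2 * length fs + \<epsilon>}"

lemma wpartI:
  "\<lbrakk>a \<in> carrier W; \<And>xs fs. a (xs, fs) \<noteq> \<zero> \<Longrightarrow> length xs = 2 * length fs + \<epsilon>\<rbrakk> \<Longrightarrow> a \<in> wpart \<epsilon>"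
  unfolding wpart_def by blast

lemma wpart_length: "\<lbrakk>a \<in> wpart \<epsilon>; a (xs, fs) \<noteq> \<zero>\<rbrakk> \<Longrightarrow> length xs = 2 * length fs + \<epsilon>"
  unfolding wpart_def by blast

lemma wpart_carrier [simp]: "a \<in> wpart \<epsilon> \<Longrightarrow> a \<in> carrier W"
  by (simp add: wpart_def)

lemma wt_wpart [simp]:
  "\<lbrakk>r \<in> carrier R; set xs \<subseteq> carrier M; set fs \<subseteq> carrier N; length xs = 2 * length fs + \<epsilon>\<rbrakk>
   \<Longrightarrow> wt r xs fs \<in> wpart \<epsilon>"
  by (rule wpartI, simp) (simp add: word_term_def split: if_splits)

lemma wpart_zero [simp]: "\<zero>\<^bsub>W\<^esub> \<in> wpart \<epsilon>"
  by (rule wpartI, rule W.zero_closed) (simp add: W_zero)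

lemma wpart_add [simp]: "\<lbrakk>a \<in> wpart \<epsilon>; b \<in> wpart \<epsilon>\<rbrakk> \<Longrightarrow> a \<oplus>\<^bsub>W\<^esub> b \<in> wpart \<epsilon>"
proof (rule wpartI)
  fix xs fs
  assume a: "a \<in> wpart \<epsilon>" and b: "b \<in> wpart \<epsilon>" and nz: "(a \<oplus>\<^bsub>W\<^esub> b) (xs, fs) \<noteq> \<zero>"
  then have "a (xs, fs) \<noteq> \<zero> \<or> b (xs, fs) \<noteq> \<zero>" unfolding W_add_apply by auto
  then show "length xs = 2 * length fs + \<epsilon>" using wpart_length[OF a] wpart_length[OF b] by blast
qed (simp add: W_add_closed)

lemma wpart_uminus [simp]: "a \<in> wpart \<epsilon> \<Longrightarrow> \<ominus>\<^bsub>W\<^esub> a \<in> wpart \<epsilon>"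
  by (rule wpartI) (auto simp: W_uminus_apply dest: wpart_length)

lemma wpart_minus [simp]: "\<lbrakk>a \<in> wpart \<epsilon>; b \<in> wpart \<epsilon>\<rbrakk> \<Longrightarrow> a \<ominus>\<^bsub>W\<^esub> b \<in> wpart \<epsilon>"
  by (simp add: W.minus_eq)

lemma wpart_mult:
  assumes a: "a \<in> wpart \<delta>" and b: "b \<in> wpart \<epsilon>"
  shows "a \<otimes>\<^bsub>W\<^esub> b \<in> wpart (\<delta> + \<epsilon>)"
proof -
  have "length xs = 2 * length fs + (\<delta> + \<epsilon>)" if nz: "(a \<otimes>\<^bsub>W\<^esub> b) (xs, fs) \<noteq> \<zero>" for xs fs
  proof -
    obtain us vs hs ks where *: "xs = us @ vs" "fs = hs @ ks" "a (us, hs) \<noteq> \<zero>" "b (vs, ks) \<noteq> \<zero>"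
      using nz wpart_carrier[OF a] wpart_carrier[OF b] by (rule W_mult_support)
    with wpart_length[OF a *(3)] wpart_length[OF b *(4)] show ?thesis by simp
  qed
  then show ?thesis using a b by (intro wpartI) (simp_all add: W_mult_closed)
qed

lemma wpart_mult_0 [simp]: "\<lbrakk>a \<in> wpart 0; b \<in> wpart \<epsilon>\<rbrakk> \<Longrightarrow> a \<otimes>\<^bsub>W\<^esub> b \<in> wpart \<epsilon>"
  "\<lbrakk>a \<in> wpart \<epsilon>; b \<in> wpart 0\<rbrakk> \<Longrightarrow> a \<otimes>\<^bsub>W\<^esub> b \<in> wpart \<epsilon>"
  by (drule (1) wpart_mult, simp)+

lemma wpart_induct [consumes 1, case_names zero word add]:
  assumes a: "a \<in> wpart \<epsilon>"
    and zero: "P \<zero>\<^bsub>W\<^esub>"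
    and wt: "\<And>r xs fs. \<lbrakk>r \<in> carrier R; set xs \<subseteq> carrier M; set fs \<subseteq> carrier N;
       length xs = 2 * length fs + \<epsilon>\<rbrakk> \<Longrightarrow> P (wt r xs fs)"
    and add: "\<And>b c. \<lbrakk>b \<in> wpart \<epsilon>; c \<in> wpart \<epsilon>; P b; P c\<rbrakk> \<Longrightarrow> P (b \<oplus>\<^bsub>W\<^esub> c)"
  shows "P a"
proof -
  \<comment> \<open>Membership in \<open>wpart \<epsilon>\<close> is carried along because the
    \<open>add\<close> case has to hand it on; for single words it comes from the support of
    \<open>a\<close>.\<close>
  from wpart_carrier[OF a] have "P a \<and> a \<in> wpart \<epsilon>"
  proof (induction rule: word_induct)
    case (word r xs fs)
    with wpart_length[OF a word(4)] show ?case by (simp add: wt)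
  qed (auto intro: zero add)
  with a show ?thesis by simp
qed

abbreviation Lin where "Lin \<equiv> linearity_ideal R M N"
abbreviation T where "T \<equiv> tensor_algebra R M N"
abbreviation Tp where "Tp \<epsilon> \<equiv> tensor_part \<epsilon> R M N"

lemma Lin_ideal: "ideal Lin W"
  unfolding linearity_ideal_def Let_def
  by (rule W.genideal_ideal) (auto simp: M_add M_smult N_add N_smult)

sublocale Lin: ideal Lin W
  by (rule Lin_ideal)

sublocale T: ring T
  unfolding tensor_algebra_def by (rule Lin.quotient_is_ring)

definition tcl :: "('m list \<times> 'n list \<Rightarrow> 'r) \<Rightarrow> ('m list \<times> 'n list \<Rightarrow> 'r) set" where
  "tcl a = Lin +>\<^bsub>W\<^esub> a"

sublocale tcl: ring_hom_ring W T tcl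
  unfolding tcl_def tensor_algebra_def using Lin.rcos_ring_hom_ring by (simp add: eta_contract_eq)

lemma tensor_eq: "tensor R M N r xs fs = tcl (wt r xs fs)"
  by (simp add: tensor_def tcl_def)

lemma tcl_eq_iff: "\<lbrakk>a \<in> carrier W; b \<in> carrier W\<rbrakk> \<Longrightarrow> tcl a = tcl b \<longleftrightarrow> a \<ominus>\<^bsub>W\<^esub> b \<in> Lin"
  unfolding tcl_def using W.quotient_eq_iff_same_a_r_cos[OF Lin_ideal] by auto

lemma Tp_carrier: "carrier (Tp \<epsilon>) = tcl ` wpart \<epsilon>"
proof -
  have "carrier (r\<lparr>carrier := c\<rparr>) = c" for r :: "('a, 'b) partial_object_scheme" and c by simp
  then show ?thesis unfolding tensor_part_def tcl_def wpart_def image_Collect by this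
qed

lemma Tp_simps: "mult (Tp \<epsilon>) = mult T" "add (Tp \<epsilon>) = add T" "zero (Tp \<epsilon>) = zero T"
  "one (Tp \<epsilon>) = one T"
  by (simp_all add: tensor_part_def)

lemma Tp_abelian_group: "abelian_group (Tp \<epsilon>)"
proof (rule abelian_groupI)
  show "\<exists>y\<in>carrier (Tp \<epsilon>). y \<oplus>\<^bsub>Tp \<epsilon>\<^esub> x = \<zero>\<^bsub>Tp \<epsilon>\<^esub>" if "x \<in> carrier (Tp \<epsilon>)" for x
  proof -
    from that obtain a where a: "a \<in> wpart \<epsilon>" "x = tcl a" by (auto simp: Tp_carrier)
    then have "tcl (\<ominus>\<^bsub>W\<^esub> a) \<oplus>\<^bsub>T\<^esub> x = \<zero>\<^bsub>T\<^esub>" by (simp add: T.l_neg)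
    moreover have "tcl (\<ominus>\<^bsub>W\<^esub> a) \<in> carrier (Tp \<epsilon>)" unfolding Tp_carrier
      by (rule imageI) (rule wpart_uminus[OF a(1)])
    ultimately show ?thesis unfolding Tp_simps by (rule bexI)
  qed
  show "\<zero>\<^bsub>Tp \<epsilon>\<^esub> \<in> carrier (Tp \<epsilon>)"
    unfolding Tp_carrier Tp_simps by (metis image_eqI tcl.hom_zero wpart_zero)
  show "x \<oplus>\<^bsub>Tp \<epsilon>\<^esub> y \<in> carrier (Tp \<epsilon>)" if "x \<in> carrier (Tp \<epsilon>)" "y \<in> carrier (Tp \<epsilon>)" for x y
    using that unfolding Tp_carrier Tp_simps
    by (auto simp flip: tcl.hom_add)
qed (auto simp: Tp_carrier Tp_simps T.a_ac)

text \<open>Negation depends on the carrier, so uniqueness of additive inverses is used to identify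
  it with the one of the tensor algebra. The generators of \<open>even_ideal\<close> and
  \<open>odd_subbimodule\<close> are differences formed in the smaller structure.\<close>

lemma Tp_uminus: "a \<in> wpart \<epsilon> \<Longrightarrow> \<ominus>\<^bsub>Tp \<epsilon>\<^esub> (tcl a) = tcl (\<ominus>\<^bsub>W\<^esub> a)"
  by (rule abelian_group.minus_equality[OF Tp_abelian_group])
    (simp_all add: Tp_carrier Tp_simps T.l_neg imageI del: tcl.hom_a_inv, simp add: T.l_neg)

lemma Tp_minus:
  "\<lbrakk>a \<in> wpart \<epsilon>; b \<in> wpart \<epsilon>\<rbrakk> \<Longrightarrow> tcl a \<ominus>\<^bsub>Tp \<epsilon>\<^esub> tcl b = tcl (a \<ominus>\<^bsub>W\<^esub> b)"
  unfolding a_minus_def[of "Tp \<epsilon>"] by (simp only: Tp_uminus) (simp add: Tp_simps W.minus_eq)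

text \<open>The preimage in the word algebra of the sub-bimodule of \<^term>\<open>Tp \<epsilon>\<close> generated by \<^term>\<open>tcl ` H\<close>;
  working with it avoids nested cosets.\<close>

inductive_set relators :: "nat \<Rightarrow> ('m list \<times> 'n list \<Rightarrow> 'r) set \<Rightarrow> ('m list \<times> 'n list \<Rightarrow> 'r) set"
  for \<epsilon> H where
    lin: "\<lbrakk>a \<in> Lin; a \<in> wpart \<epsilon>\<rbrakk> \<Longrightarrow> a \<in> relators \<epsilon> H"
  | gen: "a \<in> H \<Longrightarrow> a \<in> relators \<epsilon> H"
  | add: "\<lbrakk>a \<in> relators \<epsilon> H; b \<in> relators \<epsilon> H\<rbrakk> \<Longrightarrow> a \<oplus>\<^bsub>W\<^esub> b \<in> relators \<epsilon> H"
  | uminus: "a \<in> relators \<epsilon> H \<Longrightarrow> \<ominus>\<^bsub>W\<^esub> a \<in> relators \<epsilon> H"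
  | lmult: "\<lbrakk>a \<in> wpart 0; b \<in> relators \<epsilon> H\<rbrakk> \<Longrightarrow> a \<otimes>\<^bsub>W\<^esub> b \<in> relators \<epsilon> H"
  | rmult: "\<lbrakk>a \<in> relators \<epsilon> H; b \<in> wpart 0\<rbrakk> \<Longrightarrow> a \<otimes>\<^bsub>W\<^esub> b \<in> relators \<epsilon> H"

lemma relators_wpart: "a \<in> relators \<epsilon> H \<Longrightarrow> H \<subseteq> wpart \<epsilon> \<Longrightarrow> a \<in> wpart \<epsilon>"
  by (induction rule: relators.induct) auto

lemma relators_zero: "\<zero>\<^bsub>W\<^esub> \<in> relators \<epsilon> H"
  by (rule relators.lin) auto

lemma relators_minus:
  "\<lbrakk>a \<in> relators \<epsilon> H; b \<in> relators \<epsilon> H\<rbrakk> \<Longrightarrow> a \<ominus>\<^bsub>W\<^esub> b \<in> relators \<epsilon> H"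
  by (simp add: W.minus_eq relators.intros)

text \<open>The common form of \<open>even_ideal\<close> and \<open>odd_subbimodule\<close>: for
  \<epsilon> = 0 it is the generated two-sided ideal, for \<epsilon> = 1 the generated
  sub-bimodule.\<close>

definition part_span where
  "part_span \<epsilon> G = \<Inter>{J. additive_subgroup J (Tp \<epsilon>) \<and>
     (\<forall>a\<in>carrier (Tp 0). \<forall>b\<in>J. a \<otimes>\<^bsub>T\<^esub> b \<in> J \<and> b \<otimes>\<^bsub>T\<^esub> a \<in> J) \<and> G \<subseteq> J}"

text \<open>The rules of \<open>relators\<close> mirror the closure conditions in
  \<open>part_span\<close>, except for \<open>lin\<close>, which collects what \<open>tcl\<close>
  sends to zero. So the image of the relators is one of the competing sets, and rule induction
  places it inside every other one.\<close>

lemma relators_span: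
  assumes H: "H \<subseteq> wpart \<epsilon>"
  shows "part_span \<epsilon> (tcl ` H) = tcl ` relators \<epsilon> H"
proof
  interpret Tp: abelian_group "Tp \<epsilon>" by (rule Tp_abelian_group)
  have wp: "a \<in> wpart \<epsilon>" and wc: "a \<in> carrier W" if "a \<in> relators \<epsilon> H" for a
    using relators_wpart[OF that H] by auto
  show "part_span \<epsilon> (tcl ` H) \<subseteq> tcl ` relators \<epsilon> H"
    unfolding part_span_def
  proof (rule Inter_lower, intro CollectI conjI ballI)
    show "additive_subgroup (tcl ` relators \<epsilon> H) (Tp \<epsilon>)"
    proof (intro additive_subgroupI Tp.add.subgroupI)
      show "tcl ` relators \<epsilon> H \<subseteq> carrier (Tp \<epsilon>)" by (auto simp: Tp_carrier wp wc)
      show "tcl ` relators \<epsilon> H \<noteq> {}" using relators_zero by blast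
      show "\<ominus>\<^bsub>Tp \<epsilon>\<^esub> a \<in> tcl ` relators \<epsilon> H" if "a \<in> tcl ` relators \<epsilon> H" for a
        using that by (auto simp: Tp_uminus wp simp del: tcl.hom_a_inv intro!: imageI relators.uminus)
      show "a \<oplus>\<^bsub>Tp \<epsilon>\<^esub> b \<in> tcl ` relators \<epsilon> H"
        if "a \<in> tcl ` relators \<epsilon> H" "b \<in> tcl ` relators \<epsilon> H" for a b
      proof -
        from that obtain x y where xy: "x \<in> relators \<epsilon> H" "y \<in> relators \<epsilon> H" "a = tcl x" "b = tcl y"
          by blast
        then have "a \<oplus>\<^bsub>Tp \<epsilon>\<^esub> b = tcl (x \<oplus>\<^bsub>W\<^esub> y)" by (simp add: Tp_simps wp wc)
        with xy show ?thesis by (auto intro: relators.add)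
      qed
    qed
    show "a \<otimes>\<^bsub>T\<^esub> b \<in> tcl ` relators \<epsilon> H" "b \<otimes>\<^bsub>T\<^esub> a \<in> tcl ` relators \<epsilon> H"
      if "a \<in> carrier (Tp 0)" "b \<in> tcl ` relators \<epsilon> H" for a b
    proof -
      from that obtain x y where xy: "x \<in> wpart 0" "y \<in> relators \<epsilon> H" "a = tcl x" "b = tcl y"
        unfolding Tp_carrier by blast
      then have "a \<otimes>\<^bsub>T\<^esub> b = tcl (x \<otimes>\<^bsub>W\<^esub> y)" "b \<otimes>\<^bsub>T\<^esub> a = tcl (y \<otimes>\<^bsub>W\<^esub> x)"
        by (simp_all add: wc)
      with xy show "a \<otimes>\<^bsub>T\<^esub> b \<in> tcl ` relators \<epsilon> H" "b \<otimes>\<^bsub>T\<^esub> a \<in> tcl ` relators \<epsilon> H"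
        by (auto intro: relators.lmult relators.rmult simp del: tcl.hom_mult)
    qed
    show "tcl ` H \<subseteq> tcl ` relators \<epsilon> H" by (auto intro: relators.gen)
  qed
  show "tcl ` relators \<epsilon> H \<subseteq> part_span \<epsilon> (tcl ` H)"
    unfolding part_span_def
  proof (rule Inter_greatest, clarify)
    fix J a
    assume J: "additive_subgroup J (Tp \<epsilon>)" "tcl ` H \<subseteq> J"
      and m: "\<forall>a\<in>carrier (Tp 0). \<forall>b\<in>J. a \<otimes>\<^bsub>T\<^esub> b \<in> J \<and> b \<otimes>\<^bsub>T\<^esub> a \<in> J"
      and a: "a \<in> relators \<epsilon> H"
    interpret J: additive_subgroup J "Tp \<epsilon>" by fact
    from a show "tcl a \<in> J"
    proof (induction rule: relators.induct)
      case (lin a)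
      then have "tcl a = tcl \<zero>\<^bsub>W\<^esub>" by (subst tcl_eq_iff) (auto simp: W.minus_eq)
      then show ?case using J.zero_closed by (simp add: Tp_simps)
    next
      case (add a b)
      then show ?case using J.a_closed[of "tcl a" "tcl b"] by (simp add: Tp_simps wp wc)
    next
      case (uminus a)
      have "\<ominus>\<^bsub>Tp \<epsilon>\<^esub> tcl a \<in> J"
        unfolding a_inv_def by (rule subgroup.m_inv_closed[OF J.a_subgroup uminus.IH])
      then show ?case by (simp only: Tp_uminus[OF wp[OF uminus.hyps]])
    next
      case (lmult a b)
      then show ?case using m by (auto simp: Tp_carrier wp wc)
    next
      case (rmult a b)
      then show ?case using m by (auto simp: Tp_carrier wp wc)
    qed (use J in blast)
  qed
qed

text \<open>The composite of the two quotient maps, from words to Clifford classes; the result is a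
  coset whose members are themselves cosets.\<close>

definition cl where "cl \<epsilon> H a = tcl ` relators \<epsilon> H +>\<^bsub>Tp \<epsilon>\<^esub> tcl a"

lemma mem_cl:
  assumes H: "H \<subseteq> wpart \<epsilon>" and a: "a \<in> wpart \<epsilon>"
  shows "t \<in> cl \<epsilon> H a \<longleftrightarrow> (\<exists>b\<in>wpart \<epsilon>. t = tcl b \<and> b \<ominus>\<^bsub>W\<^esub> a \<in> relators \<epsilon> H)"
proof
  assume "t \<in> cl \<epsilon> H a"
  then obtain k where k: "k \<in> relators \<epsilon> H" "t = tcl k \<oplus>\<^bsub>T\<^esub> tcl a"
    by (auto simp: cl_def a_r_coset_def' Tp_simps)
  have kw: "k \<in> wpart \<epsilon>" using k(1) H by (rule relators_wpart)
  show "\<exists>b\<in>wpart \<epsilon>. t = tcl b \<and> b \<ominus>\<^bsub>W\<^esub> a \<in> relators \<epsilon> H"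
    using k kw a by (intro bexI[of _ "k \<oplus>\<^bsub>W\<^esub> a"]) (auto simp: W.minus_eq W.a_assoc W.r_neg)
next
  assume "\<exists>b\<in>wpart \<epsilon>. t = tcl b \<and> b \<ominus>\<^bsub>W\<^esub> a \<in> relators \<epsilon> H"
  then obtain b where b: "b \<in> wpart \<epsilon>" "t = tcl b" "b \<ominus>\<^bsub>W\<^esub> a \<in> relators \<epsilon> H" by blast
  then have "t = tcl (b \<ominus>\<^bsub>W\<^esub> a) \<oplus>\<^bsub>T\<^esub> tcl a"
    using a by (simp add: W.minus_eq W.a_assoc W.l_neg flip: tcl.hom_add del: tcl.hom_add)
  then show "t \<in> cl \<epsilon> H a" using b(3) by (auto simp: cl_def a_r_coset_def' Tp_simps)
qed

lemma W_minus_minus: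
  "\<lbrakk>a \<in> carrier W; b \<in> carrier W; c \<in> carrier W\<rbrakk> \<Longrightarrow> (a \<ominus>\<^bsub>W\<^esub> b) \<oplus>\<^bsub>W\<^esub> (b \<ominus>\<^bsub>W\<^esub> c) = a \<ominus>\<^bsub>W\<^esub> c"
  by (simp add: W.minus_eq W.a_assoc W.r_neg1)

text \<open>The same tensor has many representatives, but they differ by linearity relations of the
  right bidegree, and by the rule \<open>lin\<close> these count as relators. From here on, equality
  of classes is treated as this membership.\<close>

lemma cl_eq_iff:
  assumes H: "H \<subseteq> wpart \<epsilon>" and a: "a \<in> wpart \<epsilon>" and b: "b \<in> wpart \<epsilon>"
  shows "cl \<epsilon> H a = cl \<epsilon> H b \<longleftrightarrow> a \<ominus>\<^bsub>W\<^esub> b \<in> relators \<epsilon> H"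
proof
  assume "cl \<epsilon> H a = cl \<epsilon> H b"
  moreover have "tcl a \<in> cl \<epsilon> H a"
    using a relators_zero by (auto simp: mem_cl[OF H a] W.minus_eq W.r_neg intro!: bexI[of _ a])
  ultimately obtain b' where b': "b' \<in> wpart \<epsilon>" "tcl a = tcl b'" "b' \<ominus>\<^bsub>W\<^esub> b \<in> relators \<epsilon> H"
    using mem_cl[OF H b] by auto
  have "a \<ominus>\<^bsub>W\<^esub> b' \<in> relators \<epsilon> H" using b' a by (intro relators.lin) (auto simp: tcl_eq_iff)
  from relators.add[OF this b'(3)] show "a \<ominus>\<^bsub>W\<^esub> b \<in> relators \<epsilon> H"
    using a b b' by (simp add: W_minus_minus)
next
  assume *: "a \<ominus>\<^bsub>W\<^esub> b \<in> relators \<epsilon> H"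
  have **: "b \<ominus>\<^bsub>W\<^esub> a \<in> relators \<epsilon> H"
    using relators.uminus[OF *] a b by (simp add: W.minus_eq W.minus_add W.a_comm)
  have "c \<ominus>\<^bsub>W\<^esub> a \<in> relators \<epsilon> H \<longleftrightarrow> c \<ominus>\<^bsub>W\<^esub> b \<in> relators \<epsilon> H" if "c \<in> wpart \<epsilon>" for c
    using relators.add[OF _ *, of "c \<ominus>\<^bsub>W\<^esub> a"] relators.add[OF _ **, of "c \<ominus>\<^bsub>W\<^esub> b"] that a b
    by (auto simp: W_minus_minus)
  then show "cl \<epsilon> H a = cl \<epsilon> H b"
    by (auto simp: mem_cl[OF H a] mem_cl[OF H b] set_eq_iff)
qed

lemma cl_carrier: "a_rcosets\<^bsub>Tp \<epsilon>\<^esub> (tcl ` relators \<epsilon> H) = cl \<epsilon> H ` wpart \<epsilon>"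
  by (auto simp: A_RCOSETS_def' cl_def Tp_carrier)

lemma cl_self: "\<lbrakk>H \<subseteq> wpart \<epsilon>; a \<in> wpart \<epsilon>\<rbrakk> \<Longrightarrow> tcl a \<in> cl \<epsilon> H a"
  using relators_zero by (auto simp: mem_cl W.minus_eq W.r_neg intro!: bexI[of _ a])

lemma cl_zero: "H \<subseteq> wpart \<epsilon> \<Longrightarrow> cl \<epsilon> H \<zero>\<^bsub>W\<^esub> = tcl ` relators \<epsilon> H"
  by (auto simp: mem_cl set_eq_iff W.minus_eq relators_wpart intro!: bexI[of _ "_ :: 'm list \<times> 'n list \<Rightarrow> 'r"])

lemma cl_add:
  assumes H: "H \<subseteq> wpart \<epsilon>" and a: "a \<in> wpart \<epsilon>" and b: "b \<in> wpart \<epsilon>"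
  shows "cl \<epsilon> H a <+>\<^bsub>Tp \<epsilon>\<^esub> cl \<epsilon> H b = cl \<epsilon> H (a \<oplus>\<^bsub>W\<^esub> b)"
proof (intro equalityI subsetI)
  fix t assume "t \<in> cl \<epsilon> H a <+>\<^bsub>Tp \<epsilon>\<^esub> cl \<epsilon> H b"
  then obtain a' b' where *: "a' \<in> wpart \<epsilon>" "b' \<in> wpart \<epsilon>" "t = tcl a' \<oplus>\<^bsub>T\<^esub> tcl b'"
    "a' \<ominus>\<^bsub>W\<^esub> a \<in> relators \<epsilon> H" "b' \<ominus>\<^bsub>W\<^esub> b \<in> relators \<epsilon> H"
    by (auto simp: set_add_def' Tp_simps mem_cl[OF H a] mem_cl[OF H b])
  have "(a' \<ominus>\<^bsub>W\<^esub> a) \<oplus>\<^bsub>W\<^esub> (b' \<ominus>\<^bsub>W\<^esub> b) = (a' \<oplus>\<^bsub>W\<^esub> b') \<ominus>\<^bsub>W\<^esub> (a \<oplus>\<^bsub>W\<^esub> b)"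
    using a b * by (simp add: W.minus_eq W.minus_add W.a_ac)
  with relators.add[OF *(4,5)] * a b show "t \<in> cl \<epsilon> H (a \<oplus>\<^bsub>W\<^esub> b)"
    by (auto simp: mem_cl[OF H] intro!: bexI[of _ "a' \<oplus>\<^bsub>W\<^esub> b'"])
next
  fix t assume "t \<in> cl \<epsilon> H (a \<oplus>\<^bsub>W\<^esub> b)"
  then obtain c where c: "c \<in> wpart \<epsilon>" "t = tcl c" "c \<ominus>\<^bsub>W\<^esub> (a \<oplus>\<^bsub>W\<^esub> b) \<in> relators \<epsilon> H"
    using a b by (auto simp: mem_cl[OF H])
  have "tcl (c \<ominus>\<^bsub>W\<^esub> b) \<in> cl \<epsilon> H a" using a b c
    by (auto simp: mem_cl[OF H] W.minus_eq W.minus_add W.a_ac intro!: bexI[of _ "c \<ominus>\<^bsub>W\<^esub> b"])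
  moreover have "t = tcl (c \<ominus>\<^bsub>W\<^esub> b) \<oplus>\<^bsub>T\<^esub> tcl b"
    using b c by (simp add: W.minus_eq W.a_assoc W.l_neg flip: tcl.hom_add del: tcl.hom_add)
  ultimately show "t \<in> cl \<epsilon> H a <+>\<^bsub>Tp \<epsilon>\<^esub> cl \<epsilon> H b"
    using cl_self[OF H b] by (auto simp: set_add_def' Tp_simps)
qed

end

section \<open>The Clifford algebra and module over a ring\<close>

context word_setting begin

lemma W_minus_distr:
  "\<lbrakk>a \<in> carrier W; b \<in> carrier W; c \<in> carrier W\<rbrakk> \<Longrightarrow> (a \<ominus>\<^bsub>W\<^esub> b) \<otimes>\<^bsub>W\<^esub> c = a \<otimes>\<^bsub>W\<^esub> c \<ominus>\<^bsub>W\<^esub> b \<otimes>\<^bsub>W\<^esub> c"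
  "\<lbrakk>a \<in> carrier W; b \<in> carrier W; c \<in> carrier W\<rbrakk> \<Longrightarrow> c \<otimes>\<^bsub>W\<^esub> (a \<ominus>\<^bsub>W\<^esub> b) = c \<otimes>\<^bsub>W\<^esub> a \<ominus>\<^bsub>W\<^esub> c \<otimes>\<^bsub>W\<^esub> b"
  by (simp_all add: W.minus_eq W_l_distr W_r_distr W.l_minus W.r_minus)

lemma W_minus_add_minus:
  "\<lbrakk>a \<in> carrier W; b \<in> carrier W; c \<in> carrier W; d \<in> carrier W\<rbrakk> \<Longrightarrow>
   (a \<oplus>\<^bsub>W\<^esub> b) \<ominus>\<^bsub>W\<^esub> (c \<oplus>\<^bsub>W\<^esub> d) = (a \<ominus>\<^bsub>W\<^esub> c) \<oplus>\<^bsub>W\<^esub> (b \<ominus>\<^bsub>W\<^esub> d)"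
  by (simp add: W.minus_eq W.minus_add W.a_ac)

lemma Tp0_ring: "ring (Tp 0)"
proof (rule ringI)
  show "Group.monoid (Tp 0)"
  proof (rule monoidI)
    show "x \<otimes>\<^bsub>Tp 0\<^esub> y \<in> carrier (Tp 0)" if xy: "x \<in> carrier (Tp 0)" "y \<in> carrier (Tp 0)" for x y
    proof -
      from xy obtain a b where *: "a \<in> wpart 0" "b \<in> wpart 0" "x = tcl a" "y = tcl b"
        unfolding Tp_carrier by blast
      then have "x \<otimes>\<^bsub>Tp 0\<^esub> y = tcl (a \<otimes>\<^bsub>W\<^esub> b)" by (simp add: Tp_simps)
      with * show ?thesis by (simp add: Tp_carrier imageI del: tcl.hom_mult)
    qed
    have "tcl \<one>\<^bsub>W\<^esub> \<in> carrier (Tp 0)" unfolding Tp_carrier by (rule imageI) (simp add: W_one)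
    then show "\<one>\<^bsub>Tp 0\<^esub> \<in> carrier (Tp 0)" by (simp add: Tp_simps)
  qed (auto simp: Tp_carrier Tp_simps T.m_assoc)
qed (simp add: Tp_abelian_group, auto simp: Tp_carrier Tp_simps T.l_distr T.r_distr)

lemma genideal_Tp0: "genideal (Tp 0) G = part_span 0 G"
proof -
  have "ideal I (Tp 0) \<longleftrightarrow> additive_subgroup I (Tp 0) \<and>
     (\<forall>a\<in>carrier (Tp 0). \<forall>b\<in>I. a \<otimes>\<^bsub>T\<^esub> b \<in> I \<and> b \<otimes>\<^bsub>T\<^esub> a \<in> I)" for I
    unfolding ideal_def ideal_axioms_def using Tp0_ring by (auto simp: Tp_simps)
  then show ?thesis unfolding genideal_def part_span_def by simp
qed

end

section \<open>Relators of the even and odd Clifford quotients, and their behaviour under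
  multiplication\<close>

locale clifford_setting = word_setting R M N
  for R :: "('r, 'z) ring_scheme" (structure)
    and M :: "('r, 'm, 'y) module_scheme" and N :: "('r, 'n, 'v) module_scheme" +
  fixes q :: "'n \<Rightarrow> 'm \<Rightarrow> 'r"
  assumes q_closed [simp]: "\<lbrakk>f \<in> carrier N; x \<in> carrier M\<rbrakk> \<Longrightarrow> q f x \<in> carrier R"
begin

definition even_gens where
  "even_gens =
     {wt \<one> [x, x] [f] \<ominus>\<^bsub>W\<^esub> wt (q f x) [] [] | x f. x \<in> carrier M \<and> f \<in> carrier N} \<union>
     {wt \<one> [x, y, y, z] [f, g] \<ominus>\<^bsub>W\<^esub> wt (q f y) [x, z] [g] | x y z f g.
        x \<in> carrier M \<and> y \<in> carrier M \<and> z \<in> carrier M \<and> f \<in> carrier N \<and> g \<in> carrier N}"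

definition odd_gens where
  "odd_gens =
     {wt \<one> [x, x, y] [f] \<ominus>\<^bsub>W\<^esub> wt (q f x) [y] [] | x y f.
        x \<in> carrier M \<and> y \<in> carrier M \<and> f \<in> carrier N} \<union>
     {wt \<one> [y, x, x] [f] \<ominus>\<^bsub>W\<^esub> wt (q f x) [y] [] | x y f.
        x \<in> carrier M \<and> y \<in> carrier M \<and> f \<in> carrier N}"

text \<open>Indexing by the parity lets \<open>K\<close> and \<open>ccl\<close> speak about the
  algebra and the module at once; only the values 0 and 1 of \<epsilon> occur.\<close>

definition gens :: "nat \<Rightarrow> ('m list \<times> 'n list \<Rightarrow> 'r) set" where
  "gens \<epsilon> = (if \<epsilon> = 0 then even_gens else odd_gens)"

lemma gens_simps: "gens 0 = even_gens" "gens (Suc 0) = odd_gens"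
  by (simp_all add: gens_def)

abbreviation K where "K \<epsilon> \<equiv> relators \<epsilon> (gens \<epsilon>)"
abbreviation ccl where "ccl \<epsilon> \<equiv> cl \<epsilon> (gens \<epsilon>)"

lemma gens_wpart: "gens 0 \<subseteq> wpart 0" "gens (Suc 0) \<subseteq> wpart (Suc 0)"
  unfolding gens_simps even_gens_def odd_gens_def by auto

lemma K_wpart: "a \<in> K 0 \<Longrightarrow> a \<in> wpart 0" "a \<in> K (Suc 0) \<Longrightarrow> a \<in> wpart (Suc 0)"
  using gens_wpart relators_wpart by blast+

lemma K_carrier [simp]: "a \<in> K 0 \<Longrightarrow> a \<in> carrier W" "a \<in> K (Suc 0) \<Longrightarrow> a \<in> carrier W"
  using K_wpart wpart_carrier by blast+

lemma gens_carrier [simp]: "a \<in> gens 0 \<Longrightarrow> a \<in> carrier W" "a \<in> gens (Suc 0) \<Longrightarrow> a \<in> carrier W"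
  using gens_wpart wpart_carrier by blast+

lemma even_gens_mem:
  assumes "x \<in> carrier M" "f \<in> carrier N"
  shows "wt \<one> [x, x] [f] \<ominus>\<^bsub>W\<^esub> wt (q f x) [] [] \<in> K 0"
    and "\<lbrakk>y \<in> carrier M; z \<in> carrier M; g \<in> carrier N\<rbrakk> \<Longrightarrow>
      wt \<one> [y, x, x, z] [f, g] \<ominus>\<^bsub>W\<^esub> wt (q f x) [y, z] [g] \<in> K 0"
proof -
  have "wt \<one> [x, x] [f] \<ominus>\<^bsub>W\<^esub> wt (q f x) [] [] \<in> gens 0"
    unfolding gens_simps even_gens_def using assms by blast
  then show "wt \<one> [x, x] [f] \<ominus>\<^bsub>W\<^esub> wt (q f x) [] [] \<in> K 0" by (rule relators.gen)
  assume "y \<in> carrier M" "z \<in> carrier M" "g \<in> carrier N"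
  then have "wt \<one> [y, x, x, z] [f, g] \<ominus>\<^bsub>W\<^esub> wt (q f x) [y, z] [g] \<in> gens 0"
    unfolding gens_simps even_gens_def using assms by blast
  then show "wt \<one> [y, x, x, z] [f, g] \<ominus>\<^bsub>W\<^esub> wt (q f x) [y, z] [g] \<in> K 0" by (rule relators.gen)
qed

lemma odd_gens_mem:
  assumes "x \<in> carrier M" "y \<in> carrier M" "f \<in> carrier N"
  shows "wt \<one> [x, x, y] [f] \<ominus>\<^bsub>W\<^esub> wt (q f x) [y] [] \<in> K (Suc 0)"
    and "wt \<one> [y, x, x] [f] \<ominus>\<^bsub>W\<^esub> wt (q f x) [y] [] \<in> K (Suc 0)"
proof -
  have "wt \<one> [x, x, y] [f] \<ominus>\<^bsub>W\<^esub> wt (q f x) [y] [] \<in> gens (Suc 0)"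
    "wt \<one> [y, x, x] [f] \<ominus>\<^bsub>W\<^esub> wt (q f x) [y] [] \<in> gens (Suc 0)"
    unfolding gens_simps odd_gens_def using assms by blast+
  then show "wt \<one> [x, x, y] [f] \<ominus>\<^bsub>W\<^esub> wt (q f x) [y] [] \<in> K (Suc 0)"
    "wt \<one> [y, x, x] [f] \<ominus>\<^bsub>W\<^esub> wt (q f x) [y] [] \<in> K (Suc 0)"
    by (simp_all only: relators.gen)
qed

text \<open>As images, the generating sets of tensors and of words can be compared generator by
  generator, with \<open>tcl\<close> moved through by \<open>image_image\<close>.\<close>

lemma compr_eq_image:
  "{F x f | x f. x \<in> A \<and> f \<in> B} = (\<lambda>(x, f). F x f) ` (A \<times> B)"
  "{G x y f | x y f. x \<in> A \<and> y \<in> A \<and> f \<in> B} = (\<lambda>(x, y, f). G x y f) ` (A \<times> A \<times> B)"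
  "{H x y z f g | x y z f g. x \<in> A \<and> y \<in> A \<and> z \<in> A \<and> f \<in> B \<and> g \<in> B} =
    (\<lambda>(x, y, z, f, g). H x y z f g) ` (A \<times> A \<times> A \<times> B \<times> B)"
  by (simp_all add: set_eq_iff image_iff Bex_def split_paired_Ex) blast+

lemma even_ideal_eq: "even_ideal R M N q = tcl ` K 0"
  unfolding even_ideal_def Let_def genideal_Tp0 tensor_eq
  by (subst relators_span[OF gens_wpart(1), symmetric], unfold gens_simps even_gens_def)
    (rule arg_cong[where f = "part_span 0"], unfold compr_eq_image image_Un image_image,
     intro arg_cong2[where f = "(\<union>)"] image_cong, auto simp: Tp_minus)

lemma odd_subbimodule_eq: "odd_subbimodule R M N q = tcl ` K (Suc 0)"
proof -
  have "odd_subbimodule R M N q = part_span (Suc 0) (tcl ` gens (Suc 0))"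
    unfolding odd_subbimodule_def Let_def tensor_eq part_span_def One_nat_def
    unfolding gens_simps odd_gens_def compr_eq_image image_Un image_image Un_subset_iff Tp_simps
    by (intro arg_cong[where f = Inter] Collect_cong conj_cong refl arg_cong2[where f = "(\<subseteq>)"] image_cong)
      (auto simp: Tp_minus)
  then show ?thesis by (simp add: relators_span[OF gens_wpart(2)])
qed

lemma even_clifford_carrier: "carrier (even_clifford_ring R M N q) = ccl 0 ` wpart 0"
  by (simp add: even_clifford_ring_def FactRing_def even_ideal_eq cl_carrier)

lemma odd_clifford_carrier: "carrier (odd_clifford_module R M N q) = ccl (Suc 0) ` wpart (Suc 0)"
  by (simp add: odd_clifford_module_def Let_def odd_subbimodule_eq cl_carrier)

lemma odd_clifford_zero: "\<zero>\<^bsub>odd_clifford_module R M N q\<^esub> = ccl (Suc 0) \<zero>\<^bsub>W\<^esub>"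
  by (simp add: odd_clifford_module_def Let_def odd_subbimodule_eq cl_zero[OF gens_wpart(2)])

lemma odd_clifford_add:
  "\<lbrakk>a \<in> wpart (Suc 0); b \<in> wpart (Suc 0)\<rbrakk> \<Longrightarrow>
   ccl (Suc 0) a \<oplus>\<^bsub>odd_clifford_module R M N q\<^esub> ccl (Suc 0) b = ccl (Suc 0) (a \<oplus>\<^bsub>W\<^esub> b)"
  by (simp add: odd_clifford_module_def Let_def cl_add[OF gens_wpart(2)])

text \<open>This makes the action of the even algebra on the odd module independent of the even
  representative. An odd word has a first letter y; behind the generator on x, x it completes the
  odd generator on x, x, y. The four-letter generator already starts with an odd generator on its
  first three letters.\<close>

lemma K0_mult:
  assumes "a \<in> K 0" "b \<in> wpart (Suc 0)" shows "a \<otimes>\<^bsub>W\<^esub> b \<in> K (Suc 0)"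
  using assms
proof (induction arbitrary: b rule: relators.induct)
  case (lin a)
  then show ?case by (intro relators.lin Lin.I_r_closed) auto
next
  case (gen a)
  note a = this(1)
  from gen(2) show ?case
  proof (induction rule: wpart_induct)
    case zero
    show ?case using a by (simp add: W_null relators_zero)
  next
    case (add b c)
    then show ?case using a by (simp add: W_r_distr relators.add)
  next
    case (word r ys gs)
    then obtain y ys' where ys: "ys = y # ys'" by (cases ys) auto
    have [simp]: "y \<in> carrier M" "set ys' \<subseteq> carrier M" and l: "length ys' = 2 * length gs"
      using word ys by auto
    from a have "a \<in> even_gens" by (simp add: gens_simps)
    then show ?case unfolding even_gens_def
    proof (elim UnE CollectE exE conjE)
      fix x f assume [simp]: "x \<in> carrier M" "f \<in> carrier N"
        and a: "a = wt \<one> [x, x] [f] \<ominus>\<^bsub>W\<^esub> wt (q f x) [] []"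
      have "(wt \<one> [x, x, y] [f] \<ominus>\<^bsub>W\<^esub> wt (q f x) [y] []) \<otimes>\<^bsub>W\<^esub> wt r ys' gs \<in> K (Suc 0)"
        using word l by (intro relators.rmult odd_gens_mem) auto
      then show "a \<otimes>\<^bsub>W\<^esub> wt r ys gs \<in> K (Suc 0)"
        using word(1-3) by (simp add: a ys W_minus_distr wt_mult)
    next
      fix x y' z f g assume [simp]: "x \<in> carrier M" "y' \<in> carrier M" "z \<in> carrier M"
        "f \<in> carrier N" "g \<in> carrier N"
        and a: "a = wt \<one> [x, y', y', z] [f, g] \<ominus>\<^bsub>W\<^esub> wt (q f y') [x, z] [g]"
      have "(wt \<one> [x, y', y'] [f] \<ominus>\<^bsub>W\<^esub> wt (q f y') [x] []) \<otimes>\<^bsub>W\<^esub> wt r (z # ys) (g # gs) \<in> K (Suc 0)"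
        using word by (intro relators.rmult odd_gens_mem) auto
      then show "a \<otimes>\<^bsub>W\<^esub> wt r ys gs \<in> K (Suc 0)"
        using word(1-3) by (simp add: a W_minus_distr wt_mult)
    qed
  qed
next
  case (add a a')
  then show ?case by (simp add: W_l_distr relators.add)
next
  case (uminus a)
  then show ?case by (simp add: W.l_minus relators.uminus)
next
  case (lmult a a')
  then show ?case by (simp add: W_assoc relators.lmult)
next
  case (rmult a a')
  then show ?case by (simp add: W_assoc)
qed

text \<open>The scalar action is a union over all representatives. It collapses to one class because
  a' b' - a b = (a' - a) b' + a (b' - b) is a relator.\<close>

lemma odd_clifford_smult:
  assumes a: "a \<in> wpart 0" and b: "b \<in> wpart (Suc 0)"
  shows "ccl 0 a \<odot>\<^bsub>odd_clifford_module R M N q\<^esub> ccl (Suc 0) b = ccl (Suc 0) (a \<otimes>\<^bsub>W\<^esub> b)"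
proof -
  have eq: "ccl (Suc 0) (a' \<otimes>\<^bsub>W\<^esub> b') = ccl (Suc 0) (a \<otimes>\<^bsub>W\<^esub> b)"
    if "a' \<in> wpart 0" "b' \<in> wpart (Suc 0)" "a' \<ominus>\<^bsub>W\<^esub> a \<in> K 0" "b' \<ominus>\<^bsub>W\<^esub> b \<in> K (Suc 0)" for a' b'
  proof -
    have "(a' \<ominus>\<^bsub>W\<^esub> a) \<otimes>\<^bsub>W\<^esub> b' \<oplus>\<^bsub>W\<^esub> a \<otimes>\<^bsub>W\<^esub> (b' \<ominus>\<^bsub>W\<^esub> b) \<in> K (Suc 0)"
      using that a by (intro relators.add K0_mult relators.lmult)
    moreover have "(a' \<ominus>\<^bsub>W\<^esub> a) \<otimes>\<^bsub>W\<^esub> b' \<oplus>\<^bsub>W\<^esub> a \<otimes>\<^bsub>W\<^esub> (b' \<ominus>\<^bsub>W\<^esub> b) = a' \<otimes>\<^bsub>W\<^esub> b' \<ominus>\<^bsub>W\<^esub> a \<otimes>\<^bsub>W\<^esub> b"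
      using that a b by (simp add: W_minus_distr W_minus_minus)
    ultimately show ?thesis using that a b by (subst cl_eq_iff[OF gens_wpart(2)]) auto
  qed
  have coset: "tcl ` K (Suc 0) +>\<^bsub>Tp (Suc 0)\<^esub> (tcl a' \<otimes>\<^bsub>T\<^esub> tcl b') = ccl (Suc 0) (a' \<otimes>\<^bsub>W\<^esub> b')"
    if "a' \<in> wpart 0" "b' \<in> wpart (Suc 0)" for a' b'
    using that by (simp add: cl_def)
  have "ccl 0 a \<odot>\<^bsub>odd_clifford_module R M N q\<^esub> ccl (Suc 0) b =
      (\<Union>s\<in>ccl 0 a. \<Union>t\<in>ccl (Suc 0) b. tcl ` K (Suc 0) +>\<^bsub>Tp (Suc 0)\<^esub> (s \<otimes>\<^bsub>T\<^esub> t))"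
    by (simp add: odd_clifford_module_def Let_def odd_subbimodule_eq Tp_simps)
  also have "\<dots> = (\<Union>s\<in>ccl 0 a. \<Union>t\<in>ccl (Suc 0) b. ccl (Suc 0) (a \<otimes>\<^bsub>W\<^esub> b))"
  proof (intro SUP_cong refl)
    fix s t assume "s \<in> ccl 0 a" "t \<in> ccl (Suc 0) b"
    then obtain a' b' where "a' \<in> wpart 0" "b' \<in> wpart (Suc 0)" "a' \<ominus>\<^bsub>W\<^esub> a \<in> K 0"
      "b' \<ominus>\<^bsub>W\<^esub> b \<in> K (Suc 0)" "s = tcl a'" "t = tcl b'"
      using mem_cl[OF gens_wpart(1) a] mem_cl[OF gens_wpart(2) b] by auto
    with coset eq show "tcl ` K (Suc 0) +>\<^bsub>Tp (Suc 0)\<^esub> (s \<otimes>\<^bsub>T\<^esub> t) = ccl (Suc 0) (a \<otimes>\<^bsub>W\<^esub> b)" by simp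
  qed
  also have "\<dots> = ccl (Suc 0) (a \<otimes>\<^bsub>W\<^esub> b)"
    using cl_self[OF gens_wpart(1) a] cl_self[OF gens_wpart(2) b] by blast
  finally show ?thesis .
qed

text \<open>The factor has bidegree (2 d - 1, d), written without subtraction. In the application it
  is v \<otimes> g, with d = 1.\<close>

lemma odd_mult_word:
  assumes "a \<in> wpart (Suc 0)" "r \<in> carrier R" "set xs \<subseteq> carrier M" "set fs \<subseteq> carrier N"
    "Suc (length xs) = 2 * length fs"
  shows "a \<otimes>\<^bsub>W\<^esub> wt r xs fs \<in> wpart 0"
  using assms(1) by (induction rule: wpart_induct) (use assms in \<open>simp_all add: W_null wt_mult W_l_distr\<close>)

text \<open>This makes the inverse map b \<mapsto> b v \<otimes> g well defined. The odd generator
  on x, x, y starts with an even generator. The one on y, x, x has to borrow the next letters z and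
  g of the word, and then it is the four-letter even generator; this is the purpose of that second
  kind of relation. The rule \<open>rmult\<close> puts even words in front of the factor, which is
  why the induction leaves \<open>r\<close>, \<open>xs\<close> and \<open>fs\<close>
  arbitrary.\<close>

lemma K1_mult:
  assumes "a \<in> K (Suc 0)" "r \<in> carrier R" "set xs \<subseteq> carrier M" "set fs \<subseteq> carrier N"
    "Suc (length xs) = 2 * length fs"
  shows "a \<otimes>\<^bsub>W\<^esub> wt r xs fs \<in> K 0"
  using assms
proof (induction arbitrary: r xs fs rule: relators.induct)
  case (lin a)
  have "a \<otimes>\<^bsub>W\<^esub> wt r xs fs \<in> wpart 0" using lin by (simp add: odd_mult_word)
  with lin show ?case by (intro relators.lin Lin.I_r_closed) auto
next
  case (gen a)
  \<comment> \<open>The equation \<open>Suc (length xs) = 2 * length fs\<close> excludes an empty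
    \<open>fs\<close>, and then \<open>xs\<close> has odd length and is not empty either.\<close>
  obtain g gs where fs: "fs = g # gs" using gen by (cases fs) auto
  then obtain z zs where xs: "xs = z # zs" using gen by (cases xs) auto
  have [simp]: "z \<in> carrier M" "set zs \<subseteq> carrier M" "g \<in> carrier N" "set gs \<subseteq> carrier N"
    and l: "length zs = 2 * length gs"
    using gen fs xs by auto
  from gen(1) have "a \<in> odd_gens" by (simp add: gens_simps)
  then show ?case unfolding odd_gens_def
  proof (elim UnE CollectE exE conjE)
    fix x y f assume [simp]: "x \<in> carrier M" "y \<in> carrier M" "f \<in> carrier N"
      and a: "a = wt \<one> [x, x, y] [f] \<ominus>\<^bsub>W\<^esub> wt (q f x) [y] []"
    have "(wt \<one> [x, x] [f] \<ominus>\<^bsub>W\<^esub> wt (q f x) [] []) \<otimes>\<^bsub>W\<^esub> wt r (y # xs) fs \<in> K 0"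
      using gen by (intro relators.rmult even_gens_mem) auto
    then show "a \<otimes>\<^bsub>W\<^esub> wt r xs fs \<in> K 0"
      using gen(2-4) by (simp add: a W_minus_distr wt_mult)
  next
    fix x y f assume [simp]: "x \<in> carrier M" "y \<in> carrier M" "f \<in> carrier N"
      and a: "a = wt \<one> [y, x, x] [f] \<ominus>\<^bsub>W\<^esub> wt (q f x) [y] []"
    have "(wt \<one> [y, x, x, z] [f, g] \<ominus>\<^bsub>W\<^esub> wt (q f x) [y, z] [g]) \<otimes>\<^bsub>W\<^esub> wt r zs gs \<in> K 0"
      using gen l by (intro relators.rmult even_gens_mem) auto
    then show "a \<otimes>\<^bsub>W\<^esub> wt r xs fs \<in> K 0"
      using gen(2) by (simp add: a xs fs W_minus_distr wt_mult)
  qed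
next
  case (add a a')
  then show ?case by (simp add: W_l_distr relators.add)
next
  case (uminus a)
  then show ?case by (simp add: W.l_minus relators.uminus)
next
  case (lmult a a')
  then show ?case by (simp add: W_assoc relators.lmult)
next
  case (rmult a b)
  from rmult.hyps(2) have "a \<otimes>\<^bsub>W\<^esub> (b \<otimes>\<^bsub>W\<^esub> wt r xs fs) \<in> K 0"
  proof (induction rule: wpart_induct)
    case zero
    then show ?case using rmult.hyps(1) rmult.prems by (simp add: W_null relators_zero)
  next
    case (word s ys gs)
    then show ?case using rmult.IH[of "s \<otimes> r" "ys @ xs" "gs @ fs"] rmult.prems by (simp add: wt_mult)
  next
    case (add b c)
    then show ?case using rmult.hyps(1) rmult.prems by (simp add: W_l_distr W_r_distr relators.add)
  qed
  then show ?case using rmult by (simp add: W_assoc)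
qed

lemma even_unit:
  assumes a: "a \<in> wpart 0" and v: "v \<in> carrier M" "g \<in> carrier N" "q g v = \<one>"
  shows "a \<otimes>\<^bsub>W\<^esub> wt \<one> [v] [] \<otimes>\<^bsub>W\<^esub> wt \<one> [v] [g] \<ominus>\<^bsub>W\<^esub> a \<in> K 0"
proof -
  have "a \<otimes>\<^bsub>W\<^esub> (wt \<one> [v, v] [g] \<ominus>\<^bsub>W\<^esub> wt (q g v) [] []) \<in> K 0"
    using a v by (intro relators.lmult even_gens_mem) auto
  then show ?thesis
    using a v by (simp add: W_minus_distr W_assoc wt_mult W_r_one flip: W_one)
qed

text \<open>The two components of a word are concatenated separately, so v g followed by v reads v,
  v with the dual letter g. Together with the last letter y of an odd word this is the odd generator
  on y, v, v, and what precedes y is even, so \<open>lmult\<close> applies.\<close>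

lemma odd_unit:
  assumes b: "b \<in> wpart (Suc 0)" and v: "v \<in> carrier M" "g \<in> carrier N" "q g v = \<one>"
  shows "b \<otimes>\<^bsub>W\<^esub> wt \<one> [v] [g] \<otimes>\<^bsub>W\<^esub> wt \<one> [v] [] \<ominus>\<^bsub>W\<^esub> b \<in> K (Suc 0)"
  using b
proof (induction rule: wpart_induct)
  case zero
  then show ?case using v relators_zero by (simp add: W_null W.minus_eq)
next
  case (word r xs fs)
  then obtain ys y where xs: "xs = ys @ [y]" by (cases xs rule: rev_cases) auto
  have "wt r ys fs \<otimes>\<^bsub>W\<^esub> (wt \<one> [y, v, v] [g] \<ominus>\<^bsub>W\<^esub> wt (q g v) [y] []) \<in> K (Suc 0)"
    using word v xs by (intro relators.lmult odd_gens_mem) auto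
  then show ?case using word v xs by (simp add: W_minus_distr wt_mult)
next
  case (add b c)
  then have "(b \<otimes>\<^bsub>W\<^esub> wt \<one> [v] [g] \<otimes>\<^bsub>W\<^esub> wt \<one> [v] [] \<ominus>\<^bsub>W\<^esub> b) \<oplus>\<^bsub>W\<^esub>
      (c \<otimes>\<^bsub>W\<^esub> wt \<one> [v] [g] \<otimes>\<^bsub>W\<^esub> wt \<one> [v] [] \<ominus>\<^bsub>W\<^esub> c) \<in> K (Suc 0)"
    by (intro relators.add)
  then show ?case using add v by (simp add: W_l_distr W_minus_add_minus)
qed

lemma clifford_unit_bij:
  assumes v: "v \<in> carrier M" "g \<in> carrier N" "q g v = \<one>"
  shows "bij_betw (\<lambda>A. A \<odot>\<^bsub>odd_clifford_module R M N q\<^esub> ccl (Suc 0) (wt \<one> [v] []))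
    (carrier (even_clifford_ring R M N q)) (carrier (odd_clifford_module R M N q))"
  unfolding even_clifford_carrier odd_clifford_carrier bij_betw_def
proof
  let ?v = "wt \<one> [v] []" let ?g = "wt \<one> [v] [g]"
  have vw: "?v \<in> wpart (Suc 0)" using v by simp
  note smult = odd_clifford_smult[OF _ vw]
  show "inj_on (\<lambda>A. A \<odot>\<^bsub>odd_clifford_module R M N q\<^esub> ccl (Suc 0) ?v) (ccl 0 ` wpart 0)"
  proof (rule inj_onI, elim imageE)
    fix A B a b
    assume a: "a \<in> wpart 0" and b: "b \<in> wpart 0" and [simp]: "A = ccl 0 a" "B = ccl 0 b"
      and eq: "A \<odot>\<^bsub>odd_clifford_module R M N q\<^esub> ccl (Suc 0) ?v = B \<odot>\<^bsub>odd_clifford_module R M N q\<^esub> ccl (Suc 0) ?v"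
    have "a \<otimes>\<^bsub>W\<^esub> ?v \<ominus>\<^bsub>W\<^esub> b \<otimes>\<^bsub>W\<^esub> ?v \<in> K (Suc 0)"
      using eq a b vw by (simp add: smult cl_eq_iff[OF gens_wpart(2)])
    then have "(a \<otimes>\<^bsub>W\<^esub> ?v \<ominus>\<^bsub>W\<^esub> b \<otimes>\<^bsub>W\<^esub> ?v) \<otimes>\<^bsub>W\<^esub> ?g \<in> K 0"
      using v by (intro K1_mult) auto
    then have 1: "a \<otimes>\<^bsub>W\<^esub> ?v \<otimes>\<^bsub>W\<^esub> ?g \<ominus>\<^bsub>W\<^esub> b \<otimes>\<^bsub>W\<^esub> ?v \<otimes>\<^bsub>W\<^esub> ?g \<in> K 0"
      using v a b by (simp add: W_minus_distr)
    \<comment> \<open>With s = a v v g and t = b v v g, the combination (s - t) - (s - a) + (t - b)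
      of three relators equals a - b.\<close>
    have "(a \<otimes>\<^bsub>W\<^esub> ?v \<otimes>\<^bsub>W\<^esub> ?g \<ominus>\<^bsub>W\<^esub> b \<otimes>\<^bsub>W\<^esub> ?v \<otimes>\<^bsub>W\<^esub> ?g)
        \<ominus>\<^bsub>W\<^esub> (a \<otimes>\<^bsub>W\<^esub> ?v \<otimes>\<^bsub>W\<^esub> ?g \<ominus>\<^bsub>W\<^esub> a)
        \<oplus>\<^bsub>W\<^esub> (b \<otimes>\<^bsub>W\<^esub> ?v \<otimes>\<^bsub>W\<^esub> ?g \<ominus>\<^bsub>W\<^esub> b) \<in> K 0"
      by (intro relators.add relators_minus 1 even_unit a b v)
    moreover have "s \<ominus>\<^bsub>W\<^esub> t \<ominus>\<^bsub>W\<^esub> (s \<ominus>\<^bsub>W\<^esub> a) \<oplus>\<^bsub>W\<^esub> (t \<ominus>\<^bsub>W\<^esub> b) = a \<ominus>\<^bsub>W\<^esub> b"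
      if "s \<in> carrier W" "t \<in> carrier W" for s t
    proof -
      have "s \<ominus>\<^bsub>W\<^esub> t \<ominus>\<^bsub>W\<^esub> (s \<ominus>\<^bsub>W\<^esub> a) \<oplus>\<^bsub>W\<^esub> (t \<ominus>\<^bsub>W\<^esub> b)
          = (s \<oplus>\<^bsub>W\<^esub> \<ominus>\<^bsub>W\<^esub> s) \<oplus>\<^bsub>W\<^esub> (t \<oplus>\<^bsub>W\<^esub> \<ominus>\<^bsub>W\<^esub> t) \<oplus>\<^bsub>W\<^esub> (a \<ominus>\<^bsub>W\<^esub> b)"
        using that a b by (simp add: W.minus_eq W.minus_add W.a_ac del: W.r_neg)
      then show ?thesis using that a b by (simp add: W.r_neg)
    qed
    ultimately have "a \<ominus>\<^bsub>W\<^esub> b \<in> K 0" using a b v by simp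
    then show "A = B" using a b by (simp add: cl_eq_iff[OF gens_wpart(1)])
  qed
  show "(\<lambda>A. A \<odot>\<^bsub>odd_clifford_module R M N q\<^esub> ccl (Suc 0) ?v) ` ccl 0 ` wpart 0 =
      ccl (Suc 0) ` wpart (Suc 0)"
  proof (intro equalityI subsetI)
    fix B assume "B \<in> ccl (Suc 0) ` wpart (Suc 0)"
    then obtain b where b: "b \<in> wpart (Suc 0)" "B = ccl (Suc 0) b" by auto
    have bg: "b \<otimes>\<^bsub>W\<^esub> ?g \<in> wpart 0" using b v by (intro odd_mult_word) auto
    have "ccl 0 (b \<otimes>\<^bsub>W\<^esub> ?g) \<odot>\<^bsub>odd_clifford_module R M N q\<^esub> ccl (Suc 0) ?v = B"
      using b v bg odd_unit[OF b(1) v] vw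
      by (simp add: smult cl_eq_iff[OF gens_wpart(2)])
    then show "B \<in> (\<lambda>A. A \<odot>\<^bsub>odd_clifford_module R M N q\<^esub> ccl (Suc 0) ?v) ` ccl 0 ` wpart 0"
      by (rule image_eqI[OF sym imageI[OF bg]])
  next
    fix B assume "B \<in> (\<lambda>A. A \<odot>\<^bsub>odd_clifford_module R M N q\<^esub> ccl (Suc 0) ?v) ` ccl 0 ` wpart 0"
    then obtain a where a: "a \<in> wpart 0"
      "B = ccl 0 a \<odot>\<^bsub>odd_clifford_module R M N q\<^esub> ccl (Suc 0) ?v" by auto
    then show "B \<in> ccl (Suc 0) ` wpart (Suc 0)"
      using vw by (simp add: smult imageI)
  qed
qed

end

section \<open>Functoriality and degree projections\<close>

context word_setting begin

lemma Lin_mem: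
  "\<lbrakk>x \<in> carrier M; y \<in> carrier M\<rbrakk> \<Longrightarrow>
    wt \<one> [x \<oplus>\<^bsub>M\<^esub> y] [] \<ominus>\<^bsub>W\<^esub> (wt \<one> [x] [] \<oplus>\<^bsub>W\<^esub> wt \<one> [y] []) \<in> Lin"
  "\<lbrakk>r \<in> carrier R; x \<in> carrier M\<rbrakk> \<Longrightarrow> wt \<one> [r \<odot>\<^bsub>M\<^esub> x] [] \<ominus>\<^bsub>W\<^esub> wt r [x] [] \<in> Lin"
  "\<lbrakk>f \<in> carrier N; g \<in> carrier N\<rbrakk> \<Longrightarrow>
    wt \<one> [] [f \<oplus>\<^bsub>N\<^esub> g] \<ominus>\<^bsub>W\<^esub> (wt \<one> [] [f] \<oplus>\<^bsub>W\<^esub> wt \<one> [] [g]) \<in> Lin"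
  "\<lbrakk>r \<in> carrier R; f \<in> carrier N\<rbrakk> \<Longrightarrow> wt \<one> [] [r \<odot>\<^bsub>N\<^esub> f] \<ominus>\<^bsub>W\<^esub> wt r [] [f] \<in> Lin"
  unfolding linearity_ideal_def Let_def
  by (rule subsetD[OF W.genideal_self], (auto simp: M_add M_smult N_add N_smult)[1], blast)+

lemma Lin_induct:
  assumes J: "ideal J W"
    and "\<And>x y. \<lbrakk>x \<in> carrier M; y \<in> carrier M\<rbrakk> \<Longrightarrow>
      wt \<one> [x \<oplus>\<^bsub>M\<^esub> y] [] \<ominus>\<^bsub>W\<^esub> (wt \<one> [x] [] \<oplus>\<^bsub>W\<^esub> wt \<one> [y] []) \<in> J"
    and "\<And>r x. \<lbrakk>r \<in> carrier R; x \<in> carrier M\<rbrakk> \<Longrightarrow> wt \<one> [r \<odot>\<^bsub>M\<^esub> x] [] \<ominus>\<^bsub>W\<^esub> wt r [x] [] \<in> J"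
    and "\<And>f g. \<lbrakk>f \<in> carrier N; g \<in> carrier N\<rbrakk> \<Longrightarrow>
      wt \<one> [] [f \<oplus>\<^bsub>N\<^esub> g] \<ominus>\<^bsub>W\<^esub> (wt \<one> [] [f] \<oplus>\<^bsub>W\<^esub> wt \<one> [] [g]) \<in> J"
    and "\<And>r f. \<lbrakk>r \<in> carrier R; f \<in> carrier N\<rbrakk> \<Longrightarrow> wt \<one> [] [r \<odot>\<^bsub>N\<^esub> f] \<ominus>\<^bsub>W\<^esub> wt r [] [f] \<in> J"
  shows "Lin \<subseteq> J"
  unfolding linearity_ideal_def Let_def
  by (rule W.genideal_minimal[OF J]) (use assms(2-) in blast)

end

text \<open>Abstracts restriction from an open set to a smaller one. Source and target share their
  types because all sections of a presheaf have one type.\<close>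

locale clifford_morphism = A: clifford_setting R M N q + B: clifford_setting R' M' N' q'
  for R :: "('r, 'z) ring_scheme" and M :: "('r, 'm, 'y) module_scheme"
    and N :: "('r, 'n, 'v) module_scheme" and q
    and R' :: "('r, 'z) ring_scheme" and M' :: "('r, 'm, 'y) module_scheme"
    and N' :: "('r, 'n, 'v) module_scheme" and q' +
  fixes \<rho> :: "'r \<Rightarrow> 'r" and g :: "'m \<Rightarrow> 'm" and h :: "'n \<Rightarrow> 'n"
  assumes rho_hom: "\<rho> \<in> ring_hom R R'"
    and g_closed [simp]: "x \<in> carrier M \<Longrightarrow> g x \<in> carrier M'"
    and h_closed [simp]: "f \<in> carrier N \<Longrightarrow> h f \<in> carrier N'"
    and g_add: "\<lbrakk>x \<in> carrier M; y \<in> carrier M\<rbrakk> \<Longrightarrow> g (x \<oplus>\<^bsub>M\<^esub> y) = g x \<oplus>\<^bsub>M'\<^esub> g y"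
    and h_add: "\<lbrakk>f \<in> carrier N; k \<in> carrier N\<rbrakk> \<Longrightarrow> h (f \<oplus>\<^bsub>N\<^esub> k) = h f \<oplus>\<^bsub>N'\<^esub> h k"
    and g_smult: "\<lbrakk>r \<in> carrier R; x \<in> carrier M\<rbrakk> \<Longrightarrow> g (r \<odot>\<^bsub>M\<^esub> x) = \<rho> r \<odot>\<^bsub>M'\<^esub> g x"
    and h_smult: "\<lbrakk>r \<in> carrier R; f \<in> carrier N\<rbrakk> \<Longrightarrow> h (r \<odot>\<^bsub>N\<^esub> f) = \<rho> r \<odot>\<^bsub>N'\<^esub> h f"
    and q_compat: "\<lbrakk>f \<in> carrier N; x \<in> carrier M\<rbrakk> \<Longrightarrow> q' (h f) (g x) = \<rho> (q f x)"
begin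

abbreviation wm where "wm \<equiv> word_map R R' \<rho> g h"

sublocale rho: ring_hom_ring R R' \<rho>
  by (rule ring_hom_ringI2[OF A.ring_axioms B.ring_axioms rho_hom])

text \<open>Cancellation can make the support of a sum smaller than the union of the supports.
  Summing over a common finite superset lets the three sums be compared term by term.\<close>

lemma wm_superset:
  assumes "a \<in> carrier A.W" "finite S" "{w. a w \<noteq> \<zero>\<^bsub>R\<^esub>} \<subseteq> S"
  shows "wm a w' = (\<Oplus>\<^bsub>R'\<^esub>w\<in>{w \<in> S. map_prod (map g) (map h) w = w'}. \<rho> (a w))"
  unfolding word_map_def
  by (rule B.add.finprod_mono_neutral_cong_left) (use assms in auto)

lemma wm_add:
  assumes a: "a \<in> carrier A.W" and b: "b \<in> carrier A.W"
  shows "wm (a \<oplus>\<^bsub>A.W\<^esub> b) = wm a \<oplus>\<^bsub>B.W\<^esub> wm b"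
proof
  fix w'
  let ?S = "{w. a w \<noteq> \<zero>\<^bsub>R\<^esub>} \<union> {w. b w \<noteq> \<zero>\<^bsub>R\<^esub>}"
  have S: "finite ?S" using a b by (simp add: A.W_finite)
  have sub: "{w. (a \<oplus>\<^bsub>A.W\<^esub> b) w \<noteq> \<zero>\<^bsub>R\<^esub>} \<subseteq> ?S" by (auto simp: A.W_add_apply)
  show "wm (a \<oplus>\<^bsub>A.W\<^esub> b) w' = (wm a \<oplus>\<^bsub>B.W\<^esub> wm b) w'"
    unfolding B.W_add_apply wm_superset[OF A.W_add_closed[OF a b] S sub]
    using wm_superset[OF a S] wm_superset[OF b S] a b
    by (simp add: A.W_add_apply B.finsum_addf)
qed

lemma wm_wt:
  assumes "r \<in> carrier R" "set xs \<subseteq> carrier M" "set fs \<subseteq> carrier N"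
  shows "wm (A.wt r xs fs) = B.wt (\<rho> r) (map g xs) (map h fs)"
proof
  fix w'
  have "wm (A.wt r xs fs) w' =
      (\<Oplus>\<^bsub>R'\<^esub>w\<in>{w \<in> {(xs, fs)}. map_prod (map g) (map h) w = w'}. \<rho> (A.wt r xs fs w))"
    by (rule wm_superset, simp add: assms) (auto simp: word_term_def split: if_splits)
  also have "\<dots> = B.wt (\<rho> r) (map g xs) (map h fs) w'"
  proof (cases "w' = (map g xs, map h fs)")
    case True
    then have "{w \<in> {(xs, fs)}. map_prod (map g) (map h) w = w'} = {(xs, fs)}" by auto
    then show ?thesis using assms True by (simp add: word_term_def)
  next
    case False
    then have "{w \<in> {(xs, fs)}. map_prod (map g) (map h) w = w'} = {}" by auto
    then show ?thesis using False by (simp only:) (simp add: word_term_def)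
  qed
  finally show "wm (A.wt r xs fs) w' = B.wt (\<rho> r) (map g xs) (map h fs) w'" .
qed

lemma wm_zero: "wm \<zero>\<^bsub>A.W\<^esub> = \<zero>\<^bsub>B.W\<^esub>"
  by (simp add: word_map_def A.W_zero B.W_zero)

lemma g_map: "set xs \<subseteq> carrier M \<Longrightarrow> set (map g xs) \<subseteq> carrier M'"
  and h_map: "set fs \<subseteq> carrier N \<Longrightarrow> set (map h fs) \<subseteq> carrier N'"
  by auto

lemma wm_closed [simp]: "a \<in> carrier A.W \<Longrightarrow> wm a \<in> carrier B.W"
  by (induction rule: A.word_induct)
    (simp_all add: wm_zero wm_wt wm_add g_map h_map del: set_map)

lemma wm_mult:
  assumes "a \<in> carrier A.W" "b \<in> carrier A.W"
  shows "wm (a \<otimes>\<^bsub>A.W\<^esub> b) = wm a \<otimes>\<^bsub>B.W\<^esub> wm b"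
  using assms(1)
proof (induction rule: A.word_induct)
  case (word r xs fs)
  note 1 = this
  from assms(2) show ?case
    by (induction rule: A.word_induct)
      (use 1 in \<open>simp_all add: wm_zero A.W_null B.W_null A.wt_mult B.wt_mult wm_wt wm_add
        A.W_r_distr B.W_r_distr g_map h_map del: set_map\<close>)
qed (use assms(2) in \<open>simp_all add: wm_zero A.W_null B.W_null wm_add A.W_l_distr B.W_l_distr\<close>)

sublocale wm: ring_hom_ring A.W B.W wm
proof (rule ring_hom_ringI2[OF A.W_ring B.W_ring], rule ring_hom_memI)
  show "wm \<one>\<^bsub>A.W\<^esub> = \<one>\<^bsub>B.W\<^esub>" by (simp add: A.W_one B.W_one wm_wt)
qed (simp_all add: wm_mult wm_add)

lemma wm_minus:
  "\<lbrakk>a \<in> carrier A.W; b \<in> carrier A.W\<rbrakk> \<Longrightarrow> wm (a \<ominus>\<^bsub>A.W\<^esub> b) = wm a \<ominus>\<^bsub>B.W\<^esub> wm b"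
  by (simp add: A.W.minus_eq B.W.minus_eq)

text \<open>The preimage of an ideal under the ring homomorphism \<open>wm\<close> is an ideal, so
  it suffices to look at the generators.\<close>

lemma wm_Lin: "a \<in> A.Lin \<Longrightarrow> wm a \<in> B.Lin"
proof -
  have "A.Lin \<subseteq> {a \<in> carrier A.W. wm a \<in> B.Lin}"
    by (rule A.Lin_induct[OF wm.ideal_vimage[OF B.Lin_ideal]])
      (auto simp: wm_minus wm_add wm_wt A.M_add A.M_smult A.N_add A.N_smult
        g_add g_smult h_add h_smult B.Lin_mem simp del: A.W.minus_eq)
  then show "a \<in> A.Lin \<Longrightarrow> wm a \<in> B.Lin" by blast
qed

lemma wm_wpart: "a \<in> A.wpart \<epsilon> \<Longrightarrow> wm a \<in> B.wpart \<epsilon>"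
  by (induction rule: A.wpart_induct)
    (simp_all add: wm_zero wm_wt wm_add g_map h_map del: set_map)

text \<open>By \<open>q_compat\<close> a generator goes to the generator on the images of its
  letters. The closure rules survive because \<open>wm\<close> is a ring homomorphism that respects
  bidegrees.\<close>

lemma wm_K:
  assumes \<epsilon>: "\<epsilon> = 0 \<or> \<epsilon> = Suc 0" and a: "a \<in> A.K \<epsilon>"
  shows "wm a \<in> B.K \<epsilon>"
proof -
  have c: "b \<in> carrier A.W" if "b \<in> A.K \<epsilon>" for b using \<epsilon> that by auto
  from a show ?thesis
  proof (induction rule: A.relators.induct)
    case (lin a)
    then show ?case by (intro B.relators.lin wm_Lin wm_wpart)
  next
    case (gen a)
    from \<epsilon> gen have "\<epsilon> = 0 \<and> a \<in> A.even_gens \<or> \<epsilon> = Suc 0 \<and> a \<in> A.odd_gens"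
      by (auto simp: A.gens_simps)
    then show ?case
    proof (elim disjE conjE)
      assume e: "\<epsilon> = 0" and "a \<in> A.even_gens"
      then show ?case unfolding A.even_gens_def
        by (auto simp: wm_minus wm_wt e B.even_gens_mem simp flip: q_compat)
    next
      assume e: "\<epsilon> = Suc 0" and "a \<in> A.odd_gens"
      then show ?case unfolding A.odd_gens_def
        by (auto simp: wm_minus wm_wt e B.odd_gens_mem simp flip: q_compat)
    qed
  qed (simp_all add: c wm_wpart B.relators.intros)
qed

lemma tensor_res_tcl:
  assumes "a \<in> carrier A.W"
  shows "coset_map B.W B.Lin wm (A.tcl a) = B.tcl (wm a)"
proof -
  have "B.Lin +>\<^bsub>B.W\<^esub> wm b = B.tcl (wm a)" if "b \<in> A.tcl a" for b
  proof -
    obtain l where l: "l \<in> A.Lin" "b = l \<oplus>\<^bsub>A.W\<^esub> a"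
      using \<open>b \<in> A.tcl a\<close> by (auto simp: A.tcl_def a_r_coset_def')
    have lc: "l \<in> carrier A.W" using l(1) by (rule A.Lin.a_Hcarr)
    have "wm b \<ominus>\<^bsub>B.W\<^esub> wm a = wm l"
      using assms l lc by (simp add: B.W.minus_eq B.W.a_assoc B.W.r_neg)
    then have "B.tcl (wm b) = B.tcl (wm a)"
      using l lc assms by (subst B.tcl_eq_iff) (auto simp: wm_Lin simp del: wm.hom_add)
    then show ?thesis by (simp add: B.tcl_def)
  qed
  moreover have "a \<in> A.tcl a" using assms unfolding A.tcl_def by (rule A.Lin.a_rcos_self)
  ultimately show ?thesis unfolding coset_map_def by blast
qed

text \<open>Replaces the two nested \<open>coset_map\<close>s in the restriction of the Clifford
  presheaves by a single map on words. All later computations with these restrictions go through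
  this form.\<close>

lemma clifford_res:
  assumes \<epsilon>: "\<epsilon> = 0 \<or> \<epsilon> = Suc 0" and a: "a \<in> A.wpart \<epsilon>"
  shows "coset_map (B.Tp \<epsilon>) (B.tcl ` B.K \<epsilon>) (coset_map B.W B.Lin wm) (A.ccl \<epsilon> a) = B.ccl \<epsilon> (wm a)"
proof -
  have HA: "A.gens \<epsilon> \<subseteq> A.wpart \<epsilon>" and HB: "B.gens \<epsilon> \<subseteq> B.wpart \<epsilon>"
    using \<epsilon> A.gens_wpart B.gens_wpart by auto
  have "B.tcl ` B.K \<epsilon> +>\<^bsub>B.Tp \<epsilon>\<^esub> coset_map B.W B.Lin wm t = B.ccl \<epsilon> (wm a)" if t: "t \<in> A.ccl \<epsilon> a" for t
  proof -
    obtain b where b: "b \<in> A.wpart \<epsilon>" "t = A.tcl b" "b \<ominus>\<^bsub>A.W\<^esub> a \<in> A.K \<epsilon>"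
      using t A.mem_cl[OF HA a] by auto
    then have "wm b \<ominus>\<^bsub>B.W\<^esub> wm a \<in> B.K \<epsilon>" using a wm_K[OF \<epsilon> b(3)] by (simp add: wm_minus)
    then have "B.ccl \<epsilon> (wm b) = B.ccl \<epsilon> (wm a)"
      using a b by (subst B.cl_eq_iff[OF HB]) (auto simp: wm_wpart)
    then show ?thesis using b by (simp add: tensor_res_tcl B.cl_def)
  qed
  moreover have "A.tcl a \<in> A.ccl \<epsilon> a" by (rule A.cl_self[OF HA a])
  ultimately show ?thesis unfolding coset_map_def by blast
qed

end

section \<open>The components of degree (0, 0) and (1, 0)\<close>

context word_setting begin

text \<open>The degree \<open>(1, 0)\<close> component, composed with the linear form \<open>l\<close>. Modulo an ideal that contains
  all values \<open>q f x\<close> it descends to the Clifford module.\<close>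

definition degree_one :: "('m \<Rightarrow> 'r) \<Rightarrow> ('m list \<times> 'n list \<Rightarrow> 'r) \<Rightarrow> 'r" where
  "degree_one l a = (\<Oplus>x\<in>{x. a ([x], []) \<noteq> \<zero>}. a ([x], []) \<otimes> l x)"

definition linear_form :: "('m \<Rightarrow> 'r) \<Rightarrow> bool" where
  "linear_form l \<longleftrightarrow> (\<forall>x\<in>carrier M. l x \<in> carrier R) \<and>
     (\<forall>x\<in>carrier M. \<forall>y\<in>carrier M. l (x \<oplus>\<^bsub>M\<^esub> y) = l x \<oplus> l y) \<and>
     (\<forall>r\<in>carrier R. \<forall>x\<in>carrier M. l (r \<odot>\<^bsub>M\<^esub> x) = r \<otimes> l x)"

lemma W_mult_degree_zero:
  "\<lbrakk>a \<in> carrier W; b \<in> carrier W\<rbrakk> \<Longrightarrow> (a \<otimes>\<^bsub>W\<^esub> b) ([], []) = a ([], []) \<otimes> b ([], [])"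
  by (simp add: W_mult)

context
  fixes l assumes l: "linear_form l"
begin

lemma l_closed [simp]: "x \<in> carrier M \<Longrightarrow> l x \<in> carrier R"
  using l by (simp add: linear_form_def)

lemma degree_one_support:
  assumes "a \<in> carrier W"
  shows "finite {x. a ([x], []) \<noteq> \<zero>}" "{x. a ([x], []) \<noteq> \<zero>} \<subseteq> carrier M"
proof -
  have "inj (\<lambda>x. ([x], []) :: 'm list \<times> 'n list)" by (rule injI) simp
  from finite_vimageI[OF W_finite[OF assms] this] show "finite {x. a ([x], []) \<noteq> \<zero>}"
    by (simp add: vimage_def)
  show "{x. a ([x], []) \<noteq> \<zero>} \<subseteq> carrier M" using W_letters[OF assms, of "[x]" "[]" for x] by auto
qed

lemma degree_one_superset:
  assumes "a \<in> carrier W" "finite S" "{x. a ([x], []) \<noteq> \<zero>} \<subseteq> S" "S \<subseteq> carrier M"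
  shows "degree_one l a = (\<Oplus>x\<in>S. a ([x], []) \<otimes> l x)"
  unfolding degree_one_def
  by (rule add.finprod_mono_neutral_cong_left) (use assms in auto)

lemma degree_one_closed [simp]: "a \<in> carrier W \<Longrightarrow> degree_one l a \<in> carrier R"
  unfolding degree_one_def using degree_one_support(2)[of a] by (intro finsum_closed) (auto simp: subset_eq)

lemma degree_one_add:
  assumes a: "a \<in> carrier W" and b: "b \<in> carrier W"
  shows "degree_one l (a \<oplus>\<^bsub>W\<^esub> b) = degree_one l a \<oplus> degree_one l b"
proof -
  let ?S = "{x. a ([x], []) \<noteq> \<zero>} \<union> {x. b ([x], []) \<noteq> \<zero>}"
  have S: "finite ?S" "?S \<subseteq> carrier M" using degree_one_support a b by auto
  have sub: "{x. (a \<oplus>\<^bsub>W\<^esub> b) ([x], []) \<noteq> \<zero>} \<subseteq> ?S" by (auto simp: W_add_apply)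
  have "degree_one l (a \<oplus>\<^bsub>W\<^esub> b) = (\<Oplus>x\<in>?S. a ([x], []) \<otimes> l x \<oplus> b ([x], []) \<otimes> l x)"
    unfolding degree_one_superset[OF W_add_closed[OF a b] S(1) sub S(2)]
    by (rule finsum_cong') (use a b S(2) in \<open>auto simp: W_add_apply l_distr\<close>)
  also have "\<dots> = (\<Oplus>x\<in>?S. a ([x], []) \<otimes> l x) \<oplus> (\<Oplus>x\<in>?S. b ([x], []) \<otimes> l x)"
    by (rule finsum_addf) (use a b S(2) in auto)
  also have "\<dots> = degree_one l a \<oplus> degree_one l b"
    using degree_one_superset[OF a S(1) _ S(2)] degree_one_superset[OF b S(1) _ S(2)] by simp
  finally show ?thesis .
qed

lemma degree_one_zero: "degree_one l \<zero>\<^bsub>W\<^esub> = \<zero>"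
  by (simp add: degree_one_def W_zero)

lemma degree_one_uminus: "a \<in> carrier W \<Longrightarrow> degree_one l (\<ominus>\<^bsub>W\<^esub> a) = \<ominus> degree_one l a"
  using degree_one_add[of "\<ominus>\<^bsub>W\<^esub> a" a] degree_one_zero
  by (metis W.a_inv_closed W.l_neg degree_one_closed minus_equality)

lemma degree_one_minus:
  "\<lbrakk>a \<in> carrier W; b \<in> carrier W\<rbrakk> \<Longrightarrow> degree_one l (a \<ominus>\<^bsub>W\<^esub> b) = degree_one l a \<ominus> degree_one l b"
  by (simp add: W.minus_eq minus_eq degree_one_add degree_one_uminus)

lemma degree_one_wt:
  assumes "r \<in> carrier R" "set xs \<subseteq> carrier M" "set fs \<subseteq> carrier N"
  shows "degree_one l (wt r xs fs) = (if length xs = 1 \<and> fs = [] then r \<otimes> l (hd xs) else \<zero>)"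
proof (cases "\<exists>x. xs = [x] \<and> fs = []")
  case True
  then obtain x where x: "xs = [x]" "fs = []" by blast
  then have "degree_one l (wt r xs fs) = (\<Oplus>y\<in>{x}. wt r xs fs ([y], []) \<otimes> l y)"
    by (intro degree_one_superset) (use assms in simp, simp, auto simp: word_term_def, use assms in simp)
  then show ?thesis using x assms by (simp add: word_term_def)
next
  case False
  then have "\<not> (length xs = 1 \<and> fs = [])" by (auto simp: length_Suc_conv)
  moreover have "{x. wt r xs fs ([x], []) \<noteq> \<zero>} = {}" using False by (auto simp: word_term_def)
  ultimately show ?thesis unfolding degree_one_def by (simp only: if_False finsum_empty)
qed

text \<open>A word with a single letter splits only with one half empty. So
  \<open>degree_one l\<close> is a derivation over the ring homomorphism that takes the coefficient
  of the empty word.\<close>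

lemma degree_one_mult:
  assumes a: "a \<in> carrier W" and b: "b \<in> carrier W"
  shows "degree_one l (a \<otimes>\<^bsub>W\<^esub> b) = a ([], []) \<otimes> degree_one l b \<oplus> b ([], []) \<otimes> degree_one l a"
  using a
proof (induction rule: word_induct)
  case zero
  then show ?case using b by (simp add: W_null degree_one_zero) (simp add: W_zero)
next
  case (word r xs fs)
  note 1 = this
  from b show ?case
  proof (induction rule: word_induct)
    case zero
    then show ?case using 1 by (simp add: W_null degree_one_zero) (simp add: W_zero)
  next
    case (word s ys gs)
    have e: "wt r' xs' fs' ([], []) = (if xs' = [] \<and> fs' = [] then r' else \<zero>)" for r' xs' fs'
      by (auto simp: word_term_def)
    show ?case using 1 word
      by (cases xs; cases ys; cases fs; cases gs)
        (simp_all add: wt_mult degree_one_wt e m_ac)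
  next
    case (add b c)
    then show ?case using 1
      by (simp add: W_r_distr degree_one_add W_add_apply[of _ _ "([], [])"] r_distr l_distr a_ac)
  qed
next
  case (add a c)
  then show ?case using b
    by (simp add: W_l_distr degree_one_add W_add_apply[of _ _ "([], [])"] r_distr l_distr a_ac)
qed

text \<open>The two product rules make the common kernel an ideal. It contains the linearity
  relations, since none of them involves the empty word and l is linear.\<close>

lemma Lin_degree:
  assumes "a \<in> Lin" shows "a ([], []) = \<zero>" "degree_one l a = \<zero>"
proof -
  let ?J = "{a \<in> carrier W. a ([], []) = \<zero> \<and> degree_one l a = \<zero>}"
  have "ideal ?J W"
  proof (rule idealI[OF W_ring])
    show "subgroup ?J (add_monoid W)"
      by (rule W.add.subgroupI)
        (auto simp: W_add_apply W_uminus_apply degree_one_add degree_one_uminus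
          intro!: exI[of _ "\<zero>\<^bsub>W\<^esub>"] degree_one_zero, simp add: W_zero)
  qed (auto simp: W_mult_degree_zero degree_one_mult)
  then have "Lin \<subseteq> ?J"
    by (rule Lin_induct)
      (use l in \<open>auto simp: W_minus_apply W_add_apply degree_one_minus degree_one_add degree_one_wt
        M_add M_smult N_add N_smult linear_form_def minus_eq r_neg\<close>,
       simp_all add: word_term_def)
  then show "a ([], []) = \<zero>" "degree_one l a = \<zero>" using assms by auto
qed

end

end

section \<open>A cyclic odd module forces the unit ideal\<close>

context clifford_setting begin

lemma wpart1_degree_zero: "a \<in> wpart (Suc 0) \<Longrightarrow> a ([], []) = \<zero>"
  using wpart_length[of a "Suc 0" "[]" "[]"] by auto

text \<open>The only term of degree (1, 0) in an odd generator is the word y with coefficient - q f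
  x, and its value lies in I. Odd elements have no component of degree (0, 0), so by the product
  rule multiplication by an even element merely scales the value of a relator.\<close>

lemma K1_degree_one:
  assumes I: "ideal I R" and q: "\<And>f x. \<lbrakk>f \<in> carrier N; x \<in> carrier M\<rbrakk> \<Longrightarrow> q f x \<in> I"
    and l: "linear_form l" and a: "a \<in> K (Suc 0)"
  shows "degree_one l a \<in> I"
proof -
  interpret I: ideal I R by fact
  have z: "b ([], []) = \<zero>" if "b \<in> K (Suc 0)" for b
    using that by (intro wpart1_degree_zero K_wpart)
  note d = degree_one_add[OF l] degree_one_uminus[OF l] degree_one_mult[OF l] degree_one_minus[OF l]
    degree_one_wt[OF l] degree_one_closed[OF l] l_closed[OF l]
  from a show ?thesis
  proof (induction rule: relators.induct)
    case (lin a)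
    then show ?case using Lin_degree(2)[OF l] I.zero_closed by simp
  next
    case (gen a)
    then have "a \<in> odd_gens" by (simp add: gens_simps)
    then show ?case unfolding odd_gens_def
      using q by (auto simp: d minus_eq I.I_r_closed)
  qed (auto simp: d z intro: I.I_l_closed I.I_r_closed)
qed

text \<open>Modulo I, the class of \<omega> has coordinates s and t, and even elements act through
  their coefficients at the empty word. If both basis vectors are multiples of \<omega>, then c s =
  1, c t = 0 and d t = 1, hence 1 = (c s)(d t) = (c t)(d s) = 0.\<close>

lemma cyclic_imp_unit_ideal:
  assumes I: "ideal I R" and q: "\<And>f x. \<lbrakk>f \<in> carrier N; x \<in> carrier M\<rbrakk> \<Longrightarrow> q f x \<in> I"
    and \<omega>: "\<omega> \<in> wpart (Suc 0)" and c: "c \<in> wpart 0" "d \<in> wpart 0"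
    and x: "x \<in> carrier M" "y \<in> carrier M"
    and l: "linear_form l" "l x = \<one>" "l y = \<zero>" and k: "linear_form k" "k x = \<zero>" "k y = \<one>"
    and cx: "ccl (Suc 0) (c \<otimes>\<^bsub>W\<^esub> \<omega>) = ccl (Suc 0) (wt \<one> [x] [])"
    and dy: "ccl (Suc 0) (d \<otimes>\<^bsub>W\<^esub> \<omega>) = ccl (Suc 0) (wt \<one> [y] [])"
  shows "\<one> \<in> I"
proof -
  interpret I: ideal I R by fact
  let ?c = "c ([], [])" and ?d = "d ([], [])" and ?s = "degree_one l \<omega>" and ?t = "degree_one k \<omega>"
  have cl [simp]: "?c \<in> carrier R" "?d \<in> carrier R" "?s \<in> carrier R" "?t \<in> carrier R"
    using c \<omega> l k by (simp_all add: degree_one_closed)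
  have key: "b ([], []) \<otimes> degree_one m \<omega> \<ominus> m z \<in> I"
    if b: "b \<in> wpart 0" and z: "z \<in> carrier M" and m: "linear_form m"
      and eq: "ccl (Suc 0) (b \<otimes>\<^bsub>W\<^esub> \<omega>) = ccl (Suc 0) (wt \<one> [z] [])" for b z m
  proof -
    have "b \<otimes>\<^bsub>W\<^esub> \<omega> \<ominus>\<^bsub>W\<^esub> wt \<one> [z] [] \<in> K (Suc 0)"
      using eq b z \<omega> by (subst (asm) cl_eq_iff[OF gens_wpart(2)]) auto
    from K1_degree_one[OF I q m this] show ?thesis
      using b z \<omega> l_closed[OF m]
      by (simp add: degree_one_minus[OF m] degree_one_mult[OF m] degree_one_wt[OF m]
          degree_one_closed[OF m] wpart1_degree_zero)
  qed
  have 1: "?c \<otimes> ?s \<ominus> \<one> \<in> I" using key[OF c(1) x(1) l(1) cx] l by simp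
  have 2: "?c \<otimes> ?t \<in> I" using key[OF c(1) x(1) k(1) cx] k by (simp add: minus_eq)
  have 3: "?d \<otimes> ?t \<ominus> \<one> \<in> I" using key[OF c(2) x(2) k(1) dy] k by simp
  \<comment> \<open>A combination of the three congruences that lies in I and in which everything
    cancels except 1.\<close>
  have "(?c \<otimes> ?t) \<otimes> (?d \<otimes> ?s) \<oplus> \<ominus> ((?c \<otimes> ?s) \<otimes> (?d \<otimes> ?t \<ominus> \<one>)) \<oplus> \<ominus> (?c \<otimes> ?s \<ominus> \<one>) \<in> I"
    using 1 2 3 by (intro I.a_closed I.a_inv_closed I.I_l_closed[of "_ \<ominus> _"] I.I_r_closed[of "_ \<otimes> ?t"]) auto
  also have "(?c \<otimes> ?t) \<otimes> (?d \<otimes> ?s) \<oplus> \<ominus> ((?c \<otimes> ?s) \<otimes> (?d \<otimes> ?t \<ominus> \<one>)) \<oplus> \<ominus> (?c \<otimes> ?s \<ominus> \<one>) = \<one>"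
    using cl by algebra
  finally show ?thesis .
qed

end

section \<open>Germs and sheafification\<close>

text \<open>Zorn's lemma for ideals that omit 1. The union of a chain is closed under addition
  because any two of its elements lie in a common member.\<close>

lemma (in cring) ideal_subset_maximal:
  assumes I: "ideal I R" and one: "\<one> \<notin> I"
  obtains J where "maximalideal J R" "I \<subseteq> J"
proof -
  let ?A = "{J. ideal J R \<and> I \<subseteq> J \<and> \<one> \<notin> J}"
  have chain: "\<Union>C \<in> ?A" if C: "C \<noteq> {}" "subset.chain ?A C" for C
  proof -
    have CA: "C \<subseteq> ?A" using C(2) by (simp add: subset.chain_def)
    have pair: "\<exists>J\<in>C. a \<in> J \<and> b \<in> J" if "a \<in> \<Union>C" "b \<in> \<Union>C" for a b
      using that C(2) unfolding subset.chain_def by blast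
    have J: "ideal J R" if "J \<in> C" for J using that CA by blast
    have "ideal (\<Union>C) R"
    proof (rule idealI[OF ring_axioms])
      show "subgroup (\<Union>C) (add_monoid R)"
      proof (rule add.subgroupI)
        show "\<Union>C \<subseteq> carrier R" using ideal.Icarr[OF J] by (rule Union_least[OF subsetI])
        obtain J where "J \<in> C" using C(1) by blast
        with additive_subgroup.zero_closed[OF ideal.axioms(1)[OF J]] show "\<Union>C \<noteq> {}" by fastforce
        show "\<ominus> a \<in> \<Union>C" if "a \<in> \<Union>C" for a
          using that by (elim UnionE) (rule UnionI, assumption, rule additive_subgroup.a_inv_closed[OF ideal.axioms(1)[OF J]])
        show "a \<oplus> b \<in> \<Union>C" if ab: "a \<in> \<Union>C" "b \<in> \<Union>C" for a b
        proof -
          from pair[OF ab] obtain J where "J \<in> C" "a \<in> J" "b \<in> J" by blast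
          with additive_subgroup.a_closed[OF ideal.axioms(1)[OF J]] show ?thesis by (intro UnionI[of J])
        qed
      qed
      show "x \<otimes> a \<in> \<Union>C" "a \<otimes> x \<in> \<Union>C" if "a \<in> \<Union>C" "x \<in> carrier R" for a x
      proof -
        from that(1) obtain J where "J \<in> C" "a \<in> J" by blast
        with ideal.I_l_closed[OF J] ideal.I_r_closed[OF J] that(2)
        show "x \<otimes> a \<in> \<Union>C" "a \<otimes> x \<in> \<Union>C" by blast+
      qed
    qed
    then show "\<Union>C \<in> ?A" using CA C(1) by auto
  qed
  have "?A \<noteq> {}" using I one by blast
  from subset_Zorn_nonempty[OF this chain]
  obtain J where J: "J \<in> ?A" and max: "\<forall>K\<in>?A. J \<subseteq> K \<longrightarrow> K = J" by blast
  have "maximalideal J R"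
  proof (rule maximalidealI)
    show "ideal J R" "carrier R \<noteq> J" using J by auto
    show "K = J \<or> K = carrier R" if K: "ideal K R" "J \<subseteq> K" "K \<subseteq> carrier R" for K
    proof (cases "\<one> \<in> K")
      case True
      then show ?thesis using ideal.one_imp_carrier[OF K(1)] by simp
    next
      case False
      then show ?thesis using max K J by blast
    qed
  qed
  with J that show thesis by auto
qed

text \<open>A nonunit generates a proper principal ideal; this lies in some maximal ideal, hence in
  I.\<close>

lemma (in cring) unit_iff_notin_maximal:
  assumes unique: "\<And>J. maximalideal J R \<Longrightarrow> J = I" and u: "u \<in> carrier R" "u \<notin> I"
  shows "u \<in> Units R"
proof (rule ccontr)
  assume nu: "u \<notin> Units R"
  have "\<one> \<notin> PIdl u"
    using nu u(1) unfolding cgenideal_def Units_def by (auto simp: m_comm) 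
  from ideal_subset_maximal[OF cgenideal_ideal[OF u(1)] this] obtain J
    where "maximalideal J R" "PIdl u \<subseteq> J" .
  then show False using unique u cgenideal_self[OF u(1)] by blast
qed

text \<open>The Clifford presheaves need not satisfy glueing before they are sheafified, so germs
  are developed for presheaves; the structure sheaf is then a special case.\<close>

locale presheaf_of_sets =
  fixes X :: "'x topology" and F :: "('x, 'a, 'z) presheaf"
  assumes res_closed:
      "\<lbrakk>openin X U; openin X V; V \<subseteq> U; s \<in> carrier (sec F U)\<rbrakk> \<Longrightarrow> res F U V s \<in> carrier (sec F V)"
    and res_comp:
      "\<lbrakk>openin X U; openin X V; openin X W; W \<subseteq> V; V \<subseteq> U; s \<in> carrier (sec F U)\<rbrakk>
       \<Longrightarrow> res F V W (res F U V s) = res F U W s"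
begin

lemma mem_germ:
  "(V, t) \<in> germ X F p U s \<longleftrightarrow> openin X V \<and> p \<in> V \<and> t \<in> carrier (sec F V) \<and>
     (\<exists>W. openin X W \<and> p \<in> W \<and> W \<subseteq> U \<and> W \<subseteq> V \<and> res F U W s = res F V W t)"
  by (auto simp: germ_def)

lemma germ_self:
  "\<lbrakk>openin X U; p \<in> U; s \<in> carrier (sec F U)\<rbrakk> \<Longrightarrow> (U, s) \<in> germ X F p U s"
  unfolding mem_germ by blast

text \<open>Agreement near p is transitive: the two neighbourhoods of agreement are intersected, and
  the equations are restricted to the intersection.\<close>

lemma germ_subset:
  assumes U: "openin X U" "p \<in> U" "s \<in> carrier (sec F U)"
    and V: "openin X V" "p \<in> V" "t \<in> carrier (sec F V)"
    and W: "openin X W" "p \<in> W" "W \<subseteq> U" "W \<subseteq> V" "res F U W s = res F V W t"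
  shows "germ X F p U s \<subseteq> germ X F p V t"
proof (rule subrelI)
  fix V' t' assume "(V', t') \<in> germ X F p U s"
  then obtain W' where V': "openin X V'" "p \<in> V'" "t' \<in> carrier (sec F V')"
    and W': "openin X W'" "p \<in> W'" "W' \<subseteq> U" "W' \<subseteq> V'" "res F U W' s = res F V' W' t'"
    unfolding mem_germ by blast
  let ?W = "W \<inter> W'"
  have o: "openin X ?W" using W W' by blast
  have "res F V ?W t = res F W ?W (res F U W s)"
    using V W o res_comp[of V W ?W t] by simp
  also have "\<dots> = res F W' ?W (res F U W' s)"
    using U W W' o res_comp[of U W ?W s] res_comp[of U W' ?W s] by simp
  also have "\<dots> = res F V' ?W t'"
    using V' W' o res_comp[of V' W' ?W t'] by simp
  finally have "res F V ?W t = res F V' ?W t'" .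
  moreover have "p \<in> ?W" "?W \<subseteq> V" "?W \<subseteq> V'" using W W' by auto
  ultimately show "(V', t') \<in> germ X F p V t" unfolding mem_germ using V' o by blast
qed

lemma germ_eq_iff:
  assumes U: "openin X U" "p \<in> U" "s \<in> carrier (sec F U)"
    and V: "openin X V" "p \<in> V" "t \<in> carrier (sec F V)"
  shows "germ X F p U s = germ X F p V t \<longleftrightarrow>
    (\<exists>W. openin X W \<and> p \<in> W \<and> W \<subseteq> U \<and> W \<subseteq> V \<and> res F U W s = res F V W t)"
proof
  assume "germ X F p U s = germ X F p V t"
  with germ_self[OF V] have "(V, t) \<in> germ X F p U s" by simp
  then show "\<exists>W. openin X W \<and> p \<in> W \<and> W \<subseteq> U \<and> W \<subseteq> V \<and> res F U W s = res F V W t"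
    unfolding mem_germ by blast
next
  assume "\<exists>W. openin X W \<and> p \<in> W \<and> W \<subseteq> U \<and> W \<subseteq> V \<and> res F U W s = res F V W t"
  then obtain W where W: "openin X W" "p \<in> W" "W \<subseteq> U" "W \<subseteq> V" "res F U W s = res F V W t" by blast
  show "germ X F p U s = germ X F p V t"
    using germ_subset[OF U V W] germ_subset[OF V U W(1,2,4,3) W(5)[symmetric]] by blast
qed

lemma germ_res:
  assumes "openin X U" "openin X V" "p \<in> V" "V \<subseteq> U" "s \<in> carrier (sec F U)"
  shows "germ X F p V (res F U V s) = germ X F p U s"
  using assms res_comp[of U V V s] by (subst germ_eq_iff) (auto intro: res_closed)

lemma stalk_carrier:
  "g \<in> carrier (stalk X F p) \<longleftrightarrow>
     (\<exists>U s. g = germ X F p U s \<and> openin X U \<and> p \<in> U \<and> s \<in> carrier (sec F U))"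
  by (auto simp: stalk_def)

lemma sheafify_sec_carrier:
  "\<sigma> \<in> carrier (sheafify_sec X F U) \<longleftrightarrow> \<sigma> \<in> extensional U \<and>
     (\<forall>p\<in>U. \<exists>V s. openin X V \<and> p \<in> V \<and> V \<subseteq> U \<and> s \<in> carrier (sec F V) \<and>
        (\<forall>q\<in>V. \<sigma> q = germ X F q V s))"
  by (simp add: sheafify_sec_def)

lemma sheafify_secE:
  assumes "\<sigma> \<in> carrier (sheafify_sec X F U)" "p \<in> U"
  obtains V s where "openin X V" "p \<in> V" "V \<subseteq> U" "s \<in> carrier (sec F V)"
    "\<forall>q\<in>V. \<sigma> q = germ X F q V s"
  using assms unfolding sheafify_sec_carrier by blast

lemma germ_section:
  assumes "openin X U" "s \<in> carrier (sec F U)"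
  shows "(\<lambda>p\<in>U. germ X F p U s) \<in> carrier (sheafify_sec X F U)"
  unfolding sheafify_sec_carrier using assms by auto

end

lemma (in sheaf) presheaf_of_sets: "presheaf_of_sets X F"
  by unfold_locales (fact res_closed res_comp)+

text \<open>One notion for multiplication and addition of a presheaf of rings, for the scalar
  action, and for addition in the odd module, so that \<open>germ_op\<close> is evaluated once for
  all of them.\<close>

locale presheaf_action = A: presheaf_of_sets X A + B: presheaf_of_sets X B
  for X :: "'x topology" and A :: "('x, 'a, 'y) presheaf" and B :: "('x, 'b, 'z) presheaf" +
  fixes f :: "'x set \<Rightarrow> 'a \<Rightarrow> 'b \<Rightarrow> 'b"
  assumes f_closed: "\<lbrakk>openin X U; a \<in> carrier (sec A U); b \<in> carrier (sec B U)\<rbrakk> \<Longrightarrow> f U a b \<in> carrier (sec B U)"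
    and f_res: "\<lbrakk>openin X U; openin X V; V \<subseteq> U; a \<in> carrier (sec A U); b \<in> carrier (sec B U)\<rbrakk>
      \<Longrightarrow> res B U V (f U a b) = f V (res A U V a) (res B U V b)"
begin

abbreviation act where "act p \<equiv> germ_op X A B p f"

text \<open>\<open>germ_op\<close> is a union over all pairs of representatives. It collapses
  because any two pairs have equal restrictions to some neighbourhood \<open>S \<inter> T\<close> of
  p, and f commutes with restriction.\<close>

lemma act_germ:
  assumes U: "openin X U" "p \<in> U" "a \<in> carrier (sec A U)"
    and V: "openin X V" "p \<in> V" "b \<in> carrier (sec B V)"
  shows "act p (germ X A p U a) (germ X B p V b) =
    germ X B p (U \<inter> V) (f (U \<inter> V) (res A U (U \<inter> V) a) (res B V (U \<inter> V) b))"
proof -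
  let ?h = "\<lambda>U a V b. germ X B p (U \<inter> V) (f (U \<inter> V) (res A U (U \<inter> V) a) (res B V (U \<inter> V) b))"
  have eq: "?h U' a' V' b' = ?h U a V b"
    if U'a': "(U', a') \<in> germ X A p U a" and V'b': "(V', b') \<in> germ X B p V b" for U' a' V' b'
  proof -
    from U'a' obtain S where U': "openin X U'" "p \<in> U'" "a' \<in> carrier (sec A U')"
      and S: "openin X S" "p \<in> S" "S \<subseteq> U" "S \<subseteq> U'" "res A U S a = res A U' S a'"
      unfolding A.mem_germ by blast
    from V'b' obtain T where V': "openin X V'" "p \<in> V'" "b' \<in> carrier (sec B V')"
      and T: "openin X T" "p \<in> T" "T \<subseteq> V" "T \<subseteq> V'" "res B V T b = res B V' T b'"
      unfolding B.mem_germ by blast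
    let ?W = "S \<inter> T"
    have o [simp]: "openin X ?W" "openin X (U \<inter> V)" "openin X (U' \<inter> V')" using U V U' V' S T by auto
    have ra: "res A U ?W a = res A U' ?W a'"
      using A.res_comp[of U S ?W a] A.res_comp[of U' S ?W a'] U U' S by simp
    have rb: "res B V ?W b = res B V' ?W b'"
      using B.res_comp[of V T ?W b] B.res_comp[of V' T ?W b'] V V' T by simp
    have *: "germ X B p ?W (f ?W (res A U ?W a) (res B V ?W b)) = ?h U a V b"
      if "openin X U" "p \<in> U" "a \<in> carrier (sec A U)" "openin X V" "p \<in> V" "b \<in> carrier (sec B V)"
        "S \<subseteq> U" "T \<subseteq> V" for U a V b
    proof -
      have o: "openin X (U \<inter> V)" "openin X ?W" and s: "?W \<subseteq> U \<inter> V" and p: "p \<in> ?W"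
        using that S T by auto
      have ca: "res A U (U \<inter> V) a \<in> carrier (sec A (U \<inter> V))" and
        cb: "res B V (U \<inter> V) b \<in> carrier (sec B (U \<inter> V))"
        using that o by (auto intro: A.res_closed B.res_closed)
      have "res A (U \<inter> V) ?W (res A U (U \<inter> V) a) = res A U ?W a"
        using that o s by (intro A.res_comp) auto
      moreover have "res B (U \<inter> V) ?W (res B V (U \<inter> V) b) = res B V ?W b"
        using that o s by (intro B.res_comp) auto
      ultimately show ?thesis
        using B.germ_res[OF o p s f_closed[OF o(1) ca cb]] f_res[OF o s ca cb] by simp
    qed
    from *[OF U V S(3) T(3)] *[OF U' V' S(4) T(4)] ra rb show ?thesis by simp
  qed
  have "act p (germ X A p U a) (germ X B p V b) =
      (\<Union>(U', a')\<in>germ X A p U a. \<Union>(V', b')\<in>germ X B p V b. ?h U' a' V' b')"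
    by (simp add: germ_op_def)
  also have "\<dots> = (\<Union>(U', a')\<in>germ X A p U a. \<Union>(V', b')\<in>germ X B p V b. ?h U a V b)"
    by (intro SUP_cong refl) (auto simp: eq)
  also have "\<dots> = ?h U a V b"
    using A.germ_self[OF U] B.germ_self[OF V] by auto
  finally show ?thesis .
qed

lemma act_germ_same:
  assumes U: "openin X U" "p \<in> U" "a \<in> carrier (sec A U)" "b \<in> carrier (sec B U)"
  shows "act p (germ X A p U a) (germ X B p U b) = germ X B p U (f U a b)"
  using act_germ[of U p a U b] B.germ_res[of U U p "f U a b"] f_res[of U U a b] f_closed[of U a b] U
  by simp

lemma act_section_closed:
  assumes U: "openin X U" and \<sigma>: "\<sigma> \<in> carrier (sheafify_sec X A U)"
    and \<tau>: "\<tau> \<in> carrier (sheafify_sec X B U)"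
  shows "(\<lambda>p\<in>U. act p (\<sigma> p) (\<tau> p)) \<in> carrier (sheafify_sec X B U)"
  unfolding B.sheafify_sec_carrier
proof (intro conjI ballI restrict_extensional)
  fix p assume p: "p \<in> U"
  from \<sigma> p obtain V a where V: "openin X V" "p \<in> V" "V \<subseteq> U" "a \<in> carrier (sec A V)"
    "\<forall>q\<in>V. \<sigma> q = germ X A q V a" by (rule A.sheafify_secE)
  from \<tau> p obtain W b where W: "openin X W" "p \<in> W" "W \<subseteq> U" "b \<in> carrier (sec B W)"
    "\<forall>q\<in>W. \<tau> q = germ X B q W b" by (rule B.sheafify_secE)
  let ?c = "f (V \<inter> W) (res A V (V \<inter> W) a) (res B W (V \<inter> W) b)"
  have "?c \<in> carrier (sec B (V \<inter> W))"
    using V W by (intro f_closed A.res_closed B.res_closed) auto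
  moreover have "(\<lambda>p\<in>U. act p (\<sigma> p) (\<tau> p)) q = germ X B q (V \<inter> W) ?c" if "q \<in> V \<inter> W" for q
    using that V W act_germ[of V q a W b] by auto
  moreover have "openin X (V \<inter> W)" "p \<in> V \<inter> W" "V \<inter> W \<subseteq> U" using V W by auto
  ultimately show "\<exists>Z c. openin X Z \<and> p \<in> Z \<and> Z \<subseteq> U \<and> c \<in> carrier (sec B Z) \<and>
      (\<forall>q\<in>Z. (\<lambda>p\<in>U. act p (\<sigma> p) (\<tau> p)) q = germ X B q Z c)" by blast
qed

text \<open>The way back from stalks to sections. It turns an inverse in a stalk into an inverse on
  a neighbourhood, and a multiple of a germ of the generator into a multiple of a section.\<close>

lemma act_germ_eqE:
  assumes U: "openin X U" "p \<in> U" "a \<in> carrier (sec A U)"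
    and V: "openin X V" "p \<in> V" "b \<in> carrier (sec B V)"
    and Z: "openin X Z" "p \<in> Z" "c \<in> carrier (sec B Z)"
    and eq: "act p (germ X A p U a) (germ X B p V b) = germ X B p Z c"
  obtains W where "openin X W" "p \<in> W" "W \<subseteq> U" "W \<subseteq> V" "W \<subseteq> Z"
    "f W (res A U W a) (res B V W b) = res B Z W c"
proof -
  let ?I = "U \<inter> V"
  have o: "openin X ?I" "p \<in> ?I" using U V by auto
  have ca: "res A U ?I a \<in> carrier (sec A ?I)" and cb: "res B V ?I b \<in> carrier (sec B ?I)"
    using U V o by (auto intro: A.res_closed B.res_closed)
  have "germ X B p ?I (f ?I (res A U ?I a) (res B V ?I b)) = germ X B p Z c"
    using act_germ[OF U V] eq by simp
  then obtain W where W: "openin X W" "p \<in> W" "W \<subseteq> ?I" "W \<subseteq> Z"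
    "res B ?I W (f ?I (res A U ?I a) (res B V ?I b)) = res B Z W c"
    using B.germ_eq_iff[OF o f_closed[OF o(1) ca cb] Z] by blast
  moreover have "res A ?I W (res A U ?I a) = res A U W a" "res B ?I W (res B V ?I b) = res B V W b"
    using U V o W by (auto intro!: A.res_comp B.res_comp)
  ultimately show thesis using that[of W] f_res[OF o(1) W(1,3) ca cb] by auto
qed

text \<open>Bijectivity on sections over all small open sets makes multiplication by v injective on
  stalks and gives local preimages. Because preimage germs are unique, the local preimages agree
  where they meet and form one section.\<close>

theorem sheafify_bij:
  assumes V0: "openin X V0" and v: "v \<in> carrier (sec B V0)"
    and bij: "\<And>W. \<lbrakk>openin X W; W \<subseteq> V0\<rbrakk> \<Longrightarrow>
      bij_betw (\<lambda>a. f W a (res B V0 W v)) (carrier (sec A W)) (carrier (sec B W))"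
    and W: "openin X W" "W \<subseteq> V0"
  shows "bij_betw (\<lambda>\<sigma>. \<lambda>p\<in>W. act p (\<sigma> p) (germ X B p V0 v))
    (carrier (sheafify_sec X A W)) (carrier (sheafify_sec X B W))"
proof -
  have act_v: "act p (germ X A p S a) (germ X B p V0 v) = germ X B p S (f S a (res B V0 S v))"
    if "openin X S" "p \<in> S" "S \<subseteq> V0" "a \<in> carrier (sec A S)" for p S a
    using act_germ_same[of S p a "res B V0 S v"] B.germ_res[of V0 S p v] B.res_closed[of V0 S v] that V0 v
    by simp
  have inj: "g = h"
    if g: "g \<in> carrier (stalk X A p)" and h: "h \<in> carrier (stalk X A p)" and p: "p \<in> V0"
      and eq: "act p g (germ X B p V0 v) = act p h (germ X B p V0 v)" for p g h
  proof -
    \<comment> \<open>Every germ at p has a representative on a set inside \<open>V0\<close>, where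
      v can be restricted to it.\<close>
    have *: "\<exists>S a. openin X S \<and> p \<in> S \<and> S \<subseteq> V0 \<and> a \<in> carrier (sec A S) \<and> g = germ X A p S a"
      if "g \<in> carrier (stalk X A p)" for g
    proof -
      from that obtain S a where "g = germ X A p S a" "openin X S" "p \<in> S" "a \<in> carrier (sec A S)"
        unfolding A.stalk_carrier by blast
      then show ?thesis using V0 p A.germ_res[of S "S \<inter> V0" p a] A.res_closed[of S "S \<inter> V0" a]
        by (intro exI[of _ "S \<inter> V0"] exI[of _ "res A S (S \<inter> V0) a"]) auto
    qed
    from *[OF g] obtain S a where S: "openin X S" "p \<in> S" "S \<subseteq> V0" "a \<in> carrier (sec A S)"
      "g = germ X A p S a" by blast
    from *[OF h] obtain T b where T: "openin X T" "p \<in> T" "T \<subseteq> V0" "b \<in> carrier (sec A T)"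
      "h = germ X A p T b" by blast
    have cS: "res B V0 S v \<in> carrier (sec B S)" and cT: "res B V0 T v \<in> carrier (sec B T)"
      using S T V0 v by (auto intro: B.res_closed)
    have "germ X B p S (f S a (res B V0 S v)) = germ X B p T (f T b (res B V0 T v))"
      using eq S T act_v by simp
    then obtain Z where Z: "openin X Z" "p \<in> Z" "Z \<subseteq> S" "Z \<subseteq> T"
      "res B S Z (f S a (res B V0 S v)) = res B T Z (f T b (res B V0 T v))"
      using B.germ_eq_iff[OF S(1,2) f_closed[OF S(1,4) cS] T(1,2) f_closed[OF T(1,4) cT]] by blast
    have "f Z (res A S Z a) (res B V0 Z v) = f Z (res A T Z b) (res B V0 Z v)"
      using Z(5) f_res[OF S(1) Z(1,3) S(4) cS] f_res[OF T(1) Z(1,4) T(4) cT]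
        B.res_comp[OF V0 S(1) Z(1,3) S(3) v] B.res_comp[OF V0 T(1) Z(1,4) T(3) v] by simp
    moreover have "res A S Z a \<in> carrier (sec A Z)" "res A T Z b \<in> carrier (sec A Z)"
      using S T Z by (auto intro: A.res_closed)
    moreover have "Z \<subseteq> V0" using Z S by blast
    ultimately have "res A S Z a = res A T Z b"
      using bij[OF Z(1)] unfolding bij_betw_def inj_on_def by blast
    then show ?thesis using S T Z A.germ_eq_iff[OF S(1,2,4) T(1,2,4)] by blast
  qed
  have st: "\<sigma> p \<in> carrier (stalk X A p)" if "\<sigma> \<in> carrier (sheafify_sec X A W)" "p \<in> W" for \<sigma> p
    using that by (rule A.sheafify_secE) (auto simp: A.stalk_carrier)
  have vW: "(\<lambda>p\<in>W. germ X B p V0 v) \<in> carrier (sheafify_sec X B W)"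
  proof -
    have "(\<lambda>p\<in>W. germ X B p V0 v) = (\<lambda>p\<in>W. germ X B p W (res B V0 W v))"
      using B.germ_res[OF V0 W(1) _ W(2) v] by (intro restrict_ext) simp
    then show ?thesis using B.germ_section[OF W(1) B.res_closed[OF V0 W v]] by simp
  qed
  show ?thesis
  proof (rule bij_betwI')
    fix \<sigma> \<tau> assume \<sigma>: "\<sigma> \<in> carrier (sheafify_sec X A W)" and \<tau>: "\<tau> \<in> carrier (sheafify_sec X A W)"
    show "((\<lambda>p\<in>W. act p (\<sigma> p) (germ X B p V0 v)) = (\<lambda>p\<in>W. act p (\<tau> p) (germ X B p V0 v))) = (\<sigma> = \<tau>)"
    proof
      assume eq: "(\<lambda>p\<in>W. act p (\<sigma> p) (germ X B p V0 v)) = (\<lambda>p\<in>W. act p (\<tau> p) (germ X B p V0 v))"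
      show "\<sigma> = \<tau>"
      proof (rule extensionalityI[of _ W])
        fix p assume p: "p \<in> W"
        have "act p (\<sigma> p) (germ X B p V0 v) = act p (\<tau> p) (germ X B p V0 v)"
          using fun_cong[OF eq, of p] p by simp
        then show "\<sigma> p = \<tau> p" using inj[OF st[OF \<sigma> p] st[OF \<tau> p]] p W by blast
      qed (use \<sigma> \<tau> in \<open>simp_all add: A.sheafify_sec_carrier\<close>)
    qed simp
  next
    fix \<sigma> assume \<sigma>: "\<sigma> \<in> carrier (sheafify_sec X A W)"
    have "(\<lambda>p\<in>W. act p (\<sigma> p) (germ X B p V0 v)) =
        (\<lambda>p\<in>W. act p (\<sigma> p) ((\<lambda>p\<in>W. germ X B p V0 v) p))" by (rule restrict_ext) simp
    then show "(\<lambda>p\<in>W. act p (\<sigma> p) (germ X B p V0 v)) \<in> carrier (sheafify_sec X B W)"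
      using act_section_closed[OF W(1) \<sigma> vW] by simp
  next
    fix \<beta> assume \<beta>: "\<beta> \<in> carrier (sheafify_sec X B W)"
    have loc: "\<exists>S a. openin X S \<and> p \<in> S \<and> S \<subseteq> W \<and> a \<in> carrier (sec A S) \<and>
        (\<forall>q\<in>S. act q (germ X A q S a) (germ X B q V0 v) = \<beta> q)" if p: "p \<in> W" for p
    proof -
      from \<beta> p obtain S b where S: "openin X S" "p \<in> S" "S \<subseteq> W" "b \<in> carrier (sec B S)"
        "\<forall>q\<in>S. \<beta> q = germ X B q S b" by (rule B.sheafify_secE)
      have SV: "S \<subseteq> V0" using S W by blast
      have "b \<in> (\<lambda>a. f S a (res B V0 S v)) ` carrier (sec A S)"
        using bij_betw_imp_surj_on[OF bij[OF S(1) SV]] S(4) by simp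
      then obtain a where a: "a \<in> carrier (sec A S)" "f S a (res B V0 S v) = b" by auto
      then show ?thesis using S SV act_v[OF S(1) _ SV a(1)] by (intro exI[of _ S] exI[of _ a]) auto
    qed
    \<comment> \<open>The preimage germ is chosen separately at each point. By injectivity on stalks
      it coincides with the germ of any local preimage from \<open>loc\<close>, so the family is
      locally given by sections.\<close>
    define \<sigma> where "\<sigma> = (\<lambda>p\<in>W. THE g. g \<in> carrier (stalk X A p) \<and> act p g (germ X B p V0 v) = \<beta> p)"
    have \<sigma>_eq: "\<sigma> q = g"
      if "g \<in> carrier (stalk X A q)" "act q g (germ X B q V0 v) = \<beta> q" "q \<in> W" for q g
    proof -
      have "q \<in> V0" using that(3) W by blast
      then have "(THE g. g \<in> carrier (stalk X A q) \<and> act q g (germ X B q V0 v) = \<beta> q) = g"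
      proof (intro the_equality conjI)
        fix g' assume "g' \<in> carrier (stalk X A q) \<and> act q g' (germ X B q V0 v) = \<beta> q"
        then show "g' = g" using inj[of g' q g] that(1,2) \<open>q \<in> V0\<close> by simp
      qed (use that in simp_all)
      then show ?thesis using that(3) by (simp add: \<sigma>_def)
    qed
    have "\<exists>S a. openin X S \<and> p \<in> S \<and> S \<subseteq> W \<and> a \<in> carrier (sec A S) \<and>
        (\<forall>q\<in>S. \<sigma> q = germ X A q S a \<and> act q (\<sigma> q) (germ X B q V0 v) = \<beta> q)" if p: "p \<in> W" for p
    proof -
      from loc[OF p] obtain S a where S: "openin X S" "p \<in> S" "S \<subseteq> W" "a \<in> carrier (sec A S)"
        "\<And>q. q \<in> S \<Longrightarrow> act q (germ X A q S a) (germ X B q V0 v) = \<beta> q" by blast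
      have "\<sigma> q = germ X A q S a" if "q \<in> S" for q
        using S that by (intro \<sigma>_eq) (auto simp: A.stalk_carrier)
      then show ?thesis using S by (intro exI[of _ S] exI[of _ a]) auto
    qed
    note loc' = this
    have "\<sigma> \<in> carrier (sheafify_sec X A W)"
      unfolding A.sheafify_sec_carrier
    proof (intro conjI ballI)
      show "\<sigma> \<in> extensional W" by (simp add: \<sigma>_def)
      fix p assume "p \<in> W"
      from loc'[OF this] show "\<exists>V s. openin X V \<and> p \<in> V \<and> V \<subseteq> W \<and> s \<in> carrier (sec A V) \<and>
          (\<forall>q\<in>V. \<sigma> q = germ X A q V s)" by blast
    qed
    moreover have "\<beta> = (\<lambda>p\<in>W. act p (\<sigma> p) (germ X B p V0 v))"
    proof (rule extensionalityI[of _ W])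
      show "\<beta> p = (\<lambda>p\<in>W. act p (\<sigma> p) (germ X B p V0 v)) p" if "p \<in> W" for p
        using loc'[OF that] that by auto
    qed (use \<beta> in \<open>simp_all add: B.sheafify_sec_carrier\<close>)
    ultimately show "\<exists>\<sigma>\<in>carrier (sheafify_sec X A W). \<beta> = (\<lambda>p\<in>W. act p (\<sigma> p) (germ X B p V0 v))"
      by blast
  qed
qed

end

section \<open>Free modules and the dual sheaf\<close>

text \<open>The sum is evaluated from the definition of the fold, so that it applies to the
  sheafified module without the laws of an abelian monoid: a fold over one index only adds zero on
  the right.\<close>

lemma finsum_lessThan_one:
  assumes "f (0::nat) \<in> carrier G" "\<zero>\<^bsub>G\<^esub> \<in> carrier G" "f 0 \<oplus>\<^bsub>G\<^esub> \<zero>\<^bsub>G\<^esub> = f 0"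
  shows "finsum G f {..<1} = f 0"
proof -
  let ?D = "foldSetD (carrier G) (\<lambda>x y. f x \<oplus>\<^bsub>G\<^esub> y) \<zero>\<^bsub>G\<^esub>"
  have "({0}, f 0) \<in> ?D"
    using foldSetD.insertI[of 0 "{}" "\<lambda>x y. f x \<oplus>\<^bsub>G\<^esub> y" "\<zero>\<^bsub>G\<^esub>" "carrier G" "\<zero>\<^bsub>G\<^esub>"] assms
    by (simp add: foldSetD.emptyI)
  moreover have "y = f 0" if "({0}, y) \<in> ?D" for y
    using that
  proof (cases rule: foldSetD.cases)
    case (insertI x A z)
    then have "x = 0" "A = {}" by auto
    with insertI show ?thesis using assms(3) by (auto elim: foldSetD.cases)
  qed auto
  ultimately have "(THE y. ({0}, y) \<in> ?D) = f 0" by (rule the_equality)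
  moreover have "{..<1::nat} = {0}" by auto
  ultimately show ?thesis by (simp add: finsum_def finprod_def foldD_def comp_def)
qed

lemma bij_betw_PiE_singleton: "bij_betw (\<lambda>c. c (0::nat)) ({..<1} \<rightarrow>\<^sub>E C) C"
proof (rule bij_betw_byWitness[where f' = "\<lambda>r. \<lambda>i\<in>{..<1}. r"])
  show "\<forall>c\<in>{..<1} \<rightarrow>\<^sub>E C. (\<lambda>i\<in>{..<1::nat}. c 0) = c"
    by (auto simp: fun_eq_iff PiE_def extensional_def)
qed (auto simp: PiE_iff split: if_splits)

context module begin

lemma free_rank_one:
  assumes e: "e (0::nat) \<in> carrier M"
    and bij: "bij_betw (\<lambda>c. \<Oplus>\<^bsub>M\<^esub>i\<in>{..<1}. c i \<odot>\<^bsub>M\<^esub> e i) ({..<1} \<rightarrow>\<^sub>E carrier R) (carrier M)"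
  shows "bij_betw (\<lambda>r. r \<odot>\<^bsub>M\<^esub> e 0) (carrier R) (carrier M)"
proof -
  have "bij_betw (\<lambda>c. c 0 \<odot>\<^bsub>M\<^esub> e 0) ({..<1::nat} \<rightarrow>\<^sub>E carrier R) (carrier M)"
    by (rule iffD1[OF bij_betw_cong bij], rule finsum_lessThan_one) (use e in \<open>auto simp: PiE_iff\<close>)
  then have "bij_betw ((\<lambda>r. r \<odot>\<^bsub>M\<^esub> e 0) \<circ> (\<lambda>c. c 0)) ({..<1::nat} \<rightarrow>\<^sub>E carrier R) (carrier M)"
    by (simp add: comp_def)
  then show ?thesis by (rule iffD2[OF bij_betw_comp_iff[OF bij_betw_PiE_singleton]])
qed

text \<open>The dual basis of a free module of rank two. Linearity comes from uniqueness: adding or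
  scaling expansions gives an expansion again.\<close>

lemma coordinates:
  assumes e: "e (0::nat) \<in> carrier M" "e 1 \<in> carrier M"
    and bij: "bij_betw (\<lambda>c. \<Oplus>\<^bsub>M\<^esub>i\<in>{..<2}. c i \<odot>\<^bsub>M\<^esub> e i) ({..<2} \<rightarrow>\<^sub>E carrier R) (carrier M)"
  obtains l k where
    "\<And>x. x \<in> carrier M \<Longrightarrow> l x \<in> carrier R \<and> k x \<in> carrier R"
    "\<And>x y. \<lbrakk>x \<in> carrier M; y \<in> carrier M\<rbrakk> \<Longrightarrow> l (x \<oplus>\<^bsub>M\<^esub> y) = l x \<oplus> l y \<and> k (x \<oplus>\<^bsub>M\<^esub> y) = k x \<oplus> k y"
    "\<And>r x. \<lbrakk>r \<in> carrier R; x \<in> carrier M\<rbrakk> \<Longrightarrow> l (r \<odot>\<^bsub>M\<^esub> x) = r \<otimes> l x \<and> k (r \<odot>\<^bsub>M\<^esub> x) = r \<otimes> k x"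
    "l (e 0) = \<one>" "l (e 1) = \<zero>" "k (e 0) = \<zero>" "k (e 1) = \<one>"
proof -
  have sum: "(\<Oplus>\<^bsub>M\<^esub>i\<in>{..<2}. c i \<odot>\<^bsub>M\<^esub> e i) = c 0 \<odot>\<^bsub>M\<^esub> e 0 \<oplus>\<^bsub>M\<^esub> c 1 \<odot>\<^bsub>M\<^esub> e 1"
    if "c 0 \<in> carrier R" "c 1 \<in> carrier R" for c :: "nat \<Rightarrow> 'a"
  proof -
    have "{..<2::nat} = insert 0 {1}" by auto
    then show ?thesis using that e by (simp add: M.finsum_insert)
  qed
  have ex: "\<exists>r s. r \<in> carrier R \<and> s \<in> carrier R \<and> x = r \<odot>\<^bsub>M\<^esub> e 0 \<oplus>\<^bsub>M\<^esub> s \<odot>\<^bsub>M\<^esub> e 1"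
    if x: "x \<in> carrier M" for x
  proof -
    have "x \<in> (\<lambda>c. \<Oplus>\<^bsub>M\<^esub>i\<in>{..<2}. c i \<odot>\<^bsub>M\<^esub> e i) ` ({..<2} \<rightarrow>\<^sub>E carrier R)"
      using bij_betw_imp_surj_on[OF bij] x by simp
    then obtain c where c: "c \<in> {..<2} \<rightarrow>\<^sub>E carrier R" "x = (\<Oplus>\<^bsub>M\<^esub>i\<in>{..<2}. c i \<odot>\<^bsub>M\<^esub> e i)" by auto
    then have "c 0 \<in> carrier R" "c 1 \<in> carrier R" by (auto simp: PiE_iff)
    with c sum show ?thesis by auto
  qed
  have uniq: "r = r' \<and> s = s'"
    if "r \<in> carrier R" "s \<in> carrier R" "r' \<in> carrier R" "s' \<in> carrier R"
      "r \<odot>\<^bsub>M\<^esub> e 0 \<oplus>\<^bsub>M\<^esub> s \<odot>\<^bsub>M\<^esub> e 1 = r' \<odot>\<^bsub>M\<^esub> e 0 \<oplus>\<^bsub>M\<^esub> s' \<odot>\<^bsub>M\<^esub> e 1" for r s r' s'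
  proof -
    let ?c = "\<lambda>r s. \<lambda>i\<in>{..<2::nat}. if i = 0 then r else s"
    have "?c r s = ?c r' s'"
      by (rule inj_onD[OF bij_betw_imp_inj_on[OF bij]]) (use that in \<open>auto simp: sum PiE_iff\<close>)
    from fun_cong[OF this, of 0] fun_cong[OF this, of 1] show ?thesis by auto
  qed
  from ex have "\<forall>x. \<exists>r s. x \<in> carrier M \<longrightarrow> r \<in> carrier R \<and> s \<in> carrier R \<and> x = r \<odot>\<^bsub>M\<^esub> e 0 \<oplus>\<^bsub>M\<^esub> s \<odot>\<^bsub>M\<^esub> e 1"
    by blast
  then obtain l k where lk: "\<And>x. x \<in> carrier M \<Longrightarrow>
      l x \<in> carrier R \<and> k x \<in> carrier R \<and> x = l x \<odot>\<^bsub>M\<^esub> e 0 \<oplus>\<^bsub>M\<^esub> k x \<odot>\<^bsub>M\<^esub> e 1"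
    unfolding choice_iff by blast
  have val: "l x = r \<and> k x = s"
    if "r \<in> carrier R" "s \<in> carrier R" "x = r \<odot>\<^bsub>M\<^esub> e 0 \<oplus>\<^bsub>M\<^esub> s \<odot>\<^bsub>M\<^esub> e 1" for r s x
  proof -
    have "x \<in> carrier M" using that e by simp
    from lk[OF this] show ?thesis using uniq[of "l x" "k x" r s] that by simp
  qed
  show thesis
  proof (rule that[of l k])
    show "l x \<in> carrier R \<and> k x \<in> carrier R" if "x \<in> carrier M" for x using lk[OF that] by blast
    show "l (x \<oplus>\<^bsub>M\<^esub> y) = l x \<oplus> l y \<and> k (x \<oplus>\<^bsub>M\<^esub> y) = k x \<oplus> k y"
      if x: "x \<in> carrier M" and y: "y \<in> carrier M" for x y
    proof (rule val)
      have "x \<oplus>\<^bsub>M\<^esub> y = (l x \<odot>\<^bsub>M\<^esub> e 0 \<oplus>\<^bsub>M\<^esub> k x \<odot>\<^bsub>M\<^esub> e 1) \<oplus>\<^bsub>M\<^esub> (l y \<odot>\<^bsub>M\<^esub> e 0 \<oplus>\<^bsub>M\<^esub> k y \<odot>\<^bsub>M\<^esub> e 1)"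
        using lk[OF x] lk[OF y] by simp
      also have "\<dots> = (l x \<oplus> l y) \<odot>\<^bsub>M\<^esub> e 0 \<oplus>\<^bsub>M\<^esub> (k x \<oplus> k y) \<odot>\<^bsub>M\<^esub> e 1"
      proof -
        have "(r \<odot>\<^bsub>M\<^esub> e 0 \<oplus>\<^bsub>M\<^esub> s \<odot>\<^bsub>M\<^esub> e 1) \<oplus>\<^bsub>M\<^esub> (r' \<odot>\<^bsub>M\<^esub> e 0 \<oplus>\<^bsub>M\<^esub> s' \<odot>\<^bsub>M\<^esub> e 1) =
            (r \<oplus> r') \<odot>\<^bsub>M\<^esub> e 0 \<oplus>\<^bsub>M\<^esub> (s \<oplus> s') \<odot>\<^bsub>M\<^esub> e 1"
          if "r \<in> carrier R" "s \<in> carrier R" "r' \<in> carrier R" "s' \<in> carrier R" for r s r' s'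
          using that e by (simp add: smult_l_distr M.a_ac)
        then show ?thesis using lk[OF x] lk[OF y] by blast
      qed
      finally show "x \<oplus>\<^bsub>M\<^esub> y = (l x \<oplus> l y) \<odot>\<^bsub>M\<^esub> e 0 \<oplus>\<^bsub>M\<^esub> (k x \<oplus> k y) \<odot>\<^bsub>M\<^esub> e 1" .
    qed (use lk[OF x] lk[OF y] in auto)
    show "l (r \<odot>\<^bsub>M\<^esub> x) = r \<otimes> l x \<and> k (r \<odot>\<^bsub>M\<^esub> x) = r \<otimes> k x"
      if r: "r \<in> carrier R" and x: "x \<in> carrier M" for r x
    proof (rule val)
      have "r \<odot>\<^bsub>M\<^esub> x = r \<odot>\<^bsub>M\<^esub> (l x \<odot>\<^bsub>M\<^esub> e 0 \<oplus>\<^bsub>M\<^esub> k x \<odot>\<^bsub>M\<^esub> e 1)" using lk[OF x] by simp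
      also have "\<dots> = (r \<otimes> l x) \<odot>\<^bsub>M\<^esub> e 0 \<oplus>\<^bsub>M\<^esub> (r \<otimes> k x) \<odot>\<^bsub>M\<^esub> e 1"
      proof -
        have "r \<odot>\<^bsub>M\<^esub> (s \<odot>\<^bsub>M\<^esub> e 0 \<oplus>\<^bsub>M\<^esub> t \<odot>\<^bsub>M\<^esub> e 1) = (r \<otimes> s) \<odot>\<^bsub>M\<^esub> e 0 \<oplus>\<^bsub>M\<^esub> (r \<otimes> t) \<odot>\<^bsub>M\<^esub> e 1"
          if "s \<in> carrier R" "t \<in> carrier R" for s t
          using that e r by (simp add: smult_r_distr smult_assoc1)
        then show ?thesis using lk[OF x] by blast
      qed
      finally show "r \<odot>\<^bsub>M\<^esub> x = (r \<otimes> l x) \<odot>\<^bsub>M\<^esub> e 0 \<oplus>\<^bsub>M\<^esub> (r \<otimes> k x) \<odot>\<^bsub>M\<^esub> e 1" .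
    qed (use lk[OF x] r in auto)
    show "l (e 0) = \<one>" "l (e 1) = \<zero>" "k (e 0) = \<zero>" "k (e 1) = \<one>"
      using val[of \<one> \<zero> "e 0"] val[of \<zero> \<one> "e 1"] e by auto
  qed
qed

end

lemma (in sheaf_of_modules) add_closed:
  "\<lbrakk>openin X U; x \<in> carrier (sec M U); y \<in> carrier (sec M U)\<rbrakk> \<Longrightarrow> x \<oplus>\<^bsub>sec M U\<^esub> y \<in> carrier (sec M U)"
  using sec_module[of U] by (simp add: abelian_monoid.a_closed abelian_group.axioms(1) module.axioms(2))

lemma (in sheaf_of_modules) smult_closed:
  "\<lbrakk>openin X U; r \<in> carrier (sec OX U); x \<in> carrier (sec M U)\<rbrakk> \<Longrightarrow> r \<odot>\<^bsub>sec M U\<^esub> x \<in> carrier (sec M U)"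
  using sec_module[of U] by (simp add: module.smult_closed)

section \<open>The dual sheaf, and the Clifford data over an open set\<close>

context binary_quadratic_module begin

abbreviation N where "N \<equiv> dual_sheaf X OX L"

lemma dual_carrier_iff:
  "\<phi> \<in> carrier (sec N U) \<longleftrightarrow>
    \<phi> \<in> (\<Pi>\<^sub>E V\<in>{V. openin X V \<and> V \<subseteq> U}. carrier (sec L V) \<rightarrow>\<^sub>E carrier (sec OX V)) \<and>
    (\<forall>V. openin X V \<and> V \<subseteq> U \<longrightarrow>
       (\<forall>x\<in>carrier (sec L V). \<forall>y\<in>carrier (sec L V).
          \<phi> V (x \<oplus>\<^bsub>sec L V\<^esub> y) = \<phi> V x \<oplus>\<^bsub>sec OX V\<^esub> \<phi> V y) \<and>
       (\<forall>r\<in>carrier (sec OX V). \<forall>x\<in>carrier (sec L V).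
          \<phi> V (r \<odot>\<^bsub>sec L V\<^esub> x) = r \<otimes>\<^bsub>sec OX V\<^esub> \<phi> V x)) \<and>
    (\<forall>V W. openin X V \<and> openin X W \<and> W \<subseteq> V \<and> V \<subseteq> U \<longrightarrow>
       (\<forall>x\<in>carrier (sec L V). \<phi> W (res L V W x) = res OX V W (\<phi> V x)))"
  by (simp add: dual_sheaf_def)

lemma dualD:
  assumes "\<phi> \<in> carrier (sec N U)" "openin X V" "V \<subseteq> U"
  shows "x \<in> carrier (sec L V) \<Longrightarrow> \<phi> V x \<in> carrier (sec OX V)"
    and "\<lbrakk>x \<in> carrier (sec L V); y \<in> carrier (sec L V)\<rbrakk> \<Longrightarrow>
      \<phi> V (x \<oplus>\<^bsub>sec L V\<^esub> y) = \<phi> V x \<oplus>\<^bsub>sec OX V\<^esub> \<phi> V y"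
    and "\<lbrakk>r \<in> carrier (sec OX V); x \<in> carrier (sec L V)\<rbrakk> \<Longrightarrow>
      \<phi> V (r \<odot>\<^bsub>sec L V\<^esub> x) = r \<otimes>\<^bsub>sec OX V\<^esub> \<phi> V x"
    and "\<lbrakk>openin X W; W \<subseteq> V; x \<in> carrier (sec L V)\<rbrakk> \<Longrightarrow> \<phi> W (res L V W x) = res OX V W (\<phi> V x)"
    and "\<phi> V \<in> extensional (carrier (sec L V))"
  using assms unfolding dual_carrier_iff by (auto simp: PiE_iff)

lemma dualI:
  assumes "\<And>V x. \<lbrakk>openin X V; V \<subseteq> U; x \<in> carrier (sec L V)\<rbrakk> \<Longrightarrow> F V x \<in> carrier (sec OX V)"
    and "\<And>V x y. \<lbrakk>openin X V; V \<subseteq> U; x \<in> carrier (sec L V); y \<in> carrier (sec L V)\<rbrakk> \<Longrightarrow>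
      F V (x \<oplus>\<^bsub>sec L V\<^esub> y) = F V x \<oplus>\<^bsub>sec OX V\<^esub> F V y"
    and "\<And>V r x. \<lbrakk>openin X V; V \<subseteq> U; r \<in> carrier (sec OX V); x \<in> carrier (sec L V)\<rbrakk> \<Longrightarrow>
      F V (r \<odot>\<^bsub>sec L V\<^esub> x) = r \<otimes>\<^bsub>sec OX V\<^esub> F V x"
    and "\<And>V W x. \<lbrakk>openin X V; openin X W; W \<subseteq> V; V \<subseteq> U; x \<in> carrier (sec L V)\<rbrakk> \<Longrightarrow>
      F W (res L V W x) = res OX V W (F V x)"
  shows "(\<lambda>V\<in>{V. openin X V \<and> V \<subseteq> U}. \<lambda>x\<in>carrier (sec L V). F V x) \<in> carrier (sec N U)"
  unfolding dual_carrier_iff using assms L.add_closed L.smult_closed by (auto simp: L.M.res_closed)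

lemma dual_simps:
  "\<phi> \<oplus>\<^bsub>sec N U\<^esub> \<psi> = (\<lambda>V\<in>{V. openin X V \<and> V \<subseteq> U}. \<lambda>x\<in>carrier (sec L V). \<phi> V x \<oplus>\<^bsub>sec OX V\<^esub> \<psi> V x)"
  "r \<odot>\<^bsub>sec N U\<^esub> \<phi> = (\<lambda>V\<in>{V. openin X V \<and> V \<subseteq> U}. \<lambda>x\<in>carrier (sec L V).
     res OX U V r \<otimes>\<^bsub>sec OX V\<^esub> \<phi> V x)"
  "res N U V \<phi> = restrict \<phi> {W. openin X W \<and> W \<subseteq> V}"
  by (simp_all add: dual_sheaf_def)

lemma OX_res:
  assumes "openin X U" "openin X V" "V \<subseteq> U"
  shows "r \<in> carrier (sec OX U) \<Longrightarrow> res OX U V r \<in> carrier (sec OX V)"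
    and "\<lbrakk>r \<in> carrier (sec OX U); s \<in> carrier (sec OX U)\<rbrakk> \<Longrightarrow>
      res OX U V (r \<otimes>\<^bsub>sec OX U\<^esub> s) = res OX U V r \<otimes>\<^bsub>sec OX V\<^esub> res OX U V s"
    and "\<lbrakk>r \<in> carrier (sec OX U); s \<in> carrier (sec OX U)\<rbrakk> \<Longrightarrow>
      res OX U V (r \<oplus>\<^bsub>sec OX U\<^esub> s) = res OX U V r \<oplus>\<^bsub>sec OX V\<^esub> res OX U V s"
    and "res OX U V \<one>\<^bsub>sec OX U\<^esub> = \<one>\<^bsub>sec OX V\<^esub>"
  using M.OX.res_ring_hom[OF assms] by (auto simp: ring_hom_def)

lemma dual_add_closed:
  assumes U: "openin X U" and \<phi>: "\<phi> \<in> carrier (sec N U)" and \<psi>: "\<psi> \<in> carrier (sec N U)"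
  shows "\<phi> \<oplus>\<^bsub>sec N U\<^esub> \<psi> \<in> carrier (sec N U)"
  unfolding dual_simps
proof (rule dualI)
  fix V assume V: "openin X V" "V \<subseteq> U"
  interpret R: cring "sec OX V" by (rule M.OX.sec_cring[OF V(1)])
  note [simp] = dualD(1-3)[OF \<phi> V] dualD(1-3)[OF \<psi> V]
  show "\<phi> V x \<oplus>\<^bsub>sec OX V\<^esub> \<psi> V x \<in> carrier (sec OX V)" if "x \<in> carrier (sec L V)" for x
    using that by simp
  show "\<phi> V (x \<oplus>\<^bsub>sec L V\<^esub> y) \<oplus>\<^bsub>sec OX V\<^esub> \<psi> V (x \<oplus>\<^bsub>sec L V\<^esub> y) =
      \<phi> V x \<oplus>\<^bsub>sec OX V\<^esub> \<psi> V x \<oplus>\<^bsub>sec OX V\<^esub> (\<phi> V y \<oplus>\<^bsub>sec OX V\<^esub> \<psi> V y)"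
    if "x \<in> carrier (sec L V)" "y \<in> carrier (sec L V)" for x y
    using that by (simp add: R.a_ac)
  show "\<phi> V (r \<odot>\<^bsub>sec L V\<^esub> x) \<oplus>\<^bsub>sec OX V\<^esub> \<psi> V (r \<odot>\<^bsub>sec L V\<^esub> x) =
      r \<otimes>\<^bsub>sec OX V\<^esub> (\<phi> V x \<oplus>\<^bsub>sec OX V\<^esub> \<psi> V x)"
    if "r \<in> carrier (sec OX V)" "x \<in> carrier (sec L V)" for r x
    using that by (simp add: R.r_distr)
  show "\<phi> W (res L V W x) \<oplus>\<^bsub>sec OX W\<^esub> \<psi> W (res L V W x) =
      res OX V W (\<phi> V x \<oplus>\<^bsub>sec OX V\<^esub> \<psi> V x)"
    if "openin X W" "W \<subseteq> V" "x \<in> carrier (sec L V)" for W x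
    using that V by (simp add: dualD(4)[OF \<phi> V] dualD(4)[OF \<psi> V] OX_res)
qed

lemma dual_smult_closed:
  assumes U: "openin X U" and r: "r \<in> carrier (sec OX U)" and \<phi>: "\<phi> \<in> carrier (sec N U)"
  shows "r \<odot>\<^bsub>sec N U\<^esub> \<phi> \<in> carrier (sec N U)"
  unfolding dual_simps
proof (rule dualI)
  fix V assume V: "openin X V" "V \<subseteq> U"
  interpret R: cring "sec OX V" by (rule M.OX.sec_cring[OF V(1)])
  note [simp] = dualD(1-3)[OF \<phi> V] OX_res(1)[OF U V r]
  show "res OX U V r \<otimes>\<^bsub>sec OX V\<^esub> \<phi> V x \<in> carrier (sec OX V)" if "x \<in> carrier (sec L V)" for x
    using that by simp
  show "res OX U V r \<otimes>\<^bsub>sec OX V\<^esub> \<phi> V (x \<oplus>\<^bsub>sec L V\<^esub> y) =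
      res OX U V r \<otimes>\<^bsub>sec OX V\<^esub> \<phi> V x \<oplus>\<^bsub>sec OX V\<^esub> res OX U V r \<otimes>\<^bsub>sec OX V\<^esub> \<phi> V y"
    if "x \<in> carrier (sec L V)" "y \<in> carrier (sec L V)" for x y
    using that by (simp add: R.r_distr)
  show "res OX U V r \<otimes>\<^bsub>sec OX V\<^esub> \<phi> V (s \<odot>\<^bsub>sec L V\<^esub> x) =
      s \<otimes>\<^bsub>sec OX V\<^esub> (res OX U V r \<otimes>\<^bsub>sec OX V\<^esub> \<phi> V x)"
    if "s \<in> carrier (sec OX V)" "x \<in> carrier (sec L V)" for s x
    using that by (simp add: R.m_lcomm)
  show "res OX U W r \<otimes>\<^bsub>sec OX W\<^esub> \<phi> W (res L V W x) =
      res OX V W (res OX U V r \<otimes>\<^bsub>sec OX V\<^esub> \<phi> V x)"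
    if "openin X W" "W \<subseteq> V" "x \<in> carrier (sec L V)" for W x
    using that V M.OX.res_comp[OF U V(1) that(1,2) V(2) r]
    by (simp add: dualD(4)[OF \<phi> V] OX_res)
qed

lemma dual_res_closed:
  assumes V: "V \<subseteq> U" and \<phi>: "\<phi> \<in> carrier (sec N U)"
  shows "res N U V \<phi> \<in> carrier (sec N V)"
proof -
  have "res N U V \<phi> = (\<lambda>W\<in>{W. openin X W \<and> W \<subseteq> V}. \<lambda>x\<in>carrier (sec L W). \<phi> W x)"
    unfolding dual_simps using dualD(5)[OF \<phi>] V by (intro restrict_ext) (auto simp: extensional_restrict)
  also have "\<dots> \<in> carrier (sec N V)"
    by (rule dualI) (use V in \<open>auto simp: dualD[OF \<phi>]\<close>)
  finally show ?thesis .
qed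

lemma dual_res_comp:
  "\<lbrakk>W \<subseteq> V; V \<subseteq> U\<rbrakk> \<Longrightarrow> res N V W (res N U V \<phi>) = res N U W \<phi>"
  unfolding dual_simps by (auto simp: fun_eq_iff)

lemma dual_res_add:
  assumes "V \<subseteq> U"
  shows "res N U V (\<phi> \<oplus>\<^bsub>sec N U\<^esub> \<psi>) = res N U V \<phi> \<oplus>\<^bsub>sec N V\<^esub> res N U V \<psi>"
  unfolding dual_simps using assms by (auto simp: fun_eq_iff restrict_def)

lemma dual_res_smult:
  assumes "openin X U" "openin X V" "V \<subseteq> U" "r \<in> carrier (sec OX U)"
  shows "res N U V (r \<odot>\<^bsub>sec N U\<^esub> \<phi>) = res OX U V r \<odot>\<^bsub>sec N V\<^esub> res N U V \<phi>"
  unfolding dual_simps using assms M.OX.res_comp[OF assms(1,2) _ _ assms(3,4)]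
  by (auto simp: fun_eq_iff restrict_def)

abbreviation qf where "qf U \<equiv> (\<lambda>f x. f U (Q U x))"

lemma clifford_setting:
  assumes U: "openin X U"
  shows "clifford_setting (sec OX U) (sec M U) (sec N U) (qf U)"
proof (intro clifford_setting.intro word_setting.intro word_setting_axioms.intro clifford_setting_axioms.intro)
  show "cring (sec OX U)" by (rule M.OX.sec_cring[OF U])
qed (use U in \<open>simp_all add: M.add_closed M.smult_closed dual_add_closed dual_smult_closed dualD(1) Q_closed\<close>)

lemma clifford_morphism:
  assumes U: "openin X U" and V: "openin X V" "V \<subseteq> U"
  shows "clifford_morphism (sec OX U) (sec M U) (sec N U) (qf U) (sec OX V) (sec M V) (sec N V) (qf V)
    (res OX U V) (res M U V) (res N U V)"
proof (intro clifford_morphism.intro clifford_morphism_axioms.intro clifford_setting[OF U]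
    clifford_setting[OF V(1)] M.OX.res_ring_hom[OF U V])
  \<comment> \<open>As a morphism of sheaves f commutes with restriction, and so does Q; hence f (Q
    x) may be restricted before or after evaluation.\<close>
  show "res N U V f V (Q V (res M U V x)) = res OX U V (f U (Q U x))"
    if "f \<in> carrier (sec N U)" "x \<in> carrier (sec M U)" for f x
    using that U V by (simp add: dual_simps Q_res dualD(4) Q_closed)
qed (use U V in \<open>simp_all add: M.M.res_closed dual_res_closed M.res_add dual_res_add M.res_smult dual_res_smult\<close>)

end

section \<open>The Clifford sheaves\<close>

context sheaf_of_rings begin

lemma presheaf_mult: "presheaf_action X OX OX (\<lambda>U. mult (sec OX U))"
  and presheaf_add: "presheaf_action X OX OX (\<lambda>U. add (sec OX U))"
proof -
  have 1: "a \<otimes>\<^bsub>sec OX U\<^esub> b \<in> carrier (sec OX U)" "a \<oplus>\<^bsub>sec OX U\<^esub> b \<in> carrier (sec OX U)"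
    if "openin X U" "a \<in> carrier (sec OX U)" "b \<in> carrier (sec OX U)" for U a b
    using sec_cring[OF that(1)] that(2,3) by (auto simp: cring_def ring.ring_simprules)
  note h = res_ring_hom[THEN ring_hom_mult] res_ring_hom[THEN ring_hom_add]
  show "presheaf_action X OX OX (\<lambda>U. mult (sec OX U))" "presheaf_action X OX OX (\<lambda>U. add (sec OX U))"
    by (intro presheaf_action.intro presheaf_action_axioms.intro presheaf_of_sets; simp add: 1 h)+
qed

lemma germ_ring_hom:
  assumes V: "openin X V" "p \<in> V"
  shows "germ X OX p V \<in> ring_hom (sec OX V) (stalk X OX p)"
proof -
  interpret m: presheaf_action X OX OX "\<lambda>U. mult (sec OX U)" by (rule presheaf_mult)
  interpret a: presheaf_action X OX OX "\<lambda>U. add (sec OX U)" by (rule presheaf_add)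
  show ?thesis
  proof (rule ring_hom_memI)
    show "germ X OX p V x \<in> carrier (stalk X OX p)" if "x \<in> carrier (sec OX V)" for x
      unfolding m.A.stalk_carrier using V that by blast
    show "germ X OX p V (x \<otimes>\<^bsub>sec OX V\<^esub> y) = germ X OX p V x \<otimes>\<^bsub>stalk X OX p\<^esub> germ X OX p V y"
      "germ X OX p V (x \<oplus>\<^bsub>sec OX V\<^esub> y) = germ X OX p V x \<oplus>\<^bsub>stalk X OX p\<^esub> germ X OX p V y"
      if "x \<in> carrier (sec OX V)" "y \<in> carrier (sec OX V)" for x y
      using m.act_germ_same[OF V that] a.act_germ_same[OF V that] by (simp_all add: stalk_def)
    \<comment> \<open>The unit of the stalk is by definition the germ of the unit over the whole
      space, which therefore has to be restricted to V.\<close>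
    have top: "openin X (topspace X)" "V \<subseteq> topspace X" using V by (auto simp: openin_subset)
    have "\<one>\<^bsub>sec OX (topspace X)\<^esub> \<in> carrier (sec OX (topspace X))"
      using sec_cring[OF top(1)] by (simp add: cring_def ring.ring_simprules)
    from m.A.germ_res[OF top(1) V top(2) this]
    show "germ X OX p V \<one>\<^bsub>sec OX V\<^esub> = \<one>\<^bsub>stalk X OX p\<^esub>"
      using ring_hom_one[OF res_ring_hom[OF top(1) V(1) top(2)]] by (simp add: stalk_def)
  qed
qed

end

text \<open>The ideal is the preimage of the maximal ideal of the stalk.\<close>

lemma (in locally_ringed_space) local_nonunits:
  assumes V: "openin X V" "p \<in> V"
  obtains I where "ideal I (sec OX V)" "\<one>\<^bsub>sec OX V\<^esub> \<notin> I"
    "\<And>u. \<lbrakk>u \<in> carrier (sec OX V); u \<notin> I\<rbrakk> \<Longrightarrow> \<exists>W t. openin X W \<and> p \<in> W \<and> W \<subseteq> V \<and>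
       t \<in> carrier (sec OX W) \<and> res OX V W u \<otimes>\<^bsub>sec OX W\<^esub> t = \<one>\<^bsub>sec OX W\<^esub>"
proof -
  let ?S = "stalk X OX p"
  have "p \<in> topspace X" using V openin_subset by blast
  from stalk_local[OF this] obtain m where S: "cring ?S" and m: "maximalideal m ?S"
    and uniq: "\<And>J. maximalideal J ?S \<Longrightarrow> J = m" unfolding local_ring_def by blast
  interpret S: cring ?S by (rule S)
  interpret m: maximalideal m ?S by (rule m)
  interpret act: presheaf_action X OX OX "\<lambda>U. mult (sec OX U)" by (rule presheaf_mult)
  interpret R: cring "sec OX V" by (rule sec_cring[OF V(1)])
  interpret g: ring_hom_ring "sec OX V" ?S "germ X OX p V"
    by (rule ring_hom_ringI2[OF R.ring_axioms S.ring_axioms germ_ring_hom[OF V]])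
  let ?I = "{r \<in> carrier (sec OX V). germ X OX p V r \<in> m}"
  have mi: "ideal m ?S" by unfold_locales
  have nt: "\<one>\<^bsub>?S\<^esub> \<notin> m" using m.I_notcarr m.one_imp_carrier by blast
  show thesis
  proof (rule that)
    show "ideal ?I (sec OX V)" by (rule g.ideal_vimage[OF mi])
    show "\<one>\<^bsub>sec OX V\<^esub> \<notin> ?I" using nt by simp
    fix u assume u: "u \<in> carrier (sec OX V)" "u \<notin> ?I"
    then have "germ X OX p V u \<in> Units ?S"
      using S.unit_iff_notin_maximal[OF uniq, of "germ X OX p V u"] by simp
    then obtain h where h: "h \<in> carrier ?S" "germ X OX p V u \<otimes>\<^bsub>?S\<^esub> h = \<one>\<^bsub>?S\<^esub>"
      unfolding Units_def by blast
    from h(1) obtain T t where T: "openin X T" "p \<in> T" "t \<in> carrier (sec OX T)" "h = germ X OX p T t"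
      unfolding act.A.stalk_carrier by blast
    have one: "\<one>\<^bsub>?S\<^esub> = germ X OX p V \<one>\<^bsub>sec OX V\<^esub>" by simp
    have "act.act p (germ X OX p V u) (germ X OX p T t) = germ X OX p V \<one>\<^bsub>sec OX V\<^esub>"
      using h(2) T(4) one by (simp add: stalk_def)
    then obtain W where W: "openin X W" "p \<in> W" "W \<subseteq> V" "W \<subseteq> T"
      "res OX V W u \<otimes>\<^bsub>sec OX W\<^esub> res OX T W t = res OX V W \<one>\<^bsub>sec OX V\<^esub>"
      by (rule act.act_germ_eqE[OF V u(1) T(1-3) V R.one_closed])
    have "res OX V W \<one>\<^bsub>sec OX V\<^esub> = \<one>\<^bsub>sec OX W\<^esub>"
      by (rule ring_hom_one[OF res_ring_hom[OF V(1) W(1,3)]])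
    moreover have "res OX T W t \<in> carrier (sec OX W)" by (rule res_closed[OF T(1) W(1,4) T(3)])
    ultimately show "\<exists>W t. openin X W \<and> p \<in> W \<and> W \<subseteq> V \<and> t \<in> carrier (sec OX W) \<and>
        res OX V W u \<otimes>\<^bsub>sec OX W\<^esub> t = \<one>\<^bsub>sec OX W\<^esub>" using W by auto
  qed
qed

section \<open>The Clifford presheaves in terms of words\<close>

context binary_quadratic_module begin

abbreviation F0 where "F0 \<equiv> even_clifford_presheaf X OX M L Q"
abbreviation F1 where "F1 \<equiv> odd_clifford_presheaf X OX M L Q"

abbreviation WA where "WA U \<equiv> word_algebra (sec OX U) (sec M U) (sec N U)"
abbreviation WP where "WP U \<equiv> word_setting.wpart (sec OX U) (sec M U) (sec N U)"
abbreviation cls where "cls U \<epsilon> \<equiv> word_setting.cl (sec OX U) (sec M U) (sec N U) \<epsilon>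
  (clifford_setting.gens (sec OX U) (sec M U) (sec N U) (qf U) \<epsilon>)"
abbreviation restr where "restr U V \<equiv>
  word_map (sec OX U) (sec OX V) (res OX U V) (res M U V) (res N U V)"

lemma F_sec:
  "sec F0 U = even_clifford_ring (sec OX U) (sec M U) (sec N U) (qf U)"
  "sec F1 U = odd_clifford_module (sec OX U) (sec M U) (sec N U) (qf U)"
  by (simp_all add: even_clifford_presheaf_def odd_clifford_presheaf_def Let_def)

lemma F_carrier:
  assumes "openin X U"
  shows "carrier (sec F0 U) = cls U 0 ` WP U 0" "carrier (sec F1 U) = cls U (Suc 0) ` WP U (Suc 0)"
  unfolding F_sec
  using clifford_setting.even_clifford_carrier[OF clifford_setting[OF assms]]
    clifford_setting.odd_clifford_carrier[OF clifford_setting[OF assms]] by simp_all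

lemma F_res:
  assumes "openin X U" "openin X V" "V \<subseteq> U"
  shows "a \<in> WP U 0 \<Longrightarrow> res F0 U V (cls U 0 a) = cls V 0 (restr U V a)"
    and "a \<in> WP U (Suc 0) \<Longrightarrow> res F1 U V (cls U (Suc 0) a) = cls V (Suc 0) (restr U V a)"
    and "a \<in> WP U \<epsilon> \<Longrightarrow> restr U V a \<in> WP V \<epsilon>"
proof -
  interpret clifford_morphism "sec OX U" "sec M U" "sec N U" "qf U" "sec OX V" "sec M V" "sec N V" "qf V"
    "res OX U V" "res M U V" "res N U V" by (rule clifford_morphism[OF assms])
  show "a \<in> WP U 0 \<Longrightarrow> res F0 U V (cls U 0 a) = cls V 0 (restr U V a)"
    using clifford_res[of 0 a]
    by (simp add: even_clifford_presheaf_def Let_def tensor_res_def B.even_ideal_eq)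
  show "a \<in> WP U (Suc 0) \<Longrightarrow> res F1 U V (cls U (Suc 0) a) = cls V (Suc 0) (restr U V a)"
    using clifford_res[of "Suc 0" a]
    by (simp add: odd_clifford_presheaf_def Let_def tensor_res_def B.odd_subbimodule_eq)
  show "a \<in> WP U \<epsilon> \<Longrightarrow> restr U V a \<in> WP V \<epsilon>" by (rule wm_wpart)
qed

lemma restr_comp:
  assumes "openin X U" "openin X V" "openin X W" "W \<subseteq> V" "V \<subseteq> U" "a \<in> carrier (WA U)"
  shows "restr V W (restr U V a) = restr U W a"
proof -
  interpret UV: clifford_morphism "sec OX U" "sec M U" "sec N U" "qf U" "sec OX V" "sec M V" "sec N V" "qf V"
    "res OX U V" "res M U V" "res N U V" by (rule clifford_morphism) (use assms in auto)
  interpret VW: clifford_morphism "sec OX V" "sec M V" "sec N V" "qf V" "sec OX W" "sec M W" "sec N W" "qf W"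
    "res OX V W" "res M V W" "res N V W" by (rule clifford_morphism) (use assms in auto)
  interpret UW: clifford_morphism "sec OX U" "sec M U" "sec N U" "qf U" "sec OX W" "sec M W" "sec N W" "qf W"
    "res OX U W" "res M U W" "res N U W" by (rule clifford_morphism) (use assms in auto)
  from assms(6) show ?thesis
  proof (induction rule: UV.A.word_induct)
    case zero
    then show ?case by (simp add: UV.wm_zero VW.wm_zero UW.wm_zero)
  next
    case (word r xs fs)
    have "map (res M V W) (map (res M U V) xs) = map (res M U W) xs"
      using word(2) assms by (auto intro!: M.M.res_comp)
    moreover have "map (res N V W) (map (res N U V) fs) = map (res N U W) fs"
      using assms by (auto intro!: dual_res_comp)
    moreover have "res OX V W (res OX U V r) = res OX U W r"
      using word(1) assms by (intro M.OX.res_comp)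
    ultimately show ?case
      using word by (simp add: UV.wm_wt VW.wm_wt UW.wm_wt UV.g_map UV.h_map del: set_map map_map)
  next
    case (add b c)
    then show ?case by (simp add: UV.wm_add VW.wm_add UW.wm_add)
  qed
qed

lemma WP_carrier: "openin X U \<Longrightarrow> a \<in> WP U \<epsilon> \<Longrightarrow> a \<in> carrier (WA U)"
  by (rule word_setting.wpart_carrier[OF clifford_setting.axioms(1)[OF clifford_setting]])

lemma F0_presheaf: "presheaf_of_sets X F0" and F1_presheaf: "presheaf_of_sets X F1"
  by (unfold_locales; auto simp: F_carrier F_res restr_comp WP_carrier)+

lemma F_smult:
  assumes "openin X U" "a \<in> WP U 0" "b \<in> WP U (Suc 0)"
  shows "cls U 0 a \<odot>\<^bsub>sec F1 U\<^esub> cls U (Suc 0) b = cls U (Suc 0) (a \<otimes>\<^bsub>WA U\<^esub> b)"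
  unfolding F_sec using clifford_setting.odd_clifford_smult[OF clifford_setting[OF assms(1)] assms(2,3)] .

lemma F_add:
  assumes "openin X U" "a \<in> WP U (Suc 0)" "b \<in> WP U (Suc 0)"
  shows "cls U (Suc 0) a \<oplus>\<^bsub>sec F1 U\<^esub> cls U (Suc 0) b = cls U (Suc 0) (a \<oplus>\<^bsub>WA U\<^esub> b)"
  unfolding F_sec using clifford_setting.odd_clifford_add[OF clifford_setting[OF assms(1)] assms(2,3)] .

lemma F_zero: "openin X U \<Longrightarrow> \<zero>\<^bsub>sec F1 U\<^esub> = cls U (Suc 0) \<zero>\<^bsub>WA U\<^esub>"
  unfolding F_sec using clifford_setting.odd_clifford_zero[OF clifford_setting] .

lemma F_action: "presheaf_action X F0 F1 (\<lambda>U. smult (sec F1 U))"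
  and F1_add_action: "presheaf_action X F1 F1 (\<lambda>U. add (sec F1 U))"
proof -
  have closed: "a \<in> WP U 0 \<Longrightarrow> a \<otimes>\<^bsub>WA U\<^esub> b \<in> WP U (Suc 0)"
    "a \<in> WP U (Suc 0) \<Longrightarrow> a \<oplus>\<^bsub>WA U\<^esub> b \<in> WP U (Suc 0)"
    if "openin X U" "b \<in> WP U (Suc 0)" for U a b
  proof -
    interpret clifford_setting "sec OX U" "sec M U" "sec N U" "qf U" by (rule clifford_setting[OF that(1)])
    show "a \<in> WP U 0 \<Longrightarrow> a \<otimes>\<^bsub>WA U\<^esub> b \<in> WP U (Suc 0)"
      "a \<in> WP U (Suc 0) \<Longrightarrow> a \<oplus>\<^bsub>WA U\<^esub> b \<in> WP U (Suc 0)" using that by simp_all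
  qed
  have restr: "restr U V (a \<otimes>\<^bsub>WA U\<^esub> b) = restr U V a \<otimes>\<^bsub>WA V\<^esub> restr U V b"
    "restr U V (a \<oplus>\<^bsub>WA U\<^esub> b) = restr U V a \<oplus>\<^bsub>WA V\<^esub> restr U V b"
    if "openin X U" "openin X V" "V \<subseteq> U" "a \<in> carrier (WA U)" "b \<in> carrier (WA U)" for U V a b
  proof -
    interpret clifford_morphism "sec OX U" "sec M U" "sec N U" "qf U" "sec OX V" "sec M V" "sec N V" "qf V"
      "res OX U V" "res M U V" "res N U V" by (rule clifford_morphism[OF that(1-3)])
    show "restr U V (a \<otimes>\<^bsub>WA U\<^esub> b) = restr U V a \<otimes>\<^bsub>WA V\<^esub> restr U V b"
      "restr U V (a \<oplus>\<^bsub>WA U\<^esub> b) = restr U V a \<oplus>\<^bsub>WA V\<^esub> restr U V b"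
      using that(4,5) by (simp_all add: wm_mult wm_add)
  qed
  show "presheaf_action X F0 F1 (\<lambda>U. smult (sec F1 U))"
    by (intro presheaf_action.intro presheaf_action_axioms.intro F0_presheaf F1_presheaf)
      (auto simp: F_carrier F_smult F_res closed restr WP_carrier)
  show "presheaf_action X F1 F1 (\<lambda>U. add (sec F1 U))"
    by (intro presheaf_action.intro presheaf_action_axioms.intro F1_presheaf)
      (auto simp: F_carrier F_add F_res closed restr WP_carrier)
qed

text \<open>Exactly what \<open>finsum_lessThan_one\<close> asks of the sheafified odd module. The
  zero of a stalk is the germ of the zero over the whole space, so the argument rests on restriction
  preserving zeros.\<close>

lemma sheafify_add_zero:
  assumes U: "openin X U" and \<sigma>: "\<sigma> \<in> carrier (sheafify_sec X F1 U)"
  shows "\<zero>\<^bsub>sheafify_sec X F1 U\<^esub> \<in> carrier (sheafify_sec X F1 U)"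
    and "\<sigma> \<oplus>\<^bsub>sheafify_sec X F1 U\<^esub> \<zero>\<^bsub>sheafify_sec X F1 U\<^esub> = \<sigma>"
proof -
  interpret add: presheaf_action X F1 F1 "\<lambda>U. add (sec F1 U)" by (rule F1_add_action)
  have zero: "\<zero>\<^bsub>sec F1 V\<^esub> \<in> carrier (sec F1 V)" if "openin X V" for V
  proof -
    interpret clifford_setting "sec OX V" "sec M V" "sec N V" "qf V" by (rule clifford_setting[OF that])
    show ?thesis unfolding F_carrier[OF that] F_zero[OF that] by (rule imageI) simp
  qed
  have res_zero: "res F1 W V \<zero>\<^bsub>sec F1 W\<^esub> = \<zero>\<^bsub>sec F1 V\<^esub>"
    if "openin X W" "openin X V" "V \<subseteq> W" for V W
  proof -
    interpret clifford_morphism "sec OX W" "sec M W" "sec N W" "qf W" "sec OX V" "sec M V" "sec N V" "qf V"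
      "res OX W V" "res M W V" "res N W V" by (rule clifford_morphism[OF that])
    show ?thesis using F_res(2)[OF that, of "\<zero>\<^bsub>WA W\<^esub>"] by (simp add: F_zero that wm_zero)
  qed
  have add_zero: "b \<oplus>\<^bsub>sec F1 V\<^esub> \<zero>\<^bsub>sec F1 V\<^esub> = b" if V: "openin X V" and b: "b \<in> carrier (sec F1 V)" for V b
  proof -
    interpret clifford_setting "sec OX V" "sec M V" "sec N V" "qf V" by (rule clifford_setting[OF V])
    from b obtain a where "a \<in> WP V (Suc 0)" "b = cls V (Suc 0) a" unfolding F_carrier[OF V] by auto
    then show ?thesis using F_add[OF V, of a "\<zero>\<^bsub>WA V\<^esub>"] by (simp add: F_zero V)
  qed
  have top: "openin X (topspace X)" by simp
  have germ_zero: "\<zero>\<^bsub>stalk X F1 p\<^esub> = germ X F1 p V \<zero>\<^bsub>sec F1 V\<^esub>" if "openin X V" "p \<in> V" for p V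
    using add.A.germ_res[OF top that(1,2) openin_subset[OF that(1)] zero[OF top]]
      res_zero[OF top that(1) openin_subset[OF that(1)]] by (simp add: stalk_def)
  show "\<zero>\<^bsub>sheafify_sec X F1 U\<^esub> \<in> carrier (sheafify_sec X F1 U)"
  proof -
    have "\<zero>\<^bsub>sheafify_sec X F1 U\<^esub> = (\<lambda>p\<in>U. germ X F1 p U \<zero>\<^bsub>sec F1 U\<^esub>)"
      using germ_zero[OF U] by (auto simp: sheafify_sec_def intro!: restrict_ext)
    then show ?thesis using add.A.germ_section[OF U zero[OF U]] by simp
  qed
  show "\<sigma> \<oplus>\<^bsub>sheafify_sec X F1 U\<^esub> \<zero>\<^bsub>sheafify_sec X F1 U\<^esub> = \<sigma>"
  proof (rule extensionalityI[of _ U])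
    fix p assume p: "p \<in> U"
    from \<sigma> p obtain V s where V: "openin X V" "p \<in> V" "V \<subseteq> U" "s \<in> carrier (sec F1 V)"
      "\<forall>q\<in>V. \<sigma> q = germ X F1 q V s" by (rule add.A.sheafify_secE)
    then show "(\<sigma> \<oplus>\<^bsub>sheafify_sec X F1 U\<^esub> \<zero>\<^bsub>sheafify_sec X F1 U\<^esub>) p = \<sigma> p"
      using p add.act_germ_same[OF V(1,2,4) zero[OF V(1)]] germ_zero[OF V(1,2)] add_zero[OF V(1,4)]
      by (simp add: sheafify_sec_def) (simp add: stalk_def)
  qed (use \<sigma> in \<open>simp_all add: add.A.sheafify_sec_carrier\<close>, simp add: sheafify_sec_def)
qed

section \<open>Freeness of rank one over the even Clifford sheaf\<close>

abbreviation A0 where "A0 \<equiv> even_clifford X OX M L Q"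
abbreviation A1 where "A1 \<equiv> odd_clifford X OX M L Q"
abbreviation actp where "actp p \<equiv> germ_op X F0 F1 p (\<lambda>U. smult (sec F1 U))"

lemma clifford_sheaf_simps:
  "carrier (sec A0 U) = carrier (sheafify_sec X F0 U)"
  "carrier (sec A1 U) = carrier (sheafify_sec X F1 U)"
  "\<zero>\<^bsub>sec A1 U\<^esub> = \<zero>\<^bsub>sheafify_sec X F1 U\<^esub>"
  "\<sigma> \<oplus>\<^bsub>sec A1 U\<^esub> \<tau> = \<sigma> \<oplus>\<^bsub>sheafify_sec X F1 U\<^esub> \<tau>"
  "c \<odot>\<^bsub>sec A1 U\<^esub> \<sigma> = (\<lambda>p\<in>U. actp p (c p) (\<sigma> p))"
  "res A1 U V \<sigma> = restrict \<sigma> V"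
  by (simp_all add: even_clifford_def odd_clifford_def sheafify_ring_def sheafify_module_def
      ring.defs module.defs)

text \<open>Families indexed by \<open>{..<1}\<close> are single sections and a sum with one term is
  that term, so freeness of rank one becomes bijectivity of multiplication by one section over all
  smaller open sets.\<close>

lemma free_of_rank_one_iff:
  assumes U: "openin X U"
  shows "free_of_rank_on 1 X A0 A1 U \<longleftrightarrow>
    (\<exists>e\<in>carrier (sheafify_sec X F1 U). \<forall>V. openin X V \<and> V \<subseteq> U \<longrightarrow>
       bij_betw (\<lambda>\<sigma>. \<lambda>p\<in>V. actp p (\<sigma> p) (e p))
         (carrier (sheafify_sec X F0 V)) (carrier (sheafify_sec X F1 V)))"
proof -
  interpret act: presheaf_action X F0 F1 "\<lambda>U. smult (sec F1 U)" by (rule F_action)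
  have restrict: "restrict e V \<in> carrier (sheafify_sec X F1 V)"
    if e: "e \<in> carrier (sheafify_sec X F1 U)" and V: "openin X V" "V \<subseteq> U" for e V
    unfolding act.B.sheafify_sec_carrier
  proof (intro conjI ballI restrict_extensional)
    fix p assume p: "p \<in> V"
    with V have "p \<in> U" by blast
    with e obtain S s where S: "openin X S" "p \<in> S" "S \<subseteq> U" "s \<in> carrier (sec F1 S)"
      "\<forall>q\<in>S. e q = germ X F1 q S s" by (rule act.B.sheafify_secE)
    have o: "openin X (S \<inter> V)" using S V by blast
    have "res F1 S (S \<inter> V) s \<in> carrier (sec F1 (S \<inter> V))" using S o by (intro act.B.res_closed) auto
    moreover have "restrict e V q = germ X F1 q (S \<inter> V) (res F1 S (S \<inter> V) s)" if "q \<in> S \<inter> V" for q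
      using that S o by (simp add: act.B.germ_res)
    ultimately show "\<exists>Z s. openin X Z \<and> p \<in> Z \<and> Z \<subseteq> V \<and> s \<in> carrier (sec F1 Z) \<and>
        (\<forall>q\<in>Z. restrict e V q = germ X F1 q Z s)"
      using S p o by (intro exI[of _ "S \<inter> V"] exI[of _ "res F1 S (S \<inter> V) s"]) auto
  qed
  have eq: "bij_betw (\<lambda>c. \<Oplus>\<^bsub>sec A1 V\<^esub>i\<in>{..<1}. c i \<odot>\<^bsub>sec A1 V\<^esub> res A1 U V (e i))
      ({..<1} \<rightarrow>\<^sub>E carrier (sec A0 V)) (carrier (sec A1 V)) \<longleftrightarrow>
    bij_betw (\<lambda>\<sigma>. \<lambda>p\<in>V. actp p (\<sigma> p) (e 0 p))
      (carrier (sheafify_sec X F0 V)) (carrier (sheafify_sec X F1 V))"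
    if e: "e 0 \<in> carrier (sheafify_sec X F1 U)" and V: "openin X V" "V \<subseteq> U" for e :: "nat \<Rightarrow> _" and V
  proof -
    have "bij_betw (\<lambda>c. \<Oplus>\<^bsub>sec A1 V\<^esub>i\<in>{..<1}. c i \<odot>\<^bsub>sec A1 V\<^esub> res A1 U V (e i))
        ({..<1} \<rightarrow>\<^sub>E carrier (sec A0 V)) (carrier (sec A1 V)) \<longleftrightarrow>
      bij_betw ((\<lambda>\<sigma>. \<lambda>p\<in>V. actp p (\<sigma> p) (e 0 p)) \<circ> (\<lambda>c. c 0))
        ({..<1::nat} \<rightarrow>\<^sub>E carrier (sec A0 V)) (carrier (sec A1 V))"
    proof (rule bij_betw_cong)
      fix c assume "c \<in> {..<1::nat} \<rightarrow>\<^sub>E carrier (sec A0 V)"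
      then have c: "c 0 \<in> carrier (sheafify_sec X F0 V)" by (auto simp: clifford_sheaf_simps PiE_iff)
      have s: "c 0 \<odot>\<^bsub>sec A1 V\<^esub> res A1 U V (e 0) = (\<lambda>p\<in>V. actp p (c 0 p) (restrict (e 0) V p))"
        by (simp add: clifford_sheaf_simps)
      have cl: "c 0 \<odot>\<^bsub>sec A1 V\<^esub> res A1 U V (e 0) \<in> carrier (sheafify_sec X F1 V)"
        unfolding s by (rule act.act_section_closed[OF V(1) c restrict[OF e V]])
      have "(\<Oplus>\<^bsub>sec A1 V\<^esub>i\<in>{..<1}. c i \<odot>\<^bsub>sec A1 V\<^esub> res A1 U V (e i)) = c 0 \<odot>\<^bsub>sec A1 V\<^esub> res A1 U V (e 0)"
        by (rule finsum_lessThan_one)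
          (use cl sheafify_add_zero[OF V(1) cl] in \<open>simp_all add: clifford_sheaf_simps(2-4)\<close>)
      also have "\<dots> = (\<lambda>p\<in>V. actp p (c 0 p) (e 0 p))" unfolding s by (rule restrict_ext) simp
      finally show "(\<Oplus>\<^bsub>sec A1 V\<^esub>i\<in>{..<1}. c i \<odot>\<^bsub>sec A1 V\<^esub> res A1 U V (e i)) =
          ((\<lambda>\<sigma>. \<lambda>p\<in>V. actp p (\<sigma> p) (e 0 p)) \<circ> (\<lambda>c. c 0)) c" by simp
    qed
    also have "\<dots> \<longleftrightarrow> bij_betw (\<lambda>\<sigma>. \<lambda>p\<in>V. actp p (\<sigma> p) (e 0 p)) (carrier (sec A0 V)) (carrier (sec A1 V))"
      by (rule bij_betw_comp_iff[OF bij_betw_PiE_singleton, symmetric])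
    finally show ?thesis by (simp only: clifford_sheaf_simps)
  qed
  show ?thesis
  proof
    assume "free_of_rank_on 1 X A0 A1 U"
    then obtain e :: "nat \<Rightarrow> _" where e: "e \<in> {..<1} \<rightarrow> carrier (sec A1 U)"
      and bij: "\<forall>V. openin X V \<and> V \<subseteq> U \<longrightarrow>
        bij_betw (\<lambda>c. \<Oplus>\<^bsub>sec A1 V\<^esub>i\<in>{..<1}. c i \<odot>\<^bsub>sec A1 V\<^esub> res A1 U V (e i))
          ({..<1} \<rightarrow>\<^sub>E carrier (sec A0 V)) (carrier (sec A1 V))"
      unfolding free_of_rank_on_def by (elim exE conjE)
    have e0: "e 0 \<in> carrier (sheafify_sec X F1 U)" using e by (auto simp: clifford_sheaf_simps)
    show "\<exists>e\<in>carrier (sheafify_sec X F1 U). \<forall>V. openin X V \<and> V \<subseteq> U \<longrightarrow>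
       bij_betw (\<lambda>\<sigma>. \<lambda>p\<in>V. actp p (\<sigma> p) (e p))
         (carrier (sheafify_sec X F0 V)) (carrier (sheafify_sec X F1 V))"
      using bij eq[of e, OF e0] by (intro bexI[OF _ e0]) simp
  next
    assume "\<exists>e\<in>carrier (sheafify_sec X F1 U). \<forall>V. openin X V \<and> V \<subseteq> U \<longrightarrow>
       bij_betw (\<lambda>\<sigma>. \<lambda>p\<in>V. actp p (\<sigma> p) (e p))
         (carrier (sheafify_sec X F0 V)) (carrier (sheafify_sec X F1 V))"
    then obtain e where e: "e \<in> carrier (sheafify_sec X F1 U)"
      and bij: "\<forall>V. openin X V \<and> V \<subseteq> U \<longrightarrow> bij_betw (\<lambda>\<sigma>. \<lambda>p\<in>V. actp p (\<sigma> p) (e p))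
         (carrier (sheafify_sec X F0 V)) (carrier (sheafify_sec X F1 V))" by (elim bexE)
    show "free_of_rank_on 1 X A0 A1 U"
      unfolding free_of_rank_on_def
    proof (intro exI[of _ "\<lambda>_::nat. e"] conjI allI impI)
      show "(\<lambda>_. e) \<in> {..<1} \<rightarrow> carrier (sec A1 U)" using e by (simp add: clifford_sheaf_simps)
      fix V assume V: "openin X V \<and> V \<subseteq> U"
      show "bij_betw (\<lambda>c. \<Oplus>\<^bsub>sec A1 V\<^esub>i\<in>{..<1::nat}. c i \<odot>\<^bsub>sec A1 V\<^esub> res A1 U V e)
          ({..<1} \<rightarrow>\<^sub>E carrier (sec A0 V)) (carrier (sec A1 V))"
        using iffD2[OF eq[of "\<lambda>_. e" V]] bij e V by simp
    qed
  qed
qed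

end

section \<open>Primitive forms and invertible Clifford modules\<close>

lemma (in binary_quadratic_module) L_generator:
  assumes "p \<in> topspace X"
  obtains U f where "openin X U" "p \<in> U" "f \<in> carrier (sec L U)"
    "\<And>V. \<lbrakk>openin X V; V \<subseteq> U\<rbrakk> \<Longrightarrow>
      bij_betw (\<lambda>r. r \<odot>\<^bsub>sec L V\<^esub> res L U V f) (carrier (sec OX V)) (carrier (sec L V))"
proof -
  from L_invertible assms obtain U where U: "openin X U" "p \<in> U" and free: "free_of_rank_on 1 X OX L U"
    unfolding invertible_module_def locally_free_of_rank_def by blast
  from free obtain e :: "nat \<Rightarrow> _" where e: "e \<in> {..<1} \<rightarrow> carrier (sec L U)"
    and bij: "\<forall>V. openin X V \<and> V \<subseteq> U \<longrightarrow>
      bij_betw (\<lambda>c. \<Oplus>\<^bsub>sec L V\<^esub>i\<in>{..<1::nat}. c i \<odot>\<^bsub>sec L V\<^esub> res L U V (e i))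
        ({..<1} \<rightarrow>\<^sub>E carrier (sec OX V)) (carrier (sec L V))"
    unfolding free_of_rank_on_def by (elim exE conjE)
  show thesis
  proof (rule that[OF U, of "e 0"])
    show e0: "e 0 \<in> carrier (sec L U)" using e by auto
    fix V assume V: "openin X V" "V \<subseteq> U"
    show "bij_betw (\<lambda>r. r \<odot>\<^bsub>sec L V\<^esub> res L U V (e 0)) (carrier (sec OX V)) (carrier (sec L V))"
      by (rule module.free_rank_one[OF L.sec_module[OF V(1)], where e = "\<lambda>i. res L U V (e i)"])
        (use bij V L.M.res_closed[OF U(1) V e0] in simp_all)
  qed
qed

lemma (in binary_quadratic_module) M_basis:
  assumes "p \<in> topspace X"
  obtains U e where "openin X U" "p \<in> U" "e (0::nat) \<in> carrier (sec M U)" "e 1 \<in> carrier (sec M U)"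
    "\<And>V. \<lbrakk>openin X V; V \<subseteq> U\<rbrakk> \<Longrightarrow>
      bij_betw (\<lambda>c. \<Oplus>\<^bsub>sec M V\<^esub>i\<in>{..<2}. c i \<odot>\<^bsub>sec M V\<^esub> res M U V (e i))
        ({..<2} \<rightarrow>\<^sub>E carrier (sec OX V)) (carrier (sec M V))"
proof -
  from M_locally_free assms obtain U where U: "openin X U" "p \<in> U" and free: "free_of_rank_on 2 X OX M U"
    unfolding locally_free_of_rank_def by blast
  from free obtain e :: "nat \<Rightarrow> _" where e: "e \<in> {..<2} \<rightarrow> carrier (sec M U)"
    and bij: "\<forall>V. openin X V \<and> V \<subseteq> U \<longrightarrow>
      bij_betw (\<lambda>c. \<Oplus>\<^bsub>sec M V\<^esub>i\<in>{..<2::nat}. c i \<odot>\<^bsub>sec M V\<^esub> res M U V (e i))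
        ({..<2} \<rightarrow>\<^sub>E carrier (sec OX V)) (carrier (sec M V))"
    unfolding free_of_rank_on_def by (elim exE conjE)
  show thesis
    by (rule that[OF U, of e]) (use e bij in auto)
qed

lemma (in binary_quadratic_module) generated_submodule_mem:
  assumes "openin X V"
  shows "x \<in> carrier (sec M V) \<Longrightarrow> Q V x \<in> generated_submodule (sec OX V) (sec L V) (Q V ` carrier (sec M V))"
    and "submodule (generated_submodule (sec OX V) (sec L V) (Q V ` carrier (sec M V))) (sec OX V) (sec L V)"
proof -
  interpret L: Module.module "sec OX V" "sec L V" by (rule L.sec_module[OF assms])
  let ?G = "generated_submodule (sec OX V) (sec L V) (Q V ` carrier (sec M V))"
  show "x \<in> carrier (sec M V) \<Longrightarrow> Q V x \<in> ?G" by (auto simp: generated_submodule_def)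
  have G: "s \<in> ?G \<longleftrightarrow> (\<forall>H. submodule H (sec OX V) (sec L V) \<and> Q V ` carrier (sec M V) \<subseteq> H \<longrightarrow> s \<in> H)" for s
    by (auto simp: generated_submodule_def)
  have top: "submodule (carrier (sec L V)) (sec OX V) (sec L V) \<and> Q V ` carrier (sec M V) \<subseteq> carrier (sec L V)"
    using L.carrier_is_submodule Q_closed[OF assms] by auto
  show "submodule ?G (sec OX V) (sec L V)"
  proof (rule L.submoduleI)
    show "?G \<subseteq> carrier (sec L V)" using G top by blast
    show "\<zero>\<^bsub>sec L V\<^esub> \<in> ?G"
      unfolding G using subgroup.one_closed[OF submodule.axioms(1)] by fastforce
    show "\<ominus>\<^bsub>sec L V\<^esub> a \<in> ?G" if "a \<in> ?G" for a
      using that L.submoduleE(3) unfolding G by blast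
    show "a \<oplus>\<^bsub>sec L V\<^esub> b \<in> ?G" if "a \<in> ?G" "b \<in> ?G" for a b
      using that L.submoduleE(5) unfolding G by blast
    show "r \<odot>\<^bsub>sec L V\<^esub> a \<in> ?G" if "r \<in> carrier (sec OX V)" "a \<in> ?G" for r a
      using that L.submoduleE(4) unfolding G by blast
  qed
qed

lemma (in binary_quadratic_module) primitiveD:
  assumes "primitive X OX M L Q" and U: "openin X U" "p \<in> U" and s: "s \<in> carrier (sec L U)"
  shows "\<exists>V. openin X V \<and> p \<in> V \<and> V \<subseteq> U \<and>
    res L U V s \<in> generated_submodule (sec OX V) (sec L V) (Q V ` carrier (sec M V))"
proof -
  have "s \<in> {s \<in> carrier (sec L U). \<forall>p\<in>U. \<exists>V. openin X V \<and> p \<in> V \<and> V \<subseteq> U \<and>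
      res L U V s \<in> generated_submodule (sec OX V) (sec L V) (Q V ` carrier (sec M V))}"
    using s by (simp only: assms(1)[unfolded primitive_def, rule_format, OF U(1)])
  with U(2) show ?thesis by blast
qed

text \<open>Let f generate L near p, and let I be a proper ideal outside of which every element
  becomes invertible near p. If all values of Q over V lay in I f, so would f itself, by
  primitivity, and 1 would lie in I. So some value is u f with u invertible near p.\<close>

lemma (in binary_quadratic_module) primitive_unit_value:
  assumes local_X: "locally_ringed_space X OX" and prim: "primitive X OX M L Q" and p: "p \<in> topspace X"
  obtains V v g where "openin X V" "p \<in> V" "v \<in> carrier (sec M V)" "g \<in> carrier (sec N V)"
    "g V (Q V v) = \<one>\<^bsub>sec OX V\<^esub>"
proof -
  interpret X: locally_ringed_space X OX by (rule local_X)
  obtain U f where U: "openin X U" "p \<in> U" and f: "f \<in> carrier (sec L U)"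
    and gen: "\<And>V. \<lbrakk>openin X V; V \<subseteq> U\<rbrakk> \<Longrightarrow>
      bij_betw (\<lambda>r. r \<odot>\<^bsub>sec L V\<^esub> res L U V f) (carrier (sec OX V)) (carrier (sec L V))"
    using L_generator[OF p] by blast
  from primitiveD[OF prim U f] obtain V where V: "openin X V" "p \<in> V" "V \<subseteq> U"
    and fV: "res L U V f \<in> generated_submodule (sec OX V) (sec L V) (Q V ` carrier (sec M V))"
    by blast
  obtain I where I: "ideal I (sec OX V)" "\<one>\<^bsub>sec OX V\<^esub> \<notin> I"
    and unit: "\<And>u. \<lbrakk>u \<in> carrier (sec OX V); u \<notin> I\<rbrakk> \<Longrightarrow> \<exists>W t. openin X W \<and> p \<in> W \<and> W \<subseteq> V \<and>
       t \<in> carrier (sec OX W) \<and> res OX V W u \<otimes>\<^bsub>sec OX W\<^esub> t = \<one>\<^bsub>sec OX W\<^esub>"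
    using X.local_nonunits[OF V(1,2)] by blast
  interpret I: ideal I "sec OX V" by (rule I(1))
  interpret L': Module.module "sec OX V" "sec L V" by (rule L.sec_module[OF V(1)])
  let ?f = "res L U V f"
  have f': "?f \<in> carrier (sec L V)" by (rule L.M.res_closed[OF U(1) V(1,3) f])
  \<comment> \<open>The submodule I f, a candidate in the intersection that defines the generated
    submodule.\<close>
  let ?H = "(\<lambda>r. r \<odot>\<^bsub>sec L V\<^esub> ?f) ` I"
  have "submodule ?H (sec OX V) (sec L V)"
  proof (rule L'.submoduleI)
    show "?H \<subseteq> carrier (sec L V)" using f' by auto
    show "\<zero>\<^bsub>sec L V\<^esub> \<in> ?H"
      by (rule image_eqI[of _ _ "\<zero>\<^bsub>sec OX V\<^esub>"]) (use f' I.zero_closed in simp_all)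
    show "\<ominus>\<^bsub>sec L V\<^esub> a \<in> ?H" if "a \<in> ?H" for a
    proof -
      from that obtain r where r: "r \<in> I" "a = r \<odot>\<^bsub>sec L V\<^esub> ?f" by blast
      then show ?thesis using f'
        by (intro image_eqI[of _ _ "\<ominus>\<^bsub>sec OX V\<^esub> r"]) (simp_all add: L'.smult_l_minus I.a_inv_closed)
    qed
    show "a \<oplus>\<^bsub>sec L V\<^esub> b \<in> ?H" if ab: "a \<in> ?H" "b \<in> ?H" for a b
    proof -
      from ab obtain r s where r: "r \<in> I" "a = r \<odot>\<^bsub>sec L V\<^esub> ?f" "s \<in> I" "b = s \<odot>\<^bsub>sec L V\<^esub> ?f" by blast
      then show ?thesis using f'
        by (intro image_eqI[of _ _ "r \<oplus>\<^bsub>sec OX V\<^esub> s"]) (simp_all add: L'.smult_l_distr I.a_closed)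
    qed
    show "c \<odot>\<^bsub>sec L V\<^esub> a \<in> ?H" if c: "c \<in> carrier (sec OX V)" "a \<in> ?H" for c a
    proof -
      from c obtain r where r: "r \<in> I" "a = r \<odot>\<^bsub>sec L V\<^esub> ?f" by blast
      then show ?thesis using f' c
        by (intro image_eqI[of _ _ "c \<otimes>\<^bsub>sec OX V\<^esub> r"]) (simp_all add: L'.smult_assoc1 I.I_l_closed)
    qed
  qed
  moreover have "?f \<notin> ?H"
  proof
    assume "?f \<in> ?H"
    then obtain r where r: "r \<in> I" "?f = r \<odot>\<^bsub>sec L V\<^esub> ?f" by blast
    then have "\<one>\<^bsub>sec OX V\<^esub> \<odot>\<^bsub>sec L V\<^esub> ?f = r \<odot>\<^bsub>sec L V\<^esub> ?f" using f' by simp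
    from inj_onD[OF bij_betw_imp_inj_on[OF gen[OF V(1,3)]] this] r(1) I(2) show False by simp
  qed
  ultimately have "\<not> Q V ` carrier (sec M V) \<subseteq> ?H"
    using fV unfolding generated_submodule_def by blast
  then obtain x where x: "x \<in> carrier (sec M V)" "Q V x \<notin> ?H" by blast
  obtain u where u: "u \<in> carrier (sec OX V)" "Q V x = u \<odot>\<^bsub>sec L V\<^esub> ?f"
    using bij_betw_imp_surj_on[OF gen[OF V(1,3)]] Q_closed[OF V(1) x(1)] by blast
  with x(2) have "u \<notin> I" by blast
  with unit[OF u(1)] obtain W t where W: "openin X W" "p \<in> W" "W \<subseteq> V"
    and t: "t \<in> carrier (sec OX W)" "res OX V W u \<otimes>\<^bsub>sec OX W\<^esub> t = \<one>\<^bsub>sec OX W\<^esub>" by blast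
  \<comment> \<open>The coordinate with respect to f, given uniformly on every open set inside U,
    because a section of the dual is a family over all smaller open sets.\<close>
  define coeff where "coeff Z s = (THE r. r \<in> carrier (sec OX Z) \<and> s = r \<odot>\<^bsub>sec L Z\<^esub> res L U Z f)" for Z s
  have coeff: "coeff Z (r \<odot>\<^bsub>sec L Z\<^esub> res L U Z f) = r"
    if Z: "openin X Z" "Z \<subseteq> U" and r: "r \<in> carrier (sec OX Z)" for Z r
    unfolding coeff_def
    by (rule the_equality) (use r inj_onD[OF bij_betw_imp_inj_on[OF gen[OF Z]]] in auto)
  have ex: "\<exists>r\<in>carrier (sec OX Z). s = r \<odot>\<^bsub>sec L Z\<^esub> res L U Z f"
    if "openin X Z" "Z \<subseteq> U" "s \<in> carrier (sec L Z)" for Z s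
    using bij_betw_imp_surj_on[OF gen[OF that(1,2)]] that(3) by blast
  \<comment> \<open>The coordinate form multiplied by the inverse t of u; so it takes u f to
    1.\<close>
  define g where "g = (\<lambda>Z\<in>{Z. openin X Z \<and> Z \<subseteq> W}. \<lambda>s\<in>carrier (sec L Z). res OX W Z t \<otimes>\<^bsub>sec OX Z\<^esub> coeff Z s)"
  have "g \<in> carrier (sec N W)"
    unfolding g_def
  proof (rule dualI)
    fix Z assume Z: "openin X Z" "Z \<subseteq> W"
    then have ZU: "Z \<subseteq> U" using W V by blast
    interpret R: cring "sec OX Z" by (rule M.OX.sec_cring[OF Z(1)])
    interpret LZ: Module.module "sec OX Z" "sec L Z" by (rule L.sec_module[OF Z(1)])
    have fZ: "res L U Z f \<in> carrier (sec L Z)" by (rule L.M.res_closed[OF U(1) Z(1) ZU f])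
    have tZ: "res OX W Z t \<in> carrier (sec OX Z)" by (rule OX_res(1)[OF W(1) Z t(1)])
    show "res OX W Z t \<otimes>\<^bsub>sec OX Z\<^esub> coeff Z s \<in> carrier (sec OX Z)" if s: "s \<in> carrier (sec L Z)" for s
    proof -
      from ex[OF Z(1) ZU s] obtain r where "r \<in> carrier (sec OX Z)" "s = r \<odot>\<^bsub>sec L Z\<^esub> res L U Z f" by blast
      then show ?thesis using coeff[OF Z(1) ZU] tZ by simp
    qed
    show "res OX W Z t \<otimes>\<^bsub>sec OX Z\<^esub> coeff Z (s \<oplus>\<^bsub>sec L Z\<^esub> s') =
        res OX W Z t \<otimes>\<^bsub>sec OX Z\<^esub> coeff Z s \<oplus>\<^bsub>sec OX Z\<^esub> res OX W Z t \<otimes>\<^bsub>sec OX Z\<^esub> coeff Z s'"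
      if s: "s \<in> carrier (sec L Z)" "s' \<in> carrier (sec L Z)" for s s'
    proof -
      from ex[OF Z(1) ZU s(1)] ex[OF Z(1) ZU s(2)] obtain r r' where r: "r \<in> carrier (sec OX Z)"
        "s = r \<odot>\<^bsub>sec L Z\<^esub> res L U Z f" "r' \<in> carrier (sec OX Z)" "s' = r' \<odot>\<^bsub>sec L Z\<^esub> res L U Z f" by blast
      have "s \<oplus>\<^bsub>sec L Z\<^esub> s' = (r \<oplus>\<^bsub>sec OX Z\<^esub> r') \<odot>\<^bsub>sec L Z\<^esub> res L U Z f"
        using r fZ by (simp add: LZ.smult_l_distr)
      then show ?thesis using coeff[OF Z(1) ZU] tZ r by (simp add: R.r_distr)
    qed
    show "res OX W Z t \<otimes>\<^bsub>sec OX Z\<^esub> coeff Z (c \<odot>\<^bsub>sec L Z\<^esub> s) =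
        c \<otimes>\<^bsub>sec OX Z\<^esub> (res OX W Z t \<otimes>\<^bsub>sec OX Z\<^esub> coeff Z s)"
      if c: "c \<in> carrier (sec OX Z)" and s: "s \<in> carrier (sec L Z)" for c s
    proof -
      from ex[OF Z(1) ZU s] obtain r where r: "r \<in> carrier (sec OX Z)" "s = r \<odot>\<^bsub>sec L Z\<^esub> res L U Z f" by blast
      have "c \<odot>\<^bsub>sec L Z\<^esub> s = (c \<otimes>\<^bsub>sec OX Z\<^esub> r) \<odot>\<^bsub>sec L Z\<^esub> res L U Z f"
        using r fZ c by (simp add: LZ.smult_assoc1)
      then show ?thesis using coeff[OF Z(1) ZU] tZ r c by (simp add: R.m_lcomm)
    qed
    fix Y s assume Y: "openin X Y" "Y \<subseteq> Z" and s: "s \<in> carrier (sec L Z)"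
    have YU: "Y \<subseteq> U" using Y ZU by blast
    from ex[OF Z(1) ZU s] obtain r where r: "r \<in> carrier (sec OX Z)" "s = r \<odot>\<^bsub>sec L Z\<^esub> res L U Z f" by blast
    have "res L Z Y s = res OX Z Y r \<odot>\<^bsub>sec L Y\<^esub> res L U Y f"
      using r L.res_smult[OF Z(1) Y r(1) fZ] L.M.res_comp[OF U(1) Z(1) Y(1) Y(2) ZU f] by simp
    then show "res OX W Y t \<otimes>\<^bsub>sec OX Y\<^esub> coeff Y (res L Z Y s) =
        res OX Z Y (res OX W Z t \<otimes>\<^bsub>sec OX Z\<^esub> coeff Z s)"
      using r tZ coeff[OF Z(1) ZU] coeff[OF Y(1) YU] OX_res(1,2)[OF Z(1) Y]
        M.OX.res_comp[OF W(1) Z(1) Y(1) Y(2) Z(2) t(1)] by simp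
  qed
  moreover have "res M V W x \<in> carrier (sec M W)" by (rule M.M.res_closed[OF V(1) W(1,3) x(1)])
  moreover have "g W (Q W (res M V W x)) = \<one>\<^bsub>sec OX W\<^esub>"
  proof -
    interpret R: cring "sec OX W" by (rule M.OX.sec_cring[OF W(1)])
    have WU: "W \<subseteq> U" using W V by blast
    have uW: "res OX V W u \<in> carrier (sec OX W)" by (rule OX_res(1)[OF V(1) W(1,3) u(1)])
    have "Q W (res M V W x) = res OX V W u \<odot>\<^bsub>sec L W\<^esub> res L U W f"
      using Q_res[OF V(1) W(1,3) x(1)] u L.res_smult[OF V(1) W(1,3) u(1) f']
        L.M.res_comp[OF U(1) V(1) W(1) W(3) V(3) f] by simp
    moreover have "Q W (res M V W x) \<in> carrier (sec L W)"
      by (rule Q_closed[OF W(1) M.M.res_closed[OF V(1) W(1,3) x(1)]])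
    ultimately show ?thesis
      using coeff[OF W(1) WU uW] t uW W(1) M.OX.res_id[OF W(1) t(1)] by (simp add: g_def R.m_comm)
  qed
  ultimately show thesis using that[OF W(1,2)] by blast
qed

text \<open>The equation g (Q v) = 1 is inherited by all smaller open sets. So multiplication by v
  is bijective on the presheaf sections over each of them, as \<open>sheafify_bij\<close> demands,
  and the germs of v form the generator.\<close>

lemma (in binary_quadratic_module) primitive_imp_invertible:
  assumes "locally_ringed_space X OX" and "primitive X OX M L Q"
  shows "invertible_module X A0 A1"
  unfolding invertible_module_def locally_free_of_rank_def
proof
  interpret act: presheaf_action X F0 F1 "\<lambda>U. smult (sec F1 U)" by (rule F_action)
  fix p assume "p \<in> topspace X"
  with primitive_unit_value[OF assms] obtain V v g where V: "openin X V" "p \<in> V"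
    and v: "v \<in> carrier (sec M V)" and g: "g \<in> carrier (sec N V)" and one: "g V (Q V v) = \<one>\<^bsub>sec OX V\<^esub>" by blast
  let ?b = "\<lambda>W v. cls W (Suc 0) (word_term (sec OX W) \<one>\<^bsub>sec OX W\<^esub> [v] [])"
  interpret V: clifford_setting "sec OX V" "sec M V" "sec N V" "qf V" by (rule clifford_setting[OF V(1)])
  have vw: "word_term (sec OX V) \<one>\<^bsub>sec OX V\<^esub> [v] [] \<in> WP V (Suc 0)" using v by simp
  have b: "?b V v \<in> carrier (sec F1 V)"
    unfolding F_carrier[OF V(1)] by (rule imageI[OF vw])
  have bij: "bij_betw (\<lambda>a. a \<odot>\<^bsub>sec F1 W\<^esub> res F1 V W (?b V v)) (carrier (sec F0 W)) (carrier (sec F1 W))"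
    if W: "openin X W" "W \<subseteq> V" for W
  proof -
    interpret VW: clifford_morphism "sec OX V" "sec M V" "sec N V" "qf V" "sec OX W" "sec M W" "sec N W" "qf W"
      "res OX V W" "res M V W" "res N V W" by (rule clifford_morphism[OF V(1) W])
    have "res F1 V W (?b V v) = ?b W (res M V W v)"
      using F_res(2)[OF V(1) W vw] v by (simp add: VW.wm_wt)
    moreover have "qf W (res N V W g) (res M V W v) = \<one>\<^bsub>sec OX W\<^esub>"
      using VW.q_compat[OF g v] one by simp
    ultimately show ?thesis
      using VW.B.clifford_unit_bij[of "res M V W v" "res N V W g"] v g by (simp add: F_sec)
  qed
  define e where "e = (\<lambda>q\<in>V. germ X F1 q V (?b V v))"
  have "e \<in> carrier (sheafify_sec X F1 V)" unfolding e_def by (rule act.B.germ_section[OF V(1) b])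
  moreover have "bij_betw (\<lambda>\<sigma>. \<lambda>p\<in>W. actp p (\<sigma> p) (e p))
      (carrier (sheafify_sec X F0 W)) (carrier (sheafify_sec X F1 W))" if W: "openin X W" "W \<subseteq> V" for W
  proof -
    have "(\<lambda>p\<in>W. actp p (\<sigma> p) (e p)) = (\<lambda>p\<in>W. actp p (\<sigma> p) (germ X F1 p V (?b V v)))" for \<sigma>
      using W(2) by (intro restrict_ext) (auto simp: e_def)
    then show ?thesis using act.sheafify_bij[OF V(1) b bij W] by simp
  qed
  ultimately have "free_of_rank_on 1 X A0 A1 V" unfolding free_of_rank_one_iff[OF V(1)] by blast
  with V show "\<exists>U. openin X U \<and> p \<in> U \<and> free_of_rank_on 1 X A0 A1 U" by blast
qed

text \<open>Near p the generator e is given by a section \<omega> of the odd presheaf, and on some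
  neighbourhood W of p both basis vectors of M are even multiples of \<omega>. There
  \<open>cyclic_imp_unit_ideal\<close> is applied to the ideal of all r for which r f lies in the
  module generated by the values of Q.\<close>

lemma (in binary_quadratic_module) invertible_imp_primitive:
  assumes inv: "invertible_module X A0 A1"
  shows "primitive X OX M L Q"
  unfolding primitive_def
proof (intro allI impI equalityI subsetI)
  interpret act: presheaf_action X F0 F1 "\<lambda>U. smult (sec F1 U)" by (rule F_action)
  fix U s assume U: "openin X U" and s: "s \<in> carrier (sec L U)"
  have "\<exists>W. openin X W \<and> p \<in> W \<and> W \<subseteq> U \<and>
      res L U W s \<in> generated_submodule (sec OX W) (sec L W) (Q W ` carrier (sec M W))" if p: "p \<in> U" for p
  proof -
    have pX: "p \<in> topspace X" using p U openin_subset by blast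
    from inv pX obtain U1 where U1: "openin X U1" "p \<in> U1" and free: "free_of_rank_on 1 X A0 A1 U1"
      unfolding invertible_module_def locally_free_of_rank_def by blast
    from free obtain e where e: "e \<in> carrier (sheafify_sec X F1 U1)"
      and bij: "\<forall>V. openin X V \<and> V \<subseteq> U1 \<longrightarrow> bij_betw (\<lambda>\<sigma>. \<lambda>p\<in>V. actp p (\<sigma> p) (e p))
        (carrier (sheafify_sec X F0 V)) (carrier (sheafify_sec X F1 V))"
      unfolding free_of_rank_one_iff[OF U1(1)] by (elim bexE)
    obtain U2 f where U2: "openin X U2" "p \<in> U2" and f: "f \<in> carrier (sec L U2)"
      and genL: "\<And>V. \<lbrakk>openin X V; V \<subseteq> U2\<rbrakk> \<Longrightarrow>
        bij_betw (\<lambda>r. r \<odot>\<^bsub>sec L V\<^esub> res L U2 V f) (carrier (sec OX V)) (carrier (sec L V))"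
      using L_generator[OF pX] by blast
    obtain U3 x where U3: "openin X U3" "p \<in> U3" and x: "x (0::nat) \<in> carrier (sec M U3)" "x 1 \<in> carrier (sec M U3)"
      and basis: "\<And>V. \<lbrakk>openin X V; V \<subseteq> U3\<rbrakk> \<Longrightarrow>
        bij_betw (\<lambda>c. \<Oplus>\<^bsub>sec M V\<^esub>i\<in>{..<2}. c i \<odot>\<^bsub>sec M V\<^esub> res M U3 V (x i))
          ({..<2} \<rightarrow>\<^sub>E carrier (sec OX V)) (carrier (sec M V))"
      using M_basis[OF pX] by blast
    \<comment> \<open>Here s, the generator e of the odd module, the generator f of L and the basis
      x of M are all available.\<close>
    define V where "V = U \<inter> U1 \<inter> U2 \<inter> U3"
    have V: "openin X V" "p \<in> V" "V \<subseteq> U" "V \<subseteq> U1" "V \<subseteq> U2" "V \<subseteq> U3"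
      unfolding V_def using U U1 U2 U3 p by auto
    from e U1(2) obtain Z \<omega> where Z: "openin X Z" "p \<in> Z" "Z \<subseteq> U1" "\<omega> \<in> carrier (sec F1 Z)"
      and eZ: "\<forall>q\<in>Z. e q = germ X F1 q Z \<omega>" by (rule act.B.sheafify_secE)
    let ?v = "\<lambda>W y. word_term (sec OX W) \<one>\<^bsub>sec OX W\<^esub> [y] []"
    let ?b = "\<lambda>W y. cls W (Suc 0) (?v W y)"
    have vw: "?v W y \<in> WP W (Suc 0)" if "openin X W" "y \<in> carrier (sec M W)" for W y
    proof -
      interpret clifford_setting "sec OX W" "sec M W" "sec N W" "qf W" by (rule clifford_setting[OF that(1)])
      show ?thesis using that(2) by simp
    qed
    have b_res: "res F1 V W (?b V y) = ?b W (res M V W y)"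
      if W: "openin X W" "W \<subseteq> V" and y: "y \<in> carrier (sec M V)" for W y
    proof -
      interpret VW: clifford_morphism "sec OX V" "sec M V" "sec N V" "qf V" "sec OX W" "sec M W" "sec N W" "qf W"
        "res OX V W" "res M V W" "res N V W" by (rule clifford_morphism[OF V(1) W])
      show ?thesis using F_res(2)[OF V(1) W vw[OF V(1) y]] y by (simp add: VW.wm_wt)
    qed
    \<comment> \<open>Surjectivity over V writes the class of y as \<sigma> e in the sheafification.
      Near p the section \<sigma> comes from the even presheaf, and the equality of germs at p then
      holds between presheaf sections on a neighbourhood.\<close>
    have multiple: "\<exists>W a. openin X W \<and> p \<in> W \<and> W \<subseteq> Z \<and> W \<subseteq> V \<and> a \<in> carrier (sec F0 W) \<and>
        a \<odot>\<^bsub>sec F1 W\<^esub> res F1 Z W \<omega> = res F1 V W (?b V y)" if y: "y \<in> carrier (sec M V)" for y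
    proof -
      have b: "?b V y \<in> carrier (sec F1 V)" unfolding F_carrier[OF V(1)] by (rule imageI[OF vw[OF V(1) y]])
      have "(\<lambda>q\<in>V. germ X F1 q V (?b V y)) \<in> (\<lambda>\<sigma>. \<lambda>p\<in>V. actp p (\<sigma> p) (e p)) ` carrier (sheafify_sec X F0 V)"
        using act.B.germ_section[OF V(1) b] bij_betw_imp_surj_on[OF bij[rule_format, of V]] V by simp
      then obtain \<sigma> where \<sigma>: "\<sigma> \<in> carrier (sheafify_sec X F0 V)"
        "(\<lambda>q\<in>V. germ X F1 q V (?b V y)) = (\<lambda>p\<in>V. actp p (\<sigma> p) (e p))" by (elim imageE)
      from \<sigma>(1) V(2) obtain S a where S: "openin X S" "p \<in> S" "S \<subseteq> V" "a \<in> carrier (sec F0 S)"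
        "\<forall>q\<in>S. \<sigma> q = germ X F0 q S a" by (rule act.A.sheafify_secE)
      have "actp p (germ X F0 p S a) (germ X F1 p Z \<omega>) = germ X F1 p V (?b V y)"
        using fun_cong[OF \<sigma>(2), of p] V(2) S Z(2) eZ by simp
      then obtain W where W: "openin X W" "p \<in> W" "W \<subseteq> S" "W \<subseteq> Z" "W \<subseteq> V"
        "res F0 S W a \<odot>\<^bsub>sec F1 W\<^esub> res F1 Z W \<omega> = res F1 V W (?b V y)"
        by (rule act.act_germ_eqE[OF S(1,2,4) Z(1,2,4) V(1,2) b])
      moreover have "res F0 S W a \<in> carrier (sec F0 W)" by (rule act.A.res_closed[OF S(1) W(1,3) S(4)])
      ultimately show ?thesis by blast
    qed
    have xV: "res M U3 V (x 0) \<in> carrier (sec M V)" "res M U3 V (x 1) \<in> carrier (sec M V)"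
      using M.M.res_closed[OF U3(1) V(1,6)] x by auto
    from multiple[OF xV(1)] obtain W0 a0 where W0: "openin X W0" "p \<in> W0" "W0 \<subseteq> Z" "W0 \<subseteq> V"
      "a0 \<in> carrier (sec F0 W0)" "a0 \<odot>\<^bsub>sec F1 W0\<^esub> res F1 Z W0 \<omega> = res F1 V W0 (?b V (res M U3 V (x 0)))" by blast
    from multiple[OF xV(2)] obtain W1 a1 where W1: "openin X W1" "p \<in> W1" "W1 \<subseteq> Z" "W1 \<subseteq> V"
      "a1 \<in> carrier (sec F0 W1)" "a1 \<odot>\<^bsub>sec F1 W1\<^esub> res F1 Z W1 \<omega> = res F1 V W1 (?b V (res M U3 V (x 1)))" by blast
    \<comment> \<open>Each of the two basis vectors came with its own neighbourhood of p.\<close>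
    define W where "W = W0 \<inter> W1"
    have W: "openin X W" "p \<in> W" "W \<subseteq> W0" "W \<subseteq> W1" "W \<subseteq> V" "W \<subseteq> Z" unfolding W_def using W0 W1 by auto
    have WU: "W \<subseteq> U" "W \<subseteq> U2" "W \<subseteq> U3" using W V by auto
    interpret W: clifford_setting "sec OX W" "sec M W" "sec N W" "qf W" by (rule clifford_setting[OF W(1)])
    interpret MW: Module.module "sec OX W" "sec M W" by (rule M.sec_module[OF W(1)])
    interpret LW: Module.module "sec OX W" "sec L W" by (rule L.sec_module[OF W(1)])
    have xW: "res M U3 W (x 0) \<in> carrier (sec M W)" "res M U3 W (x 1) \<in> carrier (sec M W)"
      using M.M.res_closed[OF U3(1) W(1) WU(3)] x by auto
    have restrict_eq: "\<exists>c\<in>WP W 0. cls W 0 c \<odot>\<^bsub>sec F1 W\<^esub> res F1 Z W \<omega> = ?b W (res M U3 W (x i))"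
      if S: "openin X S" "S \<subseteq> Z" "S \<subseteq> V" "W \<subseteq> S" and a: "a \<in> carrier (sec F0 S)"
        and xi: "x i \<in> carrier (sec M U3)"
        and eq: "a \<odot>\<^bsub>sec F1 S\<^esub> res F1 Z S \<omega> = res F1 V S (?b V (res M U3 V (x i)))" for S a i
    proof -
      have xiV: "res M U3 V (x i) \<in> carrier (sec M V)" by (rule M.M.res_closed[OF U3(1) V(1,6) xi])
      have b: "?b V (res M U3 V (x i)) \<in> carrier (sec F1 V)"
        unfolding F_carrier[OF V(1)] by (rule imageI[OF vw[OF V(1) xiV]])
      have "res F1 S W (a \<odot>\<^bsub>sec F1 S\<^esub> res F1 Z S \<omega>) = res F0 S W a \<odot>\<^bsub>sec F1 W\<^esub> res F1 Z W \<omega>"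
        using act.f_res[OF S(1) W(1) S(4) a act.B.res_closed[OF Z(1) S(1,2) Z(4)]]
          act.B.res_comp[OF Z(1) S(1) W(1) S(4,2) Z(4)] by simp
      moreover have "res F1 S W (res F1 V S (?b V (res M U3 V (x i)))) = ?b W (res M U3 W (x i))"
        using act.B.res_comp[OF V(1) S(1) W(1) S(4,3) b] b_res[OF W(1,5) xiV]
          M.M.res_comp[OF U3(1) V(1) W(1) W(5) V(6) xi] by simp
      ultimately have "res F0 S W a \<odot>\<^bsub>sec F1 W\<^esub> res F1 Z W \<omega> = ?b W (res M U3 W (x i))" using eq by simp
      moreover have "res F0 S W a \<in> cls W 0 ` WP W 0"
        using act.A.res_closed[OF S(1) W(1) S(4) a] unfolding F_carrier[OF W(1)] .
      ultimately show ?thesis by (elim imageE) auto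
    qed
    obtain c d where cd: "c \<in> WP W 0" "d \<in> WP W 0"
      "cls W 0 c \<odot>\<^bsub>sec F1 W\<^esub> res F1 Z W \<omega> = ?b W (res M U3 W (x 0))"
      "cls W 0 d \<odot>\<^bsub>sec F1 W\<^esub> res F1 Z W \<omega> = ?b W (res M U3 W (x 1))"
      using restrict_eq[OF W0(1,3,4) W(3) W0(5) x(1) W0(6)] restrict_eq[OF W1(1,3,4) W(4) W1(5) x(2) W1(6)]
      by blast
    have "res F1 Z W \<omega> \<in> cls W (Suc 0) ` WP W (Suc 0)"
      using act.B.res_closed[OF Z(1) W(1,6) Z(4)] unfolding F_carrier[OF W(1)] .
    then obtain w where w: "w \<in> WP W (Suc 0)" "res F1 Z W \<omega> = cls W (Suc 0) w" by (elim imageE)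
    have basisW: "bij_betw (\<lambda>c. \<Oplus>\<^bsub>sec M W\<^esub>i\<in>{..<2}. c i \<odot>\<^bsub>sec M W\<^esub> res M U3 W (x i))
        ({..<2} \<rightarrow>\<^sub>E carrier (sec OX W)) (carrier (sec M W))" by (rule basis[OF W(1) WU(3)])
    obtain l k where lk: "W.linear_form l" "W.linear_form k"
      "l (res M U3 W (x 0)) = \<one>\<^bsub>sec OX W\<^esub>" "l (res M U3 W (x 1)) = \<zero>\<^bsub>sec OX W\<^esub>"
      "k (res M U3 W (x 0)) = \<zero>\<^bsub>sec OX W\<^esub>" "k (res M U3 W (x 1)) = \<one>\<^bsub>sec OX W\<^esub>"
    proof (rule MW.coordinates[OF xW basisW], goal_cases)
      case (1 l k)
      then show ?case by (intro that[of l k]) (simp_all add: W.linear_form_def)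
    qed
    let ?G = "generated_submodule (sec OX W) (sec L W) (Q W ` carrier (sec M W))"
    let ?f = "res L U2 W f"
    have G: "submodule ?G (sec OX W) (sec L W)" by (rule generated_submodule_mem(2)[OF W(1)])
    have fW: "?f \<in> carrier (sec L W)" by (rule L.M.res_closed[OF U2(1) W(1) WU(2) f])
    have surj: "\<exists>r\<in>carrier (sec OX W). y = r \<odot>\<^bsub>sec L W\<^esub> ?f" if "y \<in> carrier (sec L W)" for y
      using bij_betw_imp_surj_on[OF genL[OF W(1) WU(2)]] that by blast
    \<comment> \<open>Since f generates L, this ideal is the whole ring exactly when the values of Q
      generate all of L over W.\<close>
    let ?I = "{r \<in> carrier (sec OX W). r \<odot>\<^bsub>sec L W\<^esub> ?f \<in> ?G}"
    have "ideal ?I (sec OX W)"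
    proof (rule idealI[OF W.ring_axioms])
      show "subgroup ?I (add_monoid (sec OX W))"
      proof (rule W.add.subgroupI)
        have "\<zero>\<^bsub>sec L W\<^esub> \<in> ?G" using subgroup.one_closed[OF submodule.axioms(1)[OF G]] by simp
        then have "\<zero>\<^bsub>sec OX W\<^esub> \<in> ?I" using fW by simp
        then show "?I \<noteq> {}" by blast
      qed (use fW LW.submoduleE[OF G] in \<open>auto simp: LW.smult_l_minus LW.smult_l_distr\<close>)
      show "r \<otimes>\<^bsub>sec OX W\<^esub> a \<in> ?I" "a \<otimes>\<^bsub>sec OX W\<^esub> r \<in> ?I"
        if a: "a \<in> ?I" and r: "r \<in> carrier (sec OX W)" for a r
      proof -
        show "r \<otimes>\<^bsub>sec OX W\<^esub> a \<in> ?I"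
          using a r fW LW.submoduleE(4)[OF G] by (simp add: LW.smult_assoc1)
        then show "a \<otimes>\<^bsub>sec OX W\<^esub> r \<in> ?I" using a r by (simp add: W.m_comm)
      qed
    qed
    \<comment> \<open>With Q y = r f one has h (Q y) f = h(f) r f = h(f) Q y, which lies in the
      generated module.\<close>
    moreover have "h W (Q W y) \<in> ?I" if h: "h \<in> carrier (sec N W)" and y: "y \<in> carrier (sec M W)" for h y
    proof -
      from surj[OF Q_closed[OF W(1) y]] obtain r where r: "r \<in> carrier (sec OX W)" "Q W y = r \<odot>\<^bsub>sec L W\<^esub> ?f" by blast
      have hf: "h W ?f \<in> carrier (sec OX W)" using dualD(1)[OF h W(1)] fW by simp
      have "h W (Q W y) = h W ?f \<otimes>\<^bsub>sec OX W\<^esub> r"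
        using dualD(3)[OF h W(1) _ r(1) fW] r hf by (simp add: W.m_comm)
      moreover have "h W ?f \<odot>\<^bsub>sec L W\<^esub> Q W y \<in> ?G"
        using LW.submoduleE(4)[OF G hf generated_submodule_mem(1)[OF W(1) y]] .
      ultimately show ?thesis using r hf fW by (simp add: LW.smult_assoc1)
    qed
    moreover have "cls W (Suc 0) (c \<otimes>\<^bsub>WA W\<^esub> w) = ?b W (res M U3 W (x 0))"
      "cls W (Suc 0) (d \<otimes>\<^bsub>WA W\<^esub> w) = ?b W (res M U3 W (x 1))"
      using cd w F_smult[OF W(1) cd(1) w(1)] F_smult[OF W(1) cd(2) w(1)] by simp_all
    ultimately have "\<one>\<^bsub>sec OX W\<^esub> \<in> ?I"
      by (intro W.cyclic_imp_unit_ideal[OF _ _ w(1) cd(1,2) xW lk(1,3,4) lk(2,5,6)])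
    \<comment> \<open>Once f itself is generated by values of Q, so is the restriction of s, which
      is a multiple of f.\<close>
    then have fG: "?f \<in> ?G" using fW by simp
    have sW: "res L U W s \<in> carrier (sec L W)" by (rule L.M.res_closed[OF U W(1) WU(1) s])
    from surj[OF this] fG LW.submoduleE(4)[OF G] have "res L U W s \<in> ?G" by auto
    with W WU show ?thesis by blast
  qed
  with s show "s \<in> {s \<in> carrier (sec L U). \<forall>p\<in>U. \<exists>V. openin X V \<and> p \<in> V \<and> V \<subseteq> U \<and>
      res L U V s \<in> generated_submodule (sec OX V) (sec L V) (Q V ` carrier (sec M V))}" by simp
qed simp

theorem proposition5p3p2:
  fixes X :: "'x topology" and OX :: "('x, 'r) ring_presheaf"
    and M :: "('x, 'r, 'm) module_presheaf" and L :: "('x, 'r, 'l) module_presheaf"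
    and Q :: "'x set \<Rightarrow> 'm \<Rightarrow> 'l"
  assumes "scheme X OX"
    and "binary_quadratic_module X OX M L Q"
  shows "primitive X OX M L Q \<longleftrightarrow>
    invertible_module X (even_clifford X OX M L Q) (odd_clifford X OX M L Q)"
  using binary_quadratic_module.primitive_imp_invertible[OF assms(2) scheme.axioms(1)[OF assms(1)]]
    binary_quadratic_module.invertible_imp_primitive[OF assms(2)] by blast

end
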